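(* Let $n\ge2$ and $m\in\{1,\dots,n-1\}$. If $K_j,K\in\mathcal{K}_o^n$ ($j\in\mathbb{N}$) and $K_j$ converges to $K$ in the Hausdorff metric, then $\widetilde{C}^a_{m}(K_j,\cdot)$ converges weakly to $\widetilde{C}^a_{m}(K,\cdot)$.
   Context: $\mathcal{K}_o^n$ is the set of compact convex sets in $\mathbb{R}^n$ containing the origin $o$. $\rho_K(u)=\max\{t\ge 0: tu\in K\}$ for $u\in S^{n-1}$. For $z\in\partial K$, $N(K,z)=\{y\in\mathbb{R}^n: y\cdot(x-z)\le0\ \text{for all }x\in K\}$ is the normal cone. For Borel $\eta\subset S^{n-1}$, if $\operatorname{int}K\ne\emptyset$, $\boldsymbol{\alpha}_K^*(\eta)$ is the set of $u\in S^{n-1}$ such that $N(K,\rho_K(u)u)\cap\eta\neq\emptyset$. $G(n,m)$ is the Grassmannian of $m$-dimensional linear subspaces of $\mathbb{R}^n$, $\omega_j$ is the volume of the unit ball in $\mathbb{R}^j$, and $|L|$ is the $m$-dimensional volume of a set $L$ contained in an $m$-dimensional subspace. The $m$-dimensional dual Radon transform of $F:G(n,m)\to\mathbb{R}$ is $$\mathcal{R}_m^*F(u)=\frac{m\omega_m}{n\omega_n}\int_{G_u(n-1,m-1)}F(\operatorname{span}\{u,\zeta\})\,d\nu_{m-1}(\zeta),\quad u\in S^{n-1},$$ where $G_u(n-1,m-1)$ is the Grassmannian of $(m-1)$-dimensional subspaces of $u^\perp$ with Haar probability measure $\nu_{m-1}$. $\mathcal{R}_m^*(|K\cap\cdot|^{n-1})$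 is this transform applied to $F(\xi)=|K\cap\xi|^{n-1}$. The affine dual curvature measure of $K\in\mathcal{K}_o^n$ is the Borel measure on $S^{n-1}$ given by $\widetilde{C}^a_m(K,\cdot)=0$ if $\dim K\le n-1$, and, if $\operatorname{int}K\neq\emptyset$, $$\widetilde{C}_{m}^a(K,\eta)=\int_{\boldsymbol{\alpha}_K^*(\eta)}\rho_K(u)^{m}\,\mathcal{R}_m^*(|K\cap\cdot|^{n-1})(u)\,du$$ for Borel $\eta\subset S^{n-1}$, with $du$ spherical Lebesgue measure. (When $o\in\partial K$, $\rho_K(u)=0$ for every $u$ outside the dual cone $N(K,o)^*=\{y: y\cdot x\le0\ \forall x\in N(K,o)\}$, so only $u\in \operatorname{int}N(K,o)^*$ contribute.) Weak convergence means convergence of integrals of every continuous function on $S^{n-1}$. *)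

theory Defs
  imports "HOL-Analysis.Analysis"
begin

text \<open>Throughout, the ambient space is \<open>real^'n\<close>, and \<open>CARD('n)\<close> plays the role of the dimension \<open>n\<close>.\<close>

definition convex_bodies_o :: "(real^'n) set set" where
  "convex_bodies_o = {K. compact K \<and> convex K \<and> 0 \<in> K}"

text \<open>The suprema are finite for nonempty bounded sets, the only case of interest here.\<close>

definition hausdorff_dist :: "'a::metric_space set \<Rightarrow> 'a set \<Rightarrow> real" where
  "hausdorff_dist A B = max (SUP x\<in>A. infdist x B) (SUP y\<in>B. infdist y A)"

definition radial_fun :: "(real^'n) set \<Rightarrow> real^'n \<Rightarrow> real" where
  "radial_fun K u = (GREATEST t. 0 \<le> t \<and> t *\<^sub>R u \<in> K)"

definition normal_cone_at :: "(real^'n) set \<Rightarrow> real^'n \<Rightarrow> (real^'n) set" where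
  "normal_cone_at K z = {y. \<forall>x\<in>K. y \<bullet> (x - z) \<le> 0}"

definition reverse_radial_gauss_image :: "(real^'n) set \<Rightarrow> (real^'n) set \<Rightarrow> (real^'n) set" where
  "reverse_radial_gauss_image K \<eta> =
     {u \<in> sphere 0 1. normal_cone_at K (radial_fun K u *\<^sub>R u) \<inter> \<eta> \<noteq> {}}"

abbreviation sphere_borel :: "(real^'n) measure" where
  "sphere_borel \<equiv> restrict_space borel (sphere 0 1)"

text \<open>
  Spherical Lebesgue measure, as the cone measure: the measure of a Borel set \<open>A\<close> is \<open>n\<close> times
  the volume of the cone \<open>{x. 0 < norm x \<and> norm x < 1 \<and> x /\<^sub>R norm x \<in> A}\<close>.  It is completed
  because for Borel \<open>\<eta>\<close> the set \<open>reverse_radial_gauss_image K \<eta>\<close> is Lebesgue measurable,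
  but not obviously Borel.
\<close>

definition sphere_lebesgue :: "(real^'n) measure" where
  "sphere_lebesgue = completion (scale_measure (of_nat CARD('n))
     (distr (restrict_space lborel (ball 0 1 - {0})) sphere_borel sgn))"

text \<open>
  \<open>k\<close>-dimensional Lebesgue measure on a \<open>k\<close>-dimensional subspace, in the coordinates of an
  orthonormal basis; compare the library's definition of \<open>lborel\<close>.  The measure does not depend
  on the basis chosen.
\<close>

definition orthonormal_basis_of :: "(real^'n) set \<Rightarrow> (real^'n) set" where
  "orthonormal_basis_of \<xi> =
     (SOME B. pairwise orthogonal B \<and> (\<forall>b\<in>B. norm b = 1) \<and> span B = \<xi>)"

definition subspace_lborel :: "(real^'n) set \<Rightarrow> (real^'n) measure" where
  "subspace_lborel \<xi> =
     distr (\<Pi>\<^sub>M b\<in>orthonormal_basis_of \<xi>. lborel) borel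
       (\<lambda>c. \<Sum>b\<in>orthonormal_basis_of \<xi>. c b *\<^sub>R b)"

definition section_vol :: "(real^'n) set \<Rightarrow> (real^'n) set \<Rightarrow> real" where
  "section_vol K \<xi> = measure (subspace_lborel \<xi>) (K \<inter> \<xi>)"

text \<open>The Grassmannian of \<open>k\<close>-dimensional linear subspaces of the hyperplane orthogonal to \<open>u\<close>.\<close>

definition grassmannian_perp :: "real^'n \<Rightarrow> nat \<Rightarrow> (real^'n) set set" where
  "grassmannian_perp u k = {\<zeta>. subspace \<zeta> \<and> dim \<zeta> = k \<and> (\<forall>x\<in>\<zeta>. u \<bullet> x = 0)}"

text \<open>
  The topology of the Grassmannian is the one that makes \<open>\<zeta> \<mapsto>\<close> (matrix of the orthogonal
  projection onto \<open>\<zeta>\<close>) an embedding; for a subspace \<open>\<zeta>\<close> this projection is \<open>closest_point \<zeta>\<close>.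
\<close>

definition grassmannian_perp_borel :: "real^'n \<Rightarrow> nat \<Rightarrow> (real^'n) set measure" where
  "grassmannian_perp_borel u k =
     vimage_algebra (grassmannian_perp u k) (\<lambda>\<zeta>. matrix (closest_point \<zeta>)) borel"

text \<open>
  The orthogonal group of the hyperplane orthogonal to \<open>u\<close> is the stabilizer of \<open>u\<close> in the
  orthogonal group of the whole space.
\<close>

definition is_haar_prob :: "real^'n \<Rightarrow> nat \<Rightarrow> (real^'n) set measure \<Rightarrow> bool" where
  "is_haar_prob u k \<nu> \<longleftrightarrow>
     sets \<nu> = sets (grassmannian_perp_borel u k) \<and>
     emeasure \<nu> (space \<nu>) = 1 \<and>
     (\<forall>g. orthogonal_transformation g \<and> g u = u \<longrightarrow> distr \<nu> \<nu> (\<lambda>\<zeta>. g ` \<zeta>) = \<nu>)"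

definition haar_prob :: "real^'n \<Rightarrow> nat \<Rightarrow> (real^'n) set measure" where
  "haar_prob u k = (THE \<nu>. is_haar_prob u k \<nu>)"

definition dual_radon :: "nat \<Rightarrow> ((real^'n) set \<Rightarrow> real) \<Rightarrow> real^'n \<Rightarrow> real" where
  "dual_radon m F u =
     (real m * unit_ball_vol (real m)) / (real CARD('n) * unit_ball_vol (real CARD('n))) *
     (\<integral>\<zeta>. F (span (insert u \<zeta>)) \<partial>haar_prob u (m - 1))"

definition affine_dual_curvature_measure :: "nat \<Rightarrow> (real^'n) set \<Rightarrow> (real^'n) measure" where
  "affine_dual_curvature_measure m K =
     (if aff_dim K \<le> int CARD('n) - 1 then null_measure sphere_borel
      else measure_of (sphere 0 1) (sets sphere_borel)
        (\<lambda>\<eta>. \<integral>\<^sup>+ u \<in> reverse_radial_gauss_image K \<eta>.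
           ennreal (radial_fun K u ^ m *
             dual_radon m (\<lambda>\<xi>. section_vol K \<xi> ^ (CARD('n) - 1)) u) \<partial>sphere_lebesgue))"

definition weakly_converges_on_sphere ::
  "(nat \<Rightarrow> (real^'n) measure) \<Rightarrow> (real^'n) measure \<Rightarrow> bool" where
  "weakly_converges_on_sphere M N \<longleftrightarrow>
     (\<forall>f :: real^'n \<Rightarrow> real. continuous_on (sphere 0 1) f \<longrightarrow>
        (\<lambda>j. \<integral>v. f v \<partial>M j) \<longlonglongrightarrow> (\<integral>v. f v \<partial>N))"

end

theory Submission
  imports Defs "HOL-Probability.Distributions"
begin

text \<open>
  The affine dual curvature measure of \<open>K\<close> is an integral in polar coordinates.  For almost every
  direction \<open>u\<close> with \<open>\<rho>\<^sub>K(u) > 0\<close> the body has exactly one outer unit normal \<open>\<nu>\<^sub>K(u)\<close> at the boundary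
  point \<open>\<rho>\<^sub>K(u) u\<close>, so the reverse radial Gauss image of \<open>\<eta>\<close> is the preimage of \<open>\<eta>\<close> under \<open>\<nu>\<^sub>K\<close>, up
  to directions that carry no mass.  Hence the measure is an image measure, and integrating a
  continuous \<open>f\<close> against it gives \<open>\<integral> \<rho>\<^sub>K(u)\<^sup>m R\<^sub>K(u) f(\<nu>\<^sub>K(u)) du\<close> over the sphere, where \<open>R\<^sub>K\<close> is the
  dual Radon transform of the powers of the section volumes
  (\<open>integral_affine_dual_curvature_measure\<close>).  Weak convergence then is dominated convergence: the
  bodies \<open>K\<^sub>j\<close> lie in a common ball, which bounds all three factors uniformly.

  For the pointwise convergence almost every \<open>u\<close> falls under one of two cases.  If \<open>\<rho>\<^sub>L(u) = 0\<close>, then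
  \<open>\<rho>(K\<^sub>j, u)\<close> tends to \<open>0\<close> while the other factors stay bounded; a limit without interior points is
  covered by this case alone.  Otherwise the ray of \<open>u\<close> meets the interior of \<open>L\<close> and the normal at
  \<open>\<rho>\<^sub>L(u) u\<close> is unique.  Then the radial functions converge, every limit point of the normals of \<open>K\<^sub>j\<close>
  is a normal of \<open>L\<close> (\<open>gauss_map_tendsto\<close>), and since every subspace through \<open>u\<close> meets the
  interior of \<open>L\<close>, all section volumes, and by dominated convergence their Radon transforms,
  converge (\<open>section_radon_tendsto\<close>).

  Three facts carry this argument.

  Almost everywhere uniqueness of normals.  Suitably normalized, the normals at \<open>\<rho>\<^sub>K(u) u\<close> maximize the
  linear functional \<open>u\<close> over the polar set of \<open>K\<close>.  Maximizers depend monotonically on the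
  functional, so along a line in direction \<open>e\<close> two maximizers can differ in their \<open>e\<close>-component at
  countably many points only, and Fubini's theorem shows that functionals with several maximizers
  form a null set (\<open>null_set_several_maximizers\<close>).

  Section volumes as a function of the projection.  The volume of \<open>K \<inter> \<xi>\<close> is the integral of
  \<open>1\<^sub>K(P x) exp (- \<pi> |x - P x|\<^sup>2)\<close> over the whole space, where \<open>P\<close> is the orthogonal projection onto
  \<open>\<xi>\<close>.  This shows that the volume is independent of the orthonormal basis of \<open>\<xi>\<close>, is Borel
  measurable in \<open>P\<close>, and depends continuously on \<open>K\<close> as long as \<open>\<xi>\<close> meets the interior of \<open>K\<close>.

  Existence and uniqueness of the invariant probability measure on the Grassmannian.  For existence
  the line spanned by \<open>u\<close> is enlarged by independent random vectors with uniform distribution in the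
  unit ball; this construction also shows that integrals depend measurably on \<open>u\<close>.  Uniqueness
  holds because the stabilizer of \<open>u\<close> acts transitively and by isometries, so that all balls of a
  given radius have the same measure, and two such uniformly distributed probability measures
  coincide (\<open>uniformly_distributed_unique\<close>).
\<close>

section \<open>Hausdorff convergence of convex bodies containing the origin\<close>

lemma convex_bodies_oD:
  assumes "K \<in> convex_bodies_o" shows "compact K" "convex K" "0 \<in> K" "closed K" "bounded K" "K \<noteq> {}"
  using assms compact_imp_closed compact_imp_bounded unfolding convex_bodies_o_def by auto

lemma infdist_le_hausdorff_dist:
  fixes A B :: "'a::heine_borel set"
  assumes "compact A" "compact B"
  shows "x \<in> A \<Longrightarrow> infdist x B \<le> hausdorff_dist A B"
    and "y \<in> B \<Longrightarrow> infdist y A \<le> hausdorff_dist A B"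
proof -
  have bdd: "bdd_above ((\<lambda>x. infdist x C) ` D)" if "compact D" for C D :: "'a set"
    using that by (intro bounded_imp_bdd_above compact_imp_bounded compact_continuous_image continuous_intros)
  show "x \<in> A \<Longrightarrow> infdist x B \<le> hausdorff_dist A B"
    using cSUP_upper[OF _ bdd[OF assms(1)], of x B] unfolding hausdorff_dist_def by linarith
  show "y \<in> B \<Longrightarrow> infdist y A \<le> hausdorff_dist A B"
    using cSUP_upper[OF _ bdd[OF assms(2)], of y A] unfolding hausdorff_dist_def by linarith
qed

text \<open>
  A half-space containing \<open>A\<close> bounds the distance to \<open>A\<close> from below by the distance to the half-space.
\<close>

lemma infdist_gt_halfspace:
  fixes a :: "'a::euclidean_space"
  assumes "norm a = 1" "A \<noteq> {}" "\<And>x. x \<in> A \<Longrightarrow> a \<bullet> x \<le> b"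
  shows "a \<bullet> q - b \<le> infdist q A"
proof -
  have "a \<bullet> q - b \<le> dist q x" if "x \<in> A" for x
  proof -
    have "a \<bullet> q - b \<le> a \<bullet> (q - x)" using assms(3)[OF that] by (simp add: inner_diff_right)
    also have "\<dots> \<le> norm a * norm (q - x)" by (rule norm_cauchy_schwarz)
    finally show ?thesis using assms(1) by (simp add: dist_norm)
  qed
  then show ?thesis using assms(2) by (auto simp: infdist_def intro!: cINF_greatest)
qed

locale hausdorff_convergence =
  fixes K :: "nat \<Rightarrow> (real^'n) set" and L :: "(real^'n) set"
  assumes K: "\<And>j. K j \<in> convex_bodies_o" and L: "L \<in> convex_bodies_o"
    and conv: "(\<lambda>j. hausdorff_dist (K j) L) \<longlonglongrightarrow> 0"
begin

text \<open>
  If \<open>K\<^sub>j\<close> misses \<open>p\<close>, a hyperplane through \<open>p\<close> leaves \<open>K\<^sub>j\<close> on one side.  Moving from \<open>p\<close> to the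
  other side within a ball around \<open>p\<close> contained in \<open>L\<close> leads to a point of \<open>L\<close> whose distance from
  \<open>K\<^sub>j\<close> is at least the radius of the ball.
\<close>

lemma eventually_contains_interior_point:
  assumes p: "p \<in> interior L"
  shows "\<forall>\<^sub>F j in sequentially. p \<in> K j"
proof -
  obtain r where r: "r > 0" "cball p r \<subseteq> L" using p by (auto simp: mem_interior_cball)
  have "\<forall>\<^sub>F j in sequentially. hausdorff_dist (K j) L < r" using order_tendstoD(2)[OF conv r(1)] .
  then show ?thesis
  proof eventually_elim
    case (elim j)
    show "p \<in> K j"
    proof (rule ccontr)
      assume "p \<notin> K j"
      then obtain a b where ab: "a \<bullet> p < b" "\<And>x. x \<in> K j \<Longrightarrow> a \<bullet> x > b"
        using separating_hyperplane_closed_point[OF convex_bodies_oD(2)[OF K] convex_bodies_oD(4)[OF K]] by metis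
      have a0: "a \<noteq> 0" using ab convex_bodies_oD(3)[OF K, of j] by force
      define c where "c = - a /\<^sub>R norm a"
      have nc: "norm c = 1" using a0 by (simp add: c_def)
      have "c \<bullet> x \<le> c \<bullet> p" if "x \<in> K j" for x
        using ab(1) ab(2)[OF that] a0 by (simp add: c_def divide_simps)
      then have "c \<bullet> (p + r *\<^sub>R c) - c \<bullet> p \<le> infdist (p + r *\<^sub>R c) (K j)"
        by (intro infdist_gt_halfspace nc convex_bodies_oD(6) K)
      then have "r \<le> infdist (p + r *\<^sub>R c) (K j)"
        using nc by (simp add: inner_add_right dot_square_norm)
      also have "\<dots> \<le> hausdorff_dist (K j) L"
      proof (rule infdist_le_hausdorff_dist)
        show "p + r *\<^sub>R c \<in> L" using r nc by (intro subsetD[OF r(2)]) (simp add: dist_norm)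
      qed (use K L convex_bodies_oD in auto)
      finally show False using elim by simp
    qed
  qed
qed

lemma eventually_omits_exterior_point:
  assumes p: "p \<notin> L"
  shows "\<forall>\<^sub>F j in sequentially. p \<notin> K j"
proof -
  have "infdist p L > 0"
    using p L convex_bodies_oD by (metis in_closed_iff_infdist_zero infdist_nonneg less_eq_real_def)
  then have "\<forall>\<^sub>F j in sequentially. hausdorff_dist (K j) L < infdist p L" using order_tendstoD(2)[OF conv] by blast
  then show ?thesis
  proof eventually_elim
    case (elim j)
    then show ?case
      using infdist_le_hausdorff_dist(1)[OF convex_bodies_oD(1)[OF K] convex_bodies_oD(1)[OF L], of p j] by auto
  qed
qed

lemma approximating_sequence:
  assumes p: "p \<in> L"
  obtains x where "\<And>j. x j \<in> K j" "x \<longlonglongrightarrow> p"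
proof
  define x where "x j = closest_point (K j) p" for j
  show "x j \<in> K j" for j
    unfolding x_def by (rule closest_point_in_set[OF convex_bodies_oD(4)[OF K] convex_bodies_oD(6)[OF K]])
  have d: "dist (x j) p = infdist p (K j)" for j
    using infdist_eq_setdist setdist_closest_point K convex_bodies_oD unfolding x_def
    by (metis dist_commute)
  show "x \<longlonglongrightarrow> p"
  proof (subst tendsto_dist_iff, unfold d, rule tendsto_sandwich[OF _ _ tendsto_const conv])
    show "\<forall>\<^sub>F i in sequentially. infdist p (K i) \<le> hausdorff_dist (K i) L"
      using infdist_le_hausdorff_dist(2)[OF convex_bodies_oD(1)[OF K] convex_bodies_oD(1)[OF L] p] by simp
  qed (simp add: infdist_nonneg)
qed

lemma uniformly_bounded:
  obtains R where "R > 0" "\<And>j. K j \<subseteq> cball 0 R" "L \<subseteq> cball 0 R"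
proof -
  obtain b where b: "\<And>x. x \<in> L \<Longrightarrow> norm x \<le> b" "b > 0"
    using convex_bodies_oD(5)[OF L] bounded_pos by metis
  obtain c where c: "c > 0" "\<And>j. \<bar>hausdorff_dist (K j) L\<bar> \<le> c"
    using convergent_imp_Bseq[OF convergentI[OF conv]] by (auto simp: Bseq_def)
  show ?thesis
  proof (rule that[of "b + c"])
    show "K j \<subseteq> cball 0 (b + c)" for j
    proof
      fix x assume x: "x \<in> K j"
      have "dist x (closest_point L x) = infdist x L"
        using infdist_eq_setdist setdist_closest_point L convex_bodies_oD by metis
      also have "\<dots> \<le> c"
        using infdist_le_hausdorff_dist(1)[OF convex_bodies_oD(1)[OF K] convex_bodies_oD(1)[OF L] x] c(2)[of j] by simp
      finally have "dist x (closest_point L x) \<le> c" .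
      moreover have "norm (closest_point L x) \<le> b"
        using L convex_bodies_oD by (intro b closest_point_in_set) auto
      ultimately show "x \<in> cball 0 (b + c)"
        by (simp add: dist_norm) (metis add.commute add_mono norm_triangle_sub order_trans)
    qed
  qed (use b c in force)+
qed

end

lemma radial_fun:
  assumes K: "K \<in> convex_bodies_o" and u: "norm u = 1"
  shows radial_fun_nonneg: "0 \<le> radial_fun K u" and radial_fun_in: "radial_fun K u *\<^sub>R u \<in> K"
    and le_radial_fun_iff: "0 \<le> t \<Longrightarrow> t \<le> radial_fun K u \<longleftrightarrow> t *\<^sub>R u \<in> K"
proof -
  let ?T = "{0..} \<inter> (\<lambda>t. t *\<^sub>R u) -` K"
  obtain b where b: "\<And>x. x \<in> K \<Longrightarrow> norm x \<le> b" 
    using convex_bodies_oD(5)[OF K] bounded_pos by metis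
  have "closed ?T" by (intro closed_Int closed_vimage convex_bodies_oD(4)[OF K] continuous_intros)
  moreover have "?T \<subseteq> {0..b}" using b u by force
  ultimately have "compact ?T" by (metis bounded_closed_interval bounded_subset compact_eq_bounded_closed)
  moreover have "0 \<in> ?T" using convex_bodies_oD(3)[OF K] by simp
  ultimately obtain s where s: "s \<in> ?T" "\<And>t. t \<in> ?T \<Longrightarrow> t \<le> s"
    using compact_attains_sup[of ?T] by blast
  have eq: "radial_fun K u = s"
    unfolding radial_fun_def using s by (intro Greatest_equality) auto
  show "0 \<le> radial_fun K u" "radial_fun K u *\<^sub>R u \<in> K" using s eq by auto
  assume t: "0 \<le> t"
  show "t \<le> radial_fun K u \<longleftrightarrow> t *\<^sub>R u \<in> K"
  proof
    assume "t *\<^sub>R u \<in> K" then show "t \<le> radial_fun K u" using s(2)[of t] t eq by auto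
  next
    assume le: "t \<le> radial_fun K u"
    show "t *\<^sub>R u \<in> K"
    proof (cases "s = 0")
      case True then show ?thesis using le t eq convex_bodies_oD(3)[OF K] by auto
    next
      case False
      then have "t *\<^sub>R u = (1 - t / s) *\<^sub>R 0 + (t / s) *\<^sub>R (s *\<^sub>R u)" using s(1) by simp
      also have "\<dots> \<in> K"
        using le t False s(1) eq convex_bodies_oD[OF K] by (intro convexD) (auto simp: divide_simps)
      finally show ?thesis .
    qed
  qed
qed

lemma radial_fun_le:
  assumes K: "K \<in> convex_bodies_o" and u: "norm u = 1" and R: "K \<subseteq> cball 0 R"
  shows "radial_fun K u \<le> R"
  using subsetD[OF R radial_fun_in[OF K u]] radial_fun_nonneg[OF K u] u by simp

lemma radial_fun_zero_outside_cone:
  assumes K: "K \<in> convex_bodies_o" and u: "norm u = 1" and no: "\<And>t. t > 0 \<Longrightarrow> t *\<^sub>R u \<notin> K"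
  shows "radial_fun K u = 0"
  using radial_fun_in[OF K u] radial_fun_nonneg[OF K u] no less_eq_real_def by auto

lemma borel_measurable_radial_fun [measurable]:
  assumes K: "K \<in> convex_bodies_o"
  shows "radial_fun K \<in> borel_measurable (sphere_borel :: (real^'n) measure)"
proof (rule borel_measurableI_ge)
  fix t :: real
  have "{u \<in> space sphere_borel. t \<le> radial_fun K u} = sphere 0 1 \<inter> (if t \<le> 0 then UNIV else (\<lambda>u. t *\<^sub>R u) -` K)"
    using le_radial_fun_iff[OF K, of _ t] radial_fun_nonneg[OF K] by (auto simp: space_restrict_space) (smt (verit) dist_0_norm)
  moreover have "closed ((\<lambda>u. t *\<^sub>R u) -` K)"
    by (intro closed_vimage convex_bodies_oD(4)[OF K] continuous_intros)
  ultimately show "{u \<in> space sphere_borel. t \<le> radial_fun K u} \<in> sets (sphere_borel :: (real^'n) measure)"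
    by (subst sets_restrict_space_iff) (auto intro!: borel_closed)
qed

text \<open>
  A segment from an arbitrary point of \<open>K\<close> to an interior point lies in the interior, apart from its
  first end.  Applied to the origin and to the boundary point \<open>\<rho>\<^sub>K(u) u\<close>, this covers the ray up to the boundary.
\<close>

lemma scaled_in_interior:
  assumes K: "K \<in> convex_bodies_o" and t: "t *\<^sub>R u \<in> interior K" "t > 0" and s: "0 < s" "s < radial_fun K u"
    and u: "norm u = 1"
  shows "s *\<^sub>R u \<in> interior K"
proof -
  define r where "r = radial_fun K u"
  show ?thesis
  proof (cases "s \<le> t")
    case True
    have "s *\<^sub>R u = 0 - (s/t) *\<^sub>R (0 - t *\<^sub>R u)" using t by simp
    also have "\<dots> \<in> interior K"
      using True t s convex_bodies_oD[OF K] by (intro mem_interior_convex_shrink) auto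
    finally show ?thesis .
  next
    case False
    have "r > t" using False s r_def by simp
    define e where "e = (r - s) / (r - t)"
    have e: "0 < e" "e \<le> 1" using False s \<open>r > t\<close> by (auto simp: e_def r_def)
    have "e * (r - t) = r - s" using \<open>r > t\<close> by (simp add: e_def)
    then have "s *\<^sub>R u = r *\<^sub>R u - e *\<^sub>R (r *\<^sub>R u - t *\<^sub>R u)"
      by (simp add: scaleR_diff_left[symmetric])
    also have "\<dots> \<in> interior K"
      using e t convex_bodies_oD[OF K] radial_fun_in[OF K u] by (intro mem_interior_convex_shrink) (auto simp: r_def)
    finally show ?thesis .
  qed
qed

context hausdorff_convergence begin

lemma eventually_radial_fun_less:
  assumes u: "norm u = 1" and t: "radial_fun L u < t"
  shows "\<forall>\<^sub>F j in sequentially. radial_fun (K j) u < t"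
proof -
  have t0: "0 \<le> t" using radial_fun_nonneg[OF L u] t by simp
  have "t *\<^sub>R u \<notin> L" using le_radial_fun_iff[OF L u t0] t by simp
  from eventually_omits_exterior_point[OF this] show ?thesis
    by eventually_elim (simp add: le_radial_fun_iff[OF K u t0] flip: not_le)
qed

lemma radial_fun_tendsto_zero:
  assumes u: "norm u = 1" and 0: "radial_fun L u = 0"
  shows "(\<lambda>j. radial_fun (K j) u) \<longlonglongrightarrow> 0"
proof (rule order_tendstoI)
  fix a :: real assume "a < 0"
  then show "\<forall>\<^sub>F j in sequentially. a < radial_fun (K j) u"
    using radial_fun_nonneg[OF K u] by (auto intro!: always_eventually intro: less_le_trans)
qed (use eventually_radial_fun_less[OF u] 0 in auto)

lemma radial_fun_tendsto:
  assumes u: "norm u = 1" and t: "t > 0" "t *\<^sub>R u \<in> interior L"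
  shows "(\<lambda>j. radial_fun (K j) u) \<longlonglongrightarrow> radial_fun L u"
proof (rule order_tendstoI)
  fix a :: real assume a: "a < radial_fun L u"
  have r0: "radial_fun L u > 0"
    using le_radial_fun_iff[OF L u, of t] t interior_subset by force
  obtain s where s: "max 0 a < s" "s < radial_fun L u" using dense[of "max 0 a"] a r0 by auto
  have "s *\<^sub>R u \<in> interior L" using scaled_in_interior[OF L t(2,1) _ s(2) u] s(1) by simp
  from eventually_contains_interior_point[OF this] show "\<forall>\<^sub>F j in sequentially. a < radial_fun (K j) u"
  proof eventually_elim
    case (elim j)
    then have "s \<le> radial_fun (K j) u" using le_radial_fun_iff[OF K u, of s] s by simp
    then show ?case using s by simp
  qed
qed (use eventually_radial_fun_less[OF u] in auto)

end

section \<open>Lebesgue measure in orthonormal coordinates\<close>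

text \<open>
  Uniqueness of Lebesgue measure up to a factor, with the factor determined by one test function.
  Writing \<open>M(A) \<integral>f\<close> as a double integral of \<open>1\<^sub>A(x) f(x + y)\<close> and translating \<open>x\<close> by \<open>- y\<close> turns it
  into \<open>vol(A) \<integral>f\<close>.  Unlike the characterization of Lebesgue measure by boxes, this is applicable
  to measures that are adapted to a rotated coordinate system.
\<close>

lemma eq_lborel_if_translation_invariant:
  fixes M :: "'a::euclidean_space measure" and f :: "'a \<Rightarrow> ennreal"
  assumes "sigma_finite_measure M" and sets_M: "sets M = sets borel"
    and inv: "\<And>c. distr M borel ((+) c) = M"
    and f[measurable]: "f \<in> borel_measurable borel"
    and eq: "(\<integral>\<^sup>+x. f x \<partial>M) = (\<integral>\<^sup>+x. f x \<partial>lborel)"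
    and fin: "(\<integral>\<^sup>+x. f x \<partial>lborel) \<noteq> 0" "(\<integral>\<^sup>+x. f x \<partial>lborel) \<noteq> \<infinity>"
  shows "M = lborel"
proof (rule measure_eqI)
  note [measurable_cong] = sets_M
  interpret M: sigma_finite_measure M by fact
  interpret pair_sigma_finite M "lborel :: 'a measure" ..
  fix A assume "A \<in> sets M"
  then have [measurable]: "A \<in> sets borel" using sets_M by simp
  \<comment> \<open>Translations of \<open>M\<close>, and translations and the reflection at a point for Lebesgue measure.\<close>
  have shift_M: "(\<integral>\<^sup>+x. g x \<partial>M) = (\<integral>\<^sup>+x. g (x - y) \<partial>M)" if [measurable]: "g \<in> borel_measurable borel" for g y
  proof -
    have "(\<integral>\<^sup>+x. g x \<partial>M) = (\<integral>\<^sup>+x. g x \<partial>distr M borel ((+) (- y)))" by (simp add: inv)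
    also have "\<dots> = (\<integral>\<^sup>+x. g (x - y) \<partial>M)" by (subst nn_integral_distr) (auto simp: algebra_simps)
    finally show ?thesis .
  qed
  have shift_l: "(\<integral>\<^sup>+y. g y \<partial>lborel) = (\<integral>\<^sup>+y. g (x + y) \<partial>lborel)" if [measurable]: "g \<in> borel_measurable borel" for g x
  proof -
    have "(\<integral>\<^sup>+y. g y \<partial>lborel) = (\<integral>\<^sup>+y. g y \<partial>distr lborel borel ((+) x))" by (simp add: lborel_distr_plus)
    also have "\<dots> = (\<integral>\<^sup>+y. g (x + y) \<partial>lborel)" by (subst nn_integral_distr) auto
    finally show ?thesis .
  qed
  have reflect: "(\<integral>\<^sup>+y. indicator A (x - y) \<partial>lborel) = emeasure lborel A" for x
  proof -
    have *: "lborel = distr lborel borel (\<lambda>y. x - y)"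
      using lborel_affine[of "-1" x] by (simp add: density_1)
    have "(\<integral>\<^sup>+y. indicator A (x - y) \<partial>lborel) = (\<integral>\<^sup>+y. indicator A y \<partial>distr lborel borel (\<lambda>y. x - y))"
      by (subst nn_integral_distr) auto
    also have "\<dots> = emeasure lborel A" by (subst *[symmetric]) simp
    finally show ?thesis .
  qed
  have "emeasure M A * (\<integral>\<^sup>+y. f y \<partial>lborel) = (\<integral>\<^sup>+x. indicator A x * (\<integral>\<^sup>+y. f y \<partial>lborel) \<partial>M)"
    by (simp add: nn_integral_multc \<open>A \<in> sets M\<close>)
  also have "\<dots> = (\<integral>\<^sup>+x. (\<integral>\<^sup>+y. indicator A x * f (x + y) \<partial>lborel) \<partial>M)"
    by (intro nn_integral_cong) (subst shift_l, auto simp: nn_integral_cmult)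
  also have "\<dots> = (\<integral>\<^sup>+y. (\<integral>\<^sup>+x. indicator A x * f (x + y) \<partial>M) \<partial>lborel)"
    by (rule Fubini'[symmetric]) measurable
  also have "\<dots> = (\<integral>\<^sup>+y. (\<integral>\<^sup>+x. indicator A (x - y) * f x \<partial>M) \<partial>lborel)"
  proof (rule nn_integral_cong)
    fix y
    show "(\<integral>\<^sup>+x. indicator A x * f (x + y) \<partial>M) = (\<integral>\<^sup>+x. indicator A (x - y) * f x \<partial>M)"
      using shift_M[of "\<lambda>x. indicator A x * f (x + y)" y] by simp
  qed
  also have "\<dots> = (\<integral>\<^sup>+x. (\<integral>\<^sup>+y. indicator A (x - y) * f x \<partial>lborel) \<partial>M)"
    by (rule Fubini') measurable
  also have "\<dots> = (\<integral>\<^sup>+x. emeasure lborel A * f x \<partial>M)"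
    by (intro nn_integral_cong) (simp add: nn_integral_multc reflect)
  also have "\<dots> = emeasure lborel A * (\<integral>\<^sup>+x. f x \<partial>lborel)"
    by (simp add: nn_integral_cmult eq)
  finally show "emeasure M A = emeasure lborel A"
    using fin by (metis ennreal_mult_divide_eq infinity_ennreal_def)
qed (simp add: sets_M)

lemma borel_measurable_orthogonal_transformation:
  fixes g :: "'a::euclidean_space \<Rightarrow> 'a"
  assumes g: "orthogonal_transformation g"
  shows "g \<in> borel_measurable borel"
  using orthogonal_transformation_linear[OF g]
  by (intro borel_measurable_continuous_onI linear_continuous_on) (simp add: linear_conv_bounded_linear)

lemma lborel_distr_orthogonal:
  fixes g :: "'a::euclidean_space \<Rightarrow> 'a"
  assumes g: "orthogonal_transformation g"
  shows "distr lborel borel g = lborel"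
proof (rule eq_lborel_if_translation_invariant[where f = "indicator (ball (0::'a) 1)"])
  have lin: "linear g" using g by (rule orthogonal_transformation_linear)
  have [measurable]: "g \<in> borel_measurable borel"
    by (rule borel_measurable_orthogonal_transformation[OF g])
  have "sigma_finite_measure (distr lborel borel g)"
  proof
    let ?A = "range (\<lambda>k::nat. cball (0::'a) (real k))"
    have "emeasure (distr lborel borel g) (cball 0 (real k)) \<noteq> \<infinity>" for k
    proof -
      have "g -` cball 0 (real k) = cball 0 (real k)"
        using orthogonal_transformation_norm[OF g] by auto
      then show ?thesis using emeasure_lborel_cball_finite[of "0::'a" "real k"] by (simp add: emeasure_distr)
    qed
    moreover have "\<Union>?A = space (distr lborel borel g)"
      using real_arch_simple by auto
    ultimately show "\<exists>A. countable A \<and> A \<subseteq> sets (distr lborel borel g) \<and> \<Union>A = space (distr lborel borel g)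
        \<and> (\<forall>a\<in>A. emeasure (distr lborel borel g) a \<noteq> \<infinity>)"
      by (intro exI[of _ ?A]) auto
  qed
  then show "sigma_finite_measure (distr lborel borel g)" .
  fix c
  obtain d where d: "c = g d" using orthogonal_transformation_surj[OF g] by (metis surjD)
  have "distr (distr lborel borel g) borel ((+) c) = distr lborel borel (\<lambda>x. g (d + x))"
    by (subst distr_distr) (auto simp: o_def d linear_add[OF lin])
  also have "\<dots> = distr (distr lborel borel ((+) d)) borel g"
    by (subst distr_distr) (auto simp: o_def)
  finally show "distr (distr lborel borel g) borel ((+) c) = distr lborel borel g"
    by (simp add: lborel_distr_plus)
next
  have [measurable]: "g \<in> borel_measurable borel"
    by (rule borel_measurable_orthogonal_transformation[OF g])
  have "g -` ball 0 1 = ball (0::'a) 1"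
    using orthogonal_transformation_norm[OF g] by auto
  then show "(\<integral>\<^sup>+x. indicator (ball (0::'a) 1) x \<partial>distr lborel borel g) = (\<integral>\<^sup>+x. indicator (ball (0::'a) 1) x \<partial>lborel)"
    by (simp add: emeasure_distr)
  show "(\<integral>\<^sup>+x. indicator (ball (0::'a) 1) x \<partial>lborel) \<noteq> (0::ennreal)"
    using emeasure_lborel_ball_finite[of "0::'a" 1] open_not_negligible[of "ball (0::'a) 1"]
    by (auto simp: negligible_iff_emeasure0)
  show "(\<integral>\<^sup>+x. indicator (ball (0::'a) 1) x \<partial>lborel) \<noteq> (\<infinity>::ennreal)"
    using emeasure_lborel_ball_finite[of "0::'a" 1] by simp
qed (auto intro!: borel_measurable_indicator)

definition orthonormal :: "'a::euclidean_space set \<Rightarrow> bool" where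
  "orthonormal B \<longleftrightarrow> pairwise orthogonal B \<and> (\<forall>b\<in>B. norm b = 1)"

lemma orthonormal_independent: "orthonormal B \<Longrightarrow> independent B"
  by (metis orthonormal_def norm_zero pairwise_orthogonal_independent zero_neq_one)

lemma orthonormal_finite: "orthonormal B \<Longrightarrow> finite B"
  using orthonormal_independent independent_imp_finite by blast

lemma orthonormal_inner:
  assumes "orthonormal B" "b \<in> B" "c \<in> B"
  shows "b \<bullet> c = (if b = c then 1 else 0)"
  using assms by (auto simp: orthonormal_def pairwise_def orthogonal_def dot_square_norm)

lemma orthonormal_sum_inner:
  assumes B: "orthonormal B" and b: "b \<in> B"
  shows "(\<Sum>c\<in>B. x c *\<^sub>R c) \<bullet> b = x b"
proof -
  have "(\<Sum>c\<in>B. x c *\<^sub>R c) \<bullet> b = (\<Sum>c\<in>B. if c = b then x b else 0)"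
    unfolding inner_sum_left by (intro sum.cong) (auto simp: orthonormal_inner[OF B _ b])
  then show ?thesis using b orthonormal_finite[OF B] by simp
qed

lemma orthonormal_norm_sum:
  assumes B: "orthonormal B"
  shows "norm (\<Sum>c\<in>B. x c *\<^sub>R c) ^ 2 = (\<Sum>c\<in>B. (x c)\<^sup>2)"
proof -
  have "norm (\<Sum>c\<in>B. x c *\<^sub>R c) ^ 2 = (\<Sum>b\<in>B. x b * ((\<Sum>c\<in>B. x c *\<^sub>R c) \<bullet> b))"
    by (simp only: dot_square_norm[symmetric] inner_sum_right inner_scaleR_right)
  then show ?thesis by (simp add: orthonormal_sum_inner[OF B] power2_eq_square)
qed

lemma orthonormal_expand:
  assumes B: "orthonormal B" and x: "x \<in> span B"
  shows "x = (\<Sum>b\<in>B. (x \<bullet> b) *\<^sub>R b)"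
proof -
  obtain u where u: "x = (\<Sum>b\<in>B. u b *\<^sub>R b)"
    using x span_finite[OF orthonormal_finite[OF B]] by auto
  then have "x \<bullet> b = u b" if "b \<in> B" for b using orthonormal_sum_inner[OF B that] by simp
  then show ?thesis using u by simp
qed

definition coords_lborel :: "'a::euclidean_space set \<Rightarrow> 'a measure" where
  "coords_lborel B = distr (\<Pi>\<^sub>M b\<in>B. lborel) borel (\<lambda>c. \<Sum>b\<in>B. c b *\<^sub>R b)"

interpretation lborel_PiM: product_sigma_finite "\<lambda>_. lborel :: real measure" ..

lemma measurable_coords [measurable]:
  fixes B :: "'a::euclidean_space set"
  shows "(\<lambda>c. \<Sum>b\<in>B. c b *\<^sub>R b) \<in> borel_measurable (\<Pi>\<^sub>M b\<in>B. (lborel :: real measure))"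
proof (intro borel_measurable_sum borel_measurable_scaleR borel_measurable_const)
  show "(\<lambda>c. c b) \<in> borel_measurable (\<Pi>\<^sub>M b\<in>B. (lborel :: real measure))" if "b \<in> B" for b
    using measurable_component_singleton[OF that, of "\<lambda>_. lborel :: real measure"] by simp
qed

lemma PiM_lborel_translate:
  fixes t :: "'a \<Rightarrow> real"
  assumes I: "finite I"
  shows "distr (\<Pi>\<^sub>M i\<in>I. lborel) (\<Pi>\<^sub>M i\<in>I. lborel) (\<lambda>x. \<lambda>i\<in>I. t i + x i) = (\<Pi>\<^sub>M i\<in>I. lborel)" 
proof (rule lborel_PiM.PiM_eqI[OF I])
  fix A :: "'a \<Rightarrow> real set" assume A: "\<And>i. i \<in> I \<Longrightarrow> A i \<in> sets lborel"
  have m: "(\<lambda>x. \<lambda>i\<in>I. t i + x i) \<in> measurable (\<Pi>\<^sub>M i\<in>I. lborel) (\<Pi>\<^sub>M i\<in>I. lborel)"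
    by measurable
  have [simp]: "(+) (t i) -` A i \<in> sets borel" if "i \<in> I" for i
    using measurable_sets[of "(+) (t i)" borel borel "A i"] A[OF that] by simp
  have "(\<lambda>x. \<lambda>i\<in>I. t i + x i) -` Pi\<^sub>E I A \<inter> space (\<Pi>\<^sub>M i\<in>I. lborel) = Pi\<^sub>E I (\<lambda>i. (+) (t i) -` A i)"
    by (auto simp: space_PiM PiE_def Pi_def extensional_def)
  then have "emeasure (distr (\<Pi>\<^sub>M i\<in>I. lborel) (\<Pi>\<^sub>M i\<in>I. lborel) (\<lambda>x. \<lambda>i\<in>I. t i + x i)) (Pi\<^sub>E I A)
     = (\<Prod>i\<in>I. emeasure lborel ((+) (t i) -` A i))"
    using A I by (subst emeasure_distr[OF m]) (auto intro!: lborel_PiM.emeasure_PiM sets_PiM_I_finite)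
  also have "\<dots> = (\<Prod>i\<in>I. emeasure lborel (A i))"
  proof (intro prod.cong refl)
    fix i assume "i \<in> I"
    have "emeasure lborel (A i) = emeasure (distr lborel borel ((+) (t i))) (A i)" by (simp add: lborel_distr_plus)
    also have "\<dots> = emeasure lborel ((+) (t i) -` A i)" using A[OF \<open>i \<in> I\<close>] by (subst emeasure_distr) auto
    finally show "emeasure lborel ((+) (t i) -` A i) = emeasure lborel (A i)" by simp
  qed
  finally show "emeasure (distr (\<Pi>\<^sub>M i\<in>I. lborel) (\<Pi>\<^sub>M i\<in>I. lborel) (\<lambda>x. \<lambda>i\<in>I. t i + x i)) (Pi\<^sub>E I A)
     = (\<Prod>i\<in>I. emeasure lborel (A i))" .
qed simp

text \<open>
  The normalization makes the integral equal to \<open>1\<close> in every dimension.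
\<close>

definition gauss :: "'a::real_normed_vector \<Rightarrow> real" where "gauss x = exp (- pi * (norm x)\<^sup>2)"

lemma gauss_pos: "0 < gauss x"
  by (simp add: gauss_def)

lemma borel_measurable_gauss [measurable]:
  "(gauss :: 'a::euclidean_space \<Rightarrow> real) \<in> borel_measurable borel"
  unfolding gauss_def[abs_def] by measurable

lemma nn_integral_gauss_real: "(\<integral>\<^sup>+t. ennreal (gauss (t::real)) \<partial>lborel) = 1"
proof -
  have "gauss t = normal_density 0 (1 / sqrt (2 * pi)) t" for t
    by (simp add: gauss_def normal_density_def power_divide real_sqrt_mult[symmetric])
  then show ?thesis
    using nn_integral_eq_integral[OF integrable_normal_density, of "1 / sqrt (2 * pi)" 0] by simp
qed

lemma gauss_orthonormal_sum:
  assumes B: "orthonormal B"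
  shows "ennreal (gauss (\<Sum>b\<in>B. c b *\<^sub>R b)) = (\<Prod>b\<in>B. ennreal (gauss (c b)))"
proof -
  have "gauss (\<Sum>b\<in>B. c b *\<^sub>R b) = (\<Prod>b\<in>B. gauss (c b))"
    unfolding gauss_def orthonormal_norm_sum[OF B]
    by (simp add: sum_distrib_left exp_sum orthonormal_finite[OF B])
  then show ?thesis by (simp add: prod_ennreal less_imp_le gauss_pos)
qed

text \<open>
  The Gaussian is a product in any orthonormal coordinates; this is why it serves as the weight below.
\<close>

lemma nn_integral_gauss_coords:
  assumes B: "orthonormal B"
  shows "(\<integral>\<^sup>+c. ennreal (gauss (\<Sum>b\<in>B. c b *\<^sub>R b)) \<partial>(\<Pi>\<^sub>M b\<in>B. lborel)) = 1"
  unfolding gauss_orthonormal_sum[OF B]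
  by (subst lborel_PiM.product_nn_integral_prod) (auto simp: orthonormal_finite[OF B] nn_integral_gauss_real)

lemma orthonormal_Basis: "orthonormal (Basis :: 'a::euclidean_space set)"
  by (auto simp: orthonormal_def pairwise_def orthogonal_def inner_Basis)

lemma nn_integral_gauss: "(\<integral>\<^sup>+x. ennreal (gauss x) \<partial>lborel) = 1"
  by (subst lborel_eq) (simp add: nn_integral_distr nn_integral_gauss_coords orthonormal_Basis)

text \<open>
  Both measures are invariant under translations, and both integrate the Gaussian to \<open>1\<close>.
\<close>

lemma lborel_eq_coords_lborel:
  assumes B: "orthonormal B" "span B = (UNIV :: 'a::euclidean_space set)"
  shows "coords_lborel B = (lborel :: 'a measure)"
proof (rule eq_lborel_if_translation_invariant[where f = "\<lambda>x. ennreal (gauss x)"])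
  have fB: "finite B" using B orthonormal_finite by auto
  have G: "(\<integral>\<^sup>+x. ennreal (gauss x) \<partial>coords_lborel B) = 1"
    unfolding coords_lborel_def by (simp add: nn_integral_distr nn_integral_gauss_coords B)
  then show "(\<integral>\<^sup>+x. ennreal (gauss x) \<partial>coords_lborel B) = (\<integral>\<^sup>+x. ennreal (gauss x) \<partial>lborel)"
    by (simp add: nn_integral_gauss)
  show "sets (coords_lborel B) = sets borel" by (simp add: coords_lborel_def)
  then have [measurable_cong]: "sets (coords_lborel B) = sets borel" .
  have sp: "space (coords_lborel B) = UNIV" by (simp add: coords_lborel_def)
  show "sigma_finite_measure (coords_lborel B)"
  proof
    \<comment> \<open>Superlevel sets of the Gaussian exhaust the space and have finite measure by Chebyshev's inequality.\<close>
    let ?S = "\<lambda>k::nat. {x::'a. 1 / real (Suc k) \<le> gauss x}"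
    have "emeasure (coords_lborel B) (?S k) \<noteq> \<infinity>" for k
    proof -
      have "ennreal (1 / real (Suc k)) * emeasure (coords_lborel B) (?S k) 
          = (\<integral>\<^sup>+x. ennreal (1 / real (Suc k)) * indicator (?S k) x \<partial>coords_lborel B)"
        by (subst nn_integral_cmult_indicator) auto
      also have "\<dots> \<le> (\<integral>\<^sup>+x. ennreal (gauss x) \<partial>coords_lborel B)"
        by (intro nn_integral_mono) (auto split: split_indicator simp: ennreal_leI)
      finally show ?thesis unfolding G
        by (auto simp: ennreal_mult_top top_unique)
    qed
    moreover have "(\<Union>k. ?S k) = UNIV"
    proof -
      have "\<exists>k. 1 / real (Suc k) \<le> gauss x" for x :: 'a
        using nat_approx_posE[OF gauss_pos[of x]] less_imp_le by (metis)
      then show ?thesis by auto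
    qed
    ultimately show "\<exists>A. countable A \<and> A \<subseteq> sets (coords_lborel B) \<and> \<Union>A = space (coords_lborel B)
        \<and> (\<forall>a\<in>A. emeasure (coords_lborel B) a \<noteq> \<infinity>)"
      by (intro exI[of _ "range ?S"]) (auto simp: sp)
  qed
  fix d :: 'a
  have "distr (coords_lborel B) borel ((+) d) = distr (\<Pi>\<^sub>M b\<in>B. lborel) borel (\<lambda>c. d + (\<Sum>b\<in>B. c b *\<^sub>R b))"
    unfolding coords_lborel_def by (subst distr_distr) (auto simp: o_def)
  also have "(\<lambda>c. d + (\<Sum>b\<in>B. c b *\<^sub>R b)) = (\<lambda>c. \<Sum>b\<in>B. (\<lambda>i\<in>B. d \<bullet> i + c i) b *\<^sub>R b)"
    by (subst orthonormal_expand[OF B(1), of d]) (auto simp: B(2) scaleR_add_left sum.distrib)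
  also have "distr (\<Pi>\<^sub>M b\<in>B. lborel) borel \<dots>
     = distr (distr (\<Pi>\<^sub>M b\<in>B. lborel) (\<Pi>\<^sub>M b\<in>B. lborel) (\<lambda>c. \<lambda>i\<in>B. d \<bullet> i + c i)) borel (\<lambda>c. \<Sum>b\<in>B. c b *\<^sub>R b)"
    by (subst distr_distr) (auto simp: o_def)
  also have "\<dots> = coords_lborel B"
    by (simp add: PiM_lborel_translate fB coords_lborel_def)
  finally show "distr (coords_lborel B) borel ((+) d) = coords_lborel B" .
qed (auto simp: nn_integral_gauss)

section \<open>Orthogonal projections and the volume of central sections\<close>

definition proj :: "(real^'n) set \<Rightarrow> real^'n^'n" where "proj S = matrix (closest_point S)"

lemma closest_point_subspace_eqI:
  fixes S :: "'a::euclidean_space set"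
  assumes S: "subspace S" and z: "z \<in> S" and orth: "\<And>y. y \<in> S \<Longrightarrow> (x - z) \<bullet> y = 0"
  shows "closest_point S x = z"
proof -
  have "dist x z \<le> dist x y" if "y \<in> S" for y
  proof -
    have "(norm (x - y))\<^sup>2 = (norm (x - z))\<^sup>2 + (norm (z - y))\<^sup>2"
      using orth[OF subspace_diff[OF S z that]]
      norm_add_Pythagorean[of "x - z" "z - y"] by (simp add: orthogonal_def)
    then have "(norm (x - z))\<^sup>2 \<le> (norm (x - y))\<^sup>2" by simp
    then show ?thesis by (simp add: dist_norm)
  qed
  then show ?thesis
    using closest_point_unique[OF subspace_imp_convex[OF S] closed_subspace[OF S] z] by auto
qed

lemma closest_point_orthonormal:
  assumes B: "orthonormal B" and S: "span B = S"
  shows "closest_point S x = (\<Sum>b\<in>B. (x \<bullet> b) *\<^sub>R b)"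
proof (rule closest_point_subspace_eqI)
  show "subspace S" using S by auto
  show "(\<Sum>b\<in>B. (x \<bullet> b) *\<^sub>R b) \<in> S"
    unfolding S[symmetric] by (intro span_sum span_scale span_base)
  fix y assume "y \<in> S"
  then have y: "y = (\<Sum>b\<in>B. (y \<bullet> b) *\<^sub>R b)" using orthonormal_expand[OF B] S by auto
  have "(x - (\<Sum>b\<in>B. (x \<bullet> b) *\<^sub>R b)) \<bullet> b = 0" if "b \<in> B" for b
    using orthonormal_sum_inner[OF B that, of "\<lambda>b. x \<bullet> b"] by (simp add: inner_diff_left)
  then show "(x - (\<Sum>b\<in>B. (x \<bullet> b) *\<^sub>R b)) \<bullet> y = 0"
    by (subst y) (simp only: inner_sum_right inner_scaleR_right, simp)
qed

lemma orthonormal_basis_exists: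
  fixes S :: "'a::euclidean_space set"
  assumes "subspace S"
  obtains B where "orthonormal B" "span B = S" "card B = dim S"
  using orthonormal_basis_subspace[OF assms] unfolding orthonormal_def by metis

lemma proj_vec:
  assumes S: "subspace S"
  shows "proj S *v x = closest_point S x"
proof -
  obtain B where B: "orthonormal B" "span B = S" using orthonormal_basis_exists[OF S] .
  have "linear (closest_point S)"
    unfolding closest_point_orthonormal[OF B, abs_def]
    by (intro linearI) (auto simp: inner_add_left scaleR_add_left sum.distrib scaleR_sum_right)
  then show ?thesis unfolding proj_def by (simp add: matrix_works)
qed

lemma proj_orthonormal:
  assumes B: "orthonormal B" and S: "span B = S"
  shows "proj S *v x = (\<Sum>b\<in>B. (x \<bullet> b) *\<^sub>R b)"
  using closest_point_orthonormal[OF assms] proj_vec[of S] S by auto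

lemma proj_in: "subspace S \<Longrightarrow> proj S *v x \<in> S"
  unfolding proj_vec using closest_point_in_set[OF closed_subspace, of S x] subspace_0[of S] by auto

lemma proj_self: "subspace S \<Longrightarrow> x \<in> S \<Longrightarrow> proj S *v x = x"
  by (simp add: proj_vec closest_point_self)

lemma proj_orthogonal:
  assumes "subspace S" "y \<in> S" shows "(x - proj S *v x) \<bullet> y = 0"
proof -
  obtain B where B: "orthonormal B" "span B = S" using orthonormal_basis_exists[OF assms(1)] .
  have "(x - proj S *v x) \<bullet> b = 0" if "b \<in> B" for b
    using orthonormal_sum_inner[OF B(1) that, of "\<lambda>b. x \<bullet> b"] by (simp add: inner_diff_left proj_orthonormal[OF B])
  then show ?thesis
    by (subst orthonormal_expand[OF B(1), of y]) (use B assms in \<open>simp_all only: inner_sum_right inner_scaleR_right, simp_all\<close>)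
qed

text \<open>
  Orthogonal projections onto subspaces are exactly the symmetric idempotent matrices
  (\<open>is_projection_proj\<close>, \<open>proj_range\<close>).
\<close>

definition is_projection :: "real^'n^'n \<Rightarrow> bool" where
  "is_projection P \<longleftrightarrow> transpose P = P \<and> P ** P = P"

lemma matrix_inner: "(A *v x) \<bullet> y = x \<bullet> (transpose A *v y)" for A :: "real^'n^'m"
  by (metis dot_lmul_matrix inner_commute transpose_matrix_vector)

lemma matrix_eqI: "(\<And>x. A *v x = B *v x) \<Longrightarrow> A = B" for A B :: "real^'n^'m"
  by (simp add: matrix_eq)

lemma is_projection_proj:
  assumes S: "subspace S" shows "is_projection (proj S)"
proof -
  have "proj S ** proj S = proj S"
    by (rule matrix_eqI) (simp add: proj_self proj_in S flip: matrix_vector_mul_assoc)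
  moreover have "transpose (proj S) = proj S"
  proof (rule matrix_eqI)
    fix x
    have "(transpose (proj S) *v x - proj S *v x) \<bullet> y = 0" for y
    proof -
      have "x \<bullet> (proj S *v y) = (proj S *v x) \<bullet> (proj S *v y)"
        using proj_orthogonal[OF S proj_in[OF S], of x y] by (simp add: inner_diff_left)
      moreover have "(proj S *v x) \<bullet> y = (proj S *v x) \<bullet> (proj S *v y)"
        using proj_orthogonal[OF S proj_in[OF S], of y x] by (simp add: inner_diff_left inner_diff_right inner_commute)
      ultimately show ?thesis
        using matrix_inner[of "transpose (proj S)" x y] by (simp add: inner_diff_left)
    qed
    then show "transpose (proj S) *v x = proj S *v x"
      by (metis inner_eq_zero_iff right_minus_eq)
  qed
  ultimately show ?thesis by (simp add: is_projection_def)
qed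

lemma is_projection_inner: "is_projection P \<Longrightarrow> (P *v x) \<bullet> y = x \<bullet> (P *v y)"
  using matrix_inner[of P] by (simp add: is_projection_def)

lemma is_projection_idem: "is_projection P \<Longrightarrow> P *v (P *v x) = P *v x"
  by (simp add: is_projection_def matrix_vector_mul_assoc)

lemma is_projection_orth: "is_projection P \<Longrightarrow> (P *v x) \<bullet> (y - P *v y) = 0"
  by (simp add: is_projection_inner is_projection_idem matrix_vector_mult_diff_distrib)

lemma is_projection_pythagoras:
  assumes "is_projection P" shows "(norm x)\<^sup>2 = (norm (P *v x))\<^sup>2 + (norm (x - P *v x))\<^sup>2"
  using norm_add_Pythagorean[of "P *v x" "x - P *v x"] is_projection_orth[OF assms, of x x]
  by (simp add: orthogonal_def)

lemma subspace_range_projection: "subspace {x. P *v x = x}" for P :: "real^'n^'n"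
  by (auto simp: subspace_def matrix_vector_right_distrib matrix_vector_mult_scaleR)

lemma proj_range:
  assumes P: "is_projection P"
  shows "proj {x. P *v x = x} = P"
proof (rule matrix_eqI)
  fix x
  have "closest_point {x. P *v x = x} x = P *v x"
  proof (rule closest_point_subspace_eqI[OF subspace_range_projection])
    fix y assume "y \<in> {x. P *v x = x}"
    then show "(x - P *v x) \<bullet> y = 0"
      using is_projection_orth[OF P, of y x] by (simp add: inner_commute)
  qed (simp add: is_projection_idem P)
  then show "proj {x. P *v x = x} *v x = P *v x" by (simp add: proj_vec subspace_range_projection)
qed

text \<open>
  For an orthogonal projection \<open>P\<close> this is the volume of the section of \<open>K\<close> by the range of \<open>P\<close>
  (\<open>section_vol_eq_gauss_section\<close>), in a form that is free of bases and defined for all matrices.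
\<close>

definition gauss_section :: "(real^'n) set \<Rightarrow> real^'n^'n \<Rightarrow> real" where
  "gauss_section K P = (\<integral>x. indicator K (P *v x) * gauss (x - P *v x) \<partial>lborel)"

lemma subspace_lborel_eq: "subspace_lborel \<xi> = coords_lborel (orthonormal_basis_of \<xi>)"
  by (simp add: subspace_lborel_def coords_lborel_def)

lemma orthonormal_basis_of:
  assumes "subspace \<xi>" 
  shows "orthonormal (orthonormal_basis_of \<xi>)" "span (orthonormal_basis_of \<xi>) = \<xi>"
proof -
  obtain B where B: "orthonormal B" "span B = \<xi>" using orthonormal_basis_exists[OF assms] .
  then have "\<exists>B. pairwise orthogonal B \<and> (\<forall>b\<in>B. norm b = 1) \<and> span B = \<xi>" by (auto simp: orthonormal_def)
  from someI_ex[OF this] show "orthonormal (orthonormal_basis_of \<xi>)" "span (orthonormal_basis_of \<xi>) = \<xi>"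
    unfolding orthonormal_basis_of_def orthonormal_def by auto
qed

lemma orthonormal_complement:
  fixes B :: "'a::euclidean_space set"
  assumes B: "orthonormal B"
  obtains C where "B \<inter> C = {}" "orthonormal (B \<union> C)" "span (B \<union> C) = UNIV"
proof -
  let ?T = "{x. \<forall>y\<in>span B. orthogonal y x}"
  have T: "subspace ?T" using subspace_orthogonal_comp[of "span B"] by (simp add: orthogonal_comp_def)
  obtain C where C: "orthonormal C" "span C = ?T" using orthonormal_basis_exists[OF T] .
  have o: "orthogonal b c" if "b \<in> B" "c \<in> C" for b c
    using that C(2) span_base by blast
  show ?thesis
  proof
    show "B \<inter> C = {}"
    proof (rule ccontr)
      assume "B \<inter> C \<noteq> {}"
      then obtain b where "b \<in> B" "b \<in> C" by auto
      then have "norm b = 0" "norm b = 1" using o[of b b] B by (auto simp: orthogonal_def orthonormal_def)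
      then show False by simp
    qed
    show "orthonormal (B \<union> C)"
      using B C(1) o o[THEN orthogonal_commute[THEN iffD1]] by (auto simp: orthonormal_def pairwise_def)
    have "x \<in> span (B \<union> C)" for x
    proof -
      obtain y z where "y \<in> span B" "\<And>w. w \<in> span B \<Longrightarrow> orthogonal z w" "x = y + z"
        using orthogonal_subspace_decomp_exists[of B x] by blast
      then have "y \<in> span B" "z \<in> span C" "x = y + z"
        using C(2) by (auto simp: orthogonal_commute)
      then show ?thesis by (metis span_add span_mono subsetD sup_ge1 sup_ge2)
    qed
    then show "span (B \<union> C) = UNIV" by auto
  qed
qed

text \<open>
  Extend an orthonormal basis of \<open>\<xi>\<close> to one of the whole space.  In these coordinates Lebesgue
  measure is a product, \<open>P x\<close> only involves the coordinates along \<open>\<xi>\<close>, and the weight only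
  involves the remaining ones, over which it integrates to \<open>1\<close>.
\<close>

lemma nn_integral_section:
  fixes \<xi> :: "(real^'n) set"
  assumes \<xi>: "subspace \<xi>" and A[measurable]: "A \<in> sets borel"
  shows "(\<integral>\<^sup>+x. indicator A (proj \<xi> *v x) * ennreal (gauss (x - proj \<xi> *v x)) \<partial>lborel)
     = emeasure (subspace_lborel \<xi>) (A \<inter> \<xi>)"
proof -
  define B where "B = orthonormal_basis_of \<xi>"
  have B: "orthonormal B" "span B = \<xi>" using orthonormal_basis_of[OF \<xi>] by (auto simp: B_def)
  obtain C where C: "B \<inter> C = {}" "orthonormal (B \<union> C)" "span (B \<union> C) = UNIV"
    using orthonormal_complement[OF B(1)] .
  have oC: "orthonormal C" using C(2) by (auto simp: orthonormal_def intro: pairwise_subset)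
  note fin = orthonormal_finite[OF B(1)] orthonormal_finite[OF oC]
  let ?c = "\<lambda>B x. \<Sum>b\<in>B. x b *\<^sub>R b"
  have split: "?c (B \<union> C) x = ?c B x + ?c C x" for x
    using fin C(1) by (simp add: sum.union_disjoint)
  have P: "proj \<xi> *v ?c (B \<union> C) x = ?c B x" for x
    unfolding proj_orthonormal[OF B]
    by (intro sum.cong refl) (simp add: orthonormal_sum_inner[OF C(2)])
  have [measurable]: "(\<lambda>x. proj \<xi> *v x) \<in> borel_measurable borel"
    by (intro borel_measurable_continuous_onI matrix_vector_mult_linear_continuous_on)
  let ?f = "\<lambda>x. indicator A (proj \<xi> *v x) * ennreal (gauss (x - proj \<xi> *v x))"
  have "(\<integral>\<^sup>+x. ?f x \<partial>lborel) = (\<integral>\<^sup>+x. ?f x \<partial>coords_lborel (B \<union> C))"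
    by (simp add: lborel_eq_coords_lborel C)
  also have "\<dots> = (\<integral>\<^sup>+x. ?f (?c (B \<union> C) x) \<partial>(\<Pi>\<^sub>M b\<in>B \<union> C. lborel))"
    unfolding coords_lborel_def by (subst nn_integral_distr) auto
  also have "\<dots> = (\<integral>\<^sup>+x. indicator A (?c B x) * ennreal (gauss (?c C x)) \<partial>(\<Pi>\<^sub>M b\<in>B \<union> C. lborel))"
    by (simp only: P) (simp add: split)
  also have "\<dots> = (\<integral>\<^sup>+x. (\<integral>\<^sup>+y. indicator A (?c B (merge B C (x, y))) * ennreal (gauss (?c C (merge B C (x, y))))
       \<partial>(\<Pi>\<^sub>M b\<in>C. lborel)) \<partial>(\<Pi>\<^sub>M b\<in>B. lborel))"
  proof (rule lborel_PiM.product_nn_integral_fold[OF C(1) fin])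
    have "(\<lambda>x. ?c D x) \<in> borel_measurable (\<Pi>\<^sub>M b\<in>B \<union> C. (lborel :: real measure))" if "D \<subseteq> B \<union> C" for D
    proof (intro borel_measurable_sum borel_measurable_scaleR borel_measurable_const)
      show "(\<lambda>c. c b) \<in> borel_measurable (\<Pi>\<^sub>M b\<in>B \<union> C. (lborel :: real measure))" if "b \<in> D" for b
        using measurable_component_singleton[of b "B \<union> C" "\<lambda>_. lborel :: real measure"] that \<open>D \<subseteq> B \<union> C\<close> by auto
    qed
    from this[of B] this[of C] have [measurable]: 
      "(\<lambda>x. ?c B x) \<in> borel_measurable (\<Pi>\<^sub>M b\<in>B \<union> C. (lborel :: real measure))" 
      "(\<lambda>x. ?c C x) \<in> borel_measurable (\<Pi>\<^sub>M b\<in>B \<union> C. (lborel :: real measure))" by auto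
    show "(\<lambda>x. indicator A (?c B x) * ennreal (gauss (?c C x))) \<in> borel_measurable (\<Pi>\<^sub>M b\<in>B \<union> C. lborel)"
      by measurable
  qed
  also have "\<dots> = (\<integral>\<^sup>+x. (\<integral>\<^sup>+y. indicator A (?c B x) * ennreal (gauss (?c C y))
       \<partial>(\<Pi>\<^sub>M b\<in>C. lborel)) \<partial>(\<Pi>\<^sub>M b\<in>B. lborel))"
  proof -
    have "?c B (merge B C (x, y)) = ?c B x" "?c C (merge B C (x, y)) = ?c C y" for x y
      using C(1) by (auto intro!: sum.cong simp: merge_def)
    then show ?thesis by simp
  qed
  also have "\<dots> = (\<integral>\<^sup>+x. indicator A (?c B x) \<partial>(\<Pi>\<^sub>M b\<in>B. lborel))"
    by (subst nn_integral_cmult) (auto simp: nn_integral_gauss_coords[OF oC])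
  also have "\<dots> = (\<integral>\<^sup>+x. indicator (A \<inter> \<xi>) (?c B x) \<partial>(\<Pi>\<^sub>M b\<in>B. lborel))"
  proof -
    have "?c B x \<in> \<xi>" for x unfolding B(2)[symmetric] by (intro span_sum span_scale span_base)
    then show ?thesis by (auto intro!: nn_integral_cong split: split_indicator)
  qed
  also have "\<dots> = emeasure (coords_lborel B) (A \<inter> \<xi>)"
  proof -
    have [measurable]: "\<xi> \<in> sets borel" using closed_subspace[OF \<xi>] by simp
    have "(\<integral>\<^sup>+x. indicator (A \<inter> \<xi>) (?c B x) \<partial>(\<Pi>\<^sub>M b\<in>B. lborel)) = (\<integral>\<^sup>+x. indicator (A \<inter> \<xi>) x \<partial>coords_lborel B)"
      unfolding coords_lborel_def by (subst nn_integral_distr) auto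
    also have "\<dots> = emeasure (coords_lborel B) (A \<inter> \<xi>)"
      by (subst nn_integral_indicator) (auto simp: coords_lborel_def)
    finally show ?thesis .
  qed
  finally show ?thesis by (simp add: subspace_lborel_eq B_def)
qed

lemma measurable_matrix_vector [measurable]:
  "(\<lambda>(P :: real^'n^'m, x). P *v x) \<in> borel_measurable (borel \<Otimes>\<^sub>M borel)"
proof -
  have "continuous_on UNIV (\<lambda>p::(real^'n^'m) \<times> (real^'n). fst p *v snd p)"
    unfolding matrix_vector_mult_def by (intro continuous_intros continuous_on_vec_lambda)
  then show ?thesis by (simp add: borel_prod borel_measurable_continuous_onI split_beta')
qed

lemma section_vol_eq_gauss_section:
  assumes \<xi>: "subspace \<xi>" and K: "K \<in> sets borel"
  shows "section_vol K \<xi> = gauss_section K (proj \<xi>)"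
proof -
  note [measurable] = K
  have [measurable]: "(\<lambda>x. proj \<xi> *v x) \<in> borel_measurable borel"
    by (intro borel_measurable_continuous_onI matrix_vector_mult_linear_continuous_on)
  show ?thesis
  unfolding section_vol_def measure_def gauss_section_def
  by (subst integral_eq_nn_integral)
     (auto simp: nn_integral_section[OF \<xi> K, symmetric] ennreal_mult'' less_imp_le gauss_pos ennreal_indicator)
qed

lemma borel_measurable_gauss_section [measurable]:
  assumes [measurable]: "K \<in> sets borel"
  shows "gauss_section K \<in> borel_measurable borel"
proof -
  have "(\<lambda>P. \<integral>x. indicator K (P *v x) * gauss (x - P *v x) \<partial>lborel) \<in> borel_measurable borel"
  proof (rule lborel.borel_measurable_lebesgue_integral)
    have [measurable]: "(\<lambda>p. fst p *v snd p) \<in> borel_measurable (borel \<Otimes>\<^sub>M (lborel :: (real^'n) measure))"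
      using measurable_matrix_vector by (simp add: split_beta' cong: measurable_cong_sets)
    show "(\<lambda>(P, x). indicator K (P *v x) * gauss (x - P *v x)) \<in> borel_measurable (borel \<Otimes>\<^sub>M lborel)"
      unfolding split_beta' by measurable
  qed
  then show ?thesis by (simp add: gauss_section_def[abs_def])
qed

text \<open>
  By Pythagoras \<open>|x|\<^sup>2 \<le> R\<^sup>2 + |x - P x|\<^sup>2\<close> whenever \<open>P x \<in> K\<close>.  The bound does not
  depend on \<open>P\<close>, and so it serves for dominated convergence and for bounds uniform in \<open>P\<close>.
\<close>

lemma gauss_section_integrand_le:
  assumes P: "is_projection P" and K: "K \<subseteq> cball 0 R"
  shows "indicator K (P *v x) * gauss (x - P *v x) \<le> exp (pi * R\<^sup>2) * gauss x"
proof (cases "P *v x \<in> K")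
  case True
  then have "norm (P *v x) \<le> R" using K by auto
  then have "(norm (P *v x))\<^sup>2 \<le> R\<^sup>2" by (simp add: power_mono)
  then have "pi * (norm x)\<^sup>2 \<le> pi * (R\<^sup>2 + (norm (x - P *v x))\<^sup>2)"
    using is_projection_pythagoras[OF P, of x] by (intro mult_left_mono) auto
  then show ?thesis using True by (simp add: gauss_def exp_add[symmetric] algebra_simps)
qed (simp add: gauss_pos less_imp_le)

lemma integrable_gauss: "integrable lborel (gauss :: 'a::euclidean_space \<Rightarrow> real)"
  and integral_gauss: "(\<integral>x. gauss (x::'a) \<partial>lborel) = 1"
proof -
  show *: "integrable lborel (gauss :: 'a::euclidean_space \<Rightarrow> real)"
    by (rule integrableI_nonneg) (auto simp: less_imp_le gauss_pos nn_integral_gauss)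
  show "(\<integral>x. gauss (x::'a) \<partial>lborel) = 1"
    by (subst integral_eq_nn_integral) (auto simp: less_imp_le gauss_pos nn_integral_gauss)
qed

lemma gauss_section_nonneg: "0 \<le> gauss_section K P"
  unfolding gauss_section_def by (intro integral_nonneg_AE) (auto simp: less_imp_le gauss_pos)

lemma gauss_section_le:
  fixes P :: "real^'n^'n"
  assumes P: "is_projection P" and K: "K \<subseteq> cball 0 R"
  shows "gauss_section K P \<le> exp (pi * R\<^sup>2)"
proof -
  have "gauss_section K P \<le> (\<integral>x. exp (pi * R\<^sup>2) * gauss (x::real^'n) \<partial>lborel)"
    unfolding gauss_section_def
    by (intro integral_mono' gauss_section_integrand_le[OF assms] integrable_mult_right integrable_gauss)
       (auto simp: less_imp_le gauss_pos)
  then show ?thesis by (simp add: integral_gauss)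
qed

lemma convex_mix_in_interior:
  fixes K :: "'a::euclidean_space set"
  assumes K: "convex K" and p: "p \<in> interior K" and q: "q \<in> K" and d: "0 < d"
  shows "(1 / (1 + d)) *\<^sub>R (q + d *\<^sub>R p) \<in> interior K"
proof -
  have e: "1 / (1 + d) = 1 - d / (1 + d)" using d by (simp add: field_simps)
  have "q - (d / (1 + d)) *\<^sub>R (q - p) \<in> interior K"
    using d by (intro mem_interior_convex_shrink K p q) auto
  also have "q - (d / (1 + d)) *\<^sub>R (q - p) = (1 - d / (1 + d)) *\<^sub>R q + (d / (1 + d)) *\<^sub>R p"
    by (simp add: algebra_simps)
  finally show ?thesis by (simp add: e[symmetric] scaleR_add_right)
qed

text \<open>
  The frontier of \<open>K\<close> pulls back into the frontier of the convex preimage of \<open>K\<close>: moving an interior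
  point \<open>x\<close> of the preimage slightly away from \<open>p\<close> stays inside, which exhibits \<open>P x\<close> as lying
  strictly between the interior point \<open>p\<close> and another point of \<open>K\<close>.
\<close>

lemma negligible_projection_preimage_frontier:
  assumes K: "compact K" "convex K" and P: "is_projection P" and p: "p \<in> interior K" "P *v p = p"
  shows "{x. P *v x \<in> frontier K} \<in> null_sets lborel"
proof -
  let ?C = "(\<lambda>x. P *v x) -` K"
  have cont: "continuous_on UNIV (\<lambda>x. P *v x)"
    by (intro matrix_vector_mult_linear_continuous_on)
  have "convex ?C" by (rule convex_linear_vimage[OF matrix_vector_mul_linear K(2)])
  then have "negligible (frontier ?C)" by (rule negligible_convex_frontier)
  moreover have "{x. P *v x \<in> frontier K} \<subseteq> frontier ?C"
  proof
    fix x assume "x \<in> {x. P *v x \<in> frontier K}"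
    then have x: "P *v x \<in> K" "P *v x \<notin> interior K"
      using compact_imp_closed[OF K(1)] by (auto simp: frontier_def closure_closed)
    have "x \<notin> interior ?C"
    proof
      assume "x \<in> interior ?C"
      then obtain e where e: "e > 0" "cball x e \<subseteq> ?C" by (auto simp: mem_interior_cball)
      \<comment> \<open>A positive step width with \<open>d |x - p| \<le> e\<close>.\<close>
      define d where "d = e / (1 + norm (x - p))"
      have d: "d > 0" "d * norm (x - p) \<le> e"
        using e(1) by (auto simp: d_def divide_simps add_pos_nonneg)
      have "x + d *\<^sub>R (x - p) \<in> cball x e" using d by (simp add: dist_norm)
      then have "P *v (x + d *\<^sub>R (x - p)) \<in> K" using e(2) by auto
      moreover have "P *v (x + d *\<^sub>R (x - p)) = (1 + d) *\<^sub>R (P *v x) - d *\<^sub>R p"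
        by (simp add: matrix_vector_right_distrib matrix_vector_mult_diff_distrib matrix_vector_mult_scaleR p(2) algebra_simps)
      ultimately have q: "(1 + d) *\<^sub>R (P *v x) - d *\<^sub>R p \<in> K" by simp
      have "(1 / (1 + d)) *\<^sub>R ((1 + d) *\<^sub>R (P *v x) - d *\<^sub>R p + d *\<^sub>R p) \<in> interior K"
        by (rule convex_mix_in_interior[OF K(2) p(1) q d(1)])
      then have "P *v x \<in> interior K" using d(1) by simp
      then show False using x(2) by simp
    qed
    then show "x \<in> frontier ?C" using x(1) closure_subset[of ?C] by (auto simp: frontier_def)
  qed
  ultimately have "negligible {x. P *v x \<in> frontier K}" by (rule negligible_subset)
  moreover have "{x. P *v x \<in> frontier K} = (\<lambda>x. P *v x) -` frontier K" by auto
  then have "closed {x. P *v x \<in> frontier K}"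
    using closed_vimage[OF frontier_closed cont] by simp
  ultimately show ?thesis
    by (auto simp: negligible_iff_emeasure0 null_sets_def)
qed

context hausdorff_convergence begin

lemma gauss_section_tendsto:
  assumes P: "is_projection P" and p: "p \<in> interior L" "P *v p = p"
  shows "(\<lambda>j. gauss_section (K j) P) \<longlonglongrightarrow> gauss_section L P"
proof -
  obtain R where R: "R > 0" "\<And>j. K j \<subseteq> cball 0 R" "L \<subseteq> cball 0 R" using uniformly_bounded by blast
  have [measurable]: "(\<lambda>x. P *v x) \<in> borel_measurable borel"
    by (intro borel_measurable_continuous_onI matrix_vector_mult_linear_continuous_on)
  have [measurable]: "K j \<in> sets borel" "L \<in> sets borel" for j
    using convex_bodies_oD(4)[OF K] convex_bodies_oD(4)[OF L] by simp_all
  show ?thesis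
    unfolding gauss_section_def
  proof (rule integral_dominated_convergence[where w = "\<lambda>x. exp (pi * R\<^sup>2) * gauss x"])
    show "integrable lborel (\<lambda>x::real^'n. exp (pi * R\<^sup>2) * gauss x)"
      by (intro integrable_mult_right integrable_gauss)
    show "AE x in lborel. norm (indicator (K j) (P *v x) * gauss (x - P *v x)) \<le> exp (pi * R\<^sup>2) * gauss x" for j
      using gauss_section_integrand_le[OF P R(2)[of j]] by (auto simp: gauss_pos less_imp_le abs_mult)
    have "AE x in lborel. P *v x \<notin> frontier L"
      using AE_not_in[OF negligible_projection_preimage_frontier[OF convex_bodies_oD(1,2)[OF L] P p]] by simp
    then show "AE x in lborel. (\<lambda>j. indicator (K j) (P *v x) * gauss (x - P *v x)) \<longlonglongrightarrow>
        indicator L (P *v x) * gauss (x - P *v x)"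
    proof eventually_elim
      case (elim x)
      have "(\<lambda>j. indicator (K j) (P *v x) :: real) \<longlonglongrightarrow> indicator L (P *v x)"
      proof (cases "P *v x \<in> L")
        case True
        then have "P *v x \<in> interior L" using elim closure_subset by (auto simp: frontier_def)
        from eventually_contains_interior_point[OF this] show ?thesis
          by (intro tendsto_eventually) (auto elim!: eventually_mono simp: True)
      next
        case False
        from eventually_omits_exterior_point[OF this] show ?thesis
          by (intro tendsto_eventually) (auto elim!: eventually_mono simp: False)
      qed
      then show ?case by (intro tendsto_mult_right)
    qed
  qed measurable
qed

end

section \<open>Uniformly distributed measures\<close>

text \<open>
  Fubini's theorem for the set of pairs at distance less than \<open>r\<close>.
\<close>

lemma uniformly_distributed_swap:
  fixes M N :: "'a::{metric_space, second_countable_topology} measure"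
  assumes "sigma_finite_measure M" "sigma_finite_measure N"
    and sets: "sets M = sets borel" "sets N = sets borel"
    and A[measurable]: "A \<in> sets borel" and B[measurable]: "B \<in> sets borel"
  shows "(\<integral>\<^sup>+x. indicator A x * emeasure M (ball x r \<inter> B) \<partial>N) = (\<integral>\<^sup>+y. indicator B y * emeasure N (ball y r \<inter> A) \<partial>M)"
proof -
  note [measurable_cong] = sets
  interpret M: sigma_finite_measure M by fact
  interpret N: sigma_finite_measure N by fact
  interpret pair_sigma_finite N M ..
  let ?f = "\<lambda>x y. indicator A x * (indicator B y * indicator {..<r} (dist x y)) :: ennreal"
  have "(\<integral>\<^sup>+x. indicator A x * emeasure M (ball x r \<inter> B) \<partial>N) = (\<integral>\<^sup>+x. (\<integral>\<^sup>+y. ?f x y \<partial>M) \<partial>N)"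
  proof (rule nn_integral_cong)
    fix x
    have "(\<integral>\<^sup>+y. ?f x y \<partial>M) = indicator A x * (\<integral>\<^sup>+y. indicator B y * indicator {..<r} (dist x y) \<partial>M)"
      by (rule nn_integral_cmult) measurable
    also have "(\<integral>\<^sup>+y. indicator B y * indicator {..<r} (dist x y) \<partial>M) = (\<integral>\<^sup>+y. indicator (ball x r \<inter> B) y \<partial>M)"
      by (intro nn_integral_cong) (auto split: split_indicator)
    also have "\<dots> = emeasure M (ball x r \<inter> B)" by (simp add: sets)
    finally show "indicator A x * emeasure M (ball x r \<inter> B) = (\<integral>\<^sup>+y. ?f x y \<partial>M)" by simp
  qed
  also have "\<dots> = (\<integral>\<^sup>+y. (\<integral>\<^sup>+x. ?f x y \<partial>N) \<partial>M)"
    by (rule Fubini'[symmetric]) measurable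
  also have "\<dots> = (\<integral>\<^sup>+y. indicator B y * emeasure N (ball y r \<inter> A) \<partial>M)"
  proof (rule nn_integral_cong)
    fix y
    have "(\<integral>\<^sup>+x. ?f x y \<partial>N) = (\<integral>\<^sup>+x. indicator B y * indicator (ball y r \<inter> A) x \<partial>N)"
      by (intro nn_integral_cong) (auto split: split_indicator simp: dist_commute)
    also have "\<dots> = indicator B y * emeasure N (ball y r \<inter> A)"
      by (subst nn_integral_cmult_indicator) (auto simp: sets)
    finally show "(\<integral>\<^sup>+x. ?f x y \<partial>N) = indicator B y * emeasure N (ball y r \<inter> A)" .
  qed
  finally show ?thesis .
qed

text \<open>
  Countably many balls of radius \<open>r\<close> cover \<open>S\<close>; if one of them is a null set, so are all.
\<close>

lemma uniformly_distributed_emeasure_ball_pos: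
  fixes M :: "'a::{metric_space, second_countable_topology} measure"
  assumes "prob_space M" and sets: "sets M = sets borel" 
    and S: "AE x in M. x \<in> S" and r: "r > 0" and x0: "x0 \<in> S"
    and eq: "\<And>x y. x \<in> S \<Longrightarrow> y \<in> S \<Longrightarrow> emeasure M (ball x r) = emeasure M (ball y r)"
  shows "emeasure M (ball x0 r) \<noteq> 0"
proof
  interpret prob_space M by fact
  assume 0: "emeasure M (ball x0 r) = 0"
  let ?F = "(\<lambda>x. ball x r) ` S"
  obtain F where F: "F \<subseteq> ?F" "countable F" "\<Union>F = \<Union>?F"
    using Lindelof[of ?F] by (metis imageE open_ball)
  have "\<Union>F \<in> null_sets M"
    using F 0 eq[OF x0] by (intro null_sets_UN'[of F "\<lambda>x. x", simplified]) (auto simp: null_sets_def sets)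
  then have "AE x in M. x \<notin> \<Union>F" by (rule AE_not_in)
  with S have "AE x in M. False"
    by eventually_elim (use F(3) r in auto)
  then show False by simp
qed

text \<open>
  First, both measures give the same mass \<open>g(r)\<close> to all balls of radius \<open>r\<close> centred in \<open>S\<close>, since
  the average over \<open>N\<close> of the \<open>M\<close>-measures of balls equals the average over \<open>M\<close> of their
  \<open>N\<close>-measures.  Next, for \<open>x \<in> U\<close> the quotient \<open>M(B(x,r) \<inter> U) / g(r)\<close> is \<open>1\<close> for small \<open>r\<close>.  Fatou's
  lemma bounds \<open>N(U)\<close> by the lower limit of the integrals of these quotients over \<open>U\<close>, and exchanging
  the order of integration bounds each of them by \<open>M(U)\<close>.
\<close>

lemma uniformly_distributed_le:
  fixes M N :: "'a::{metric_space, second_countable_topology} measure"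
  assumes M: "prob_space M" and N: "prob_space N" and sets: "sets M = sets borel" "sets N = sets borel"
    and S: "AE x in M. x \<in> S" "AE x in N. x \<in> S"
    and eqM: "\<And>x y r. x \<in> S \<Longrightarrow> y \<in> S \<Longrightarrow> emeasure M (ball x r) = emeasure M (ball y r)"
    and eqN: "\<And>x y r. x \<in> S \<Longrightarrow> y \<in> S \<Longrightarrow> emeasure N (ball x r) = emeasure N (ball y r)"
    and U: "open U"
  shows "emeasure N U \<le> emeasure M U"
proof -
  note [measurable_cong] = sets
  interpret M: prob_space M by fact
  interpret N: prob_space N by fact
  have [measurable]: "U \<in> sets borel" using U by simp
  have sp: "space M = UNIV" "space N = UNIV" using sets_eq_imp_space_eq[OF sets(1)] sets_eq_imp_space_eq[OF sets(2)] by auto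
  have "S \<noteq> {}" using S(1) M.AE_False by auto
  then obtain x0 where x0: "x0 \<in> S" by auto
  define g where "g r = emeasure M (ball x0 r)" for r
  have gM: "emeasure M (ball x r) = g r" if "x \<in> S" for x r using eqM[OF that x0] by (simp add: g_def)
  \<comment> \<open>Averaging the constant \<open>g r\<close> over \<open>N\<close> and swapping the two measures gives the measure of balls under \<open>N\<close>.\<close>
  have gN: "emeasure N (ball x r) = g r" if "x \<in> S" for x r
  proof -
    have "g r = (\<integral>\<^sup>+x. g r \<partial>N)" using N.emeasure_space_1 by simp
    also have "\<dots> = (\<integral>\<^sup>+x. indicator UNIV x * emeasure M (ball x r \<inter> UNIV) \<partial>N)"
      using S(2) gM by (intro nn_integral_cong_AE) (auto elim!: eventually_mono)
    also have "\<dots> = (\<integral>\<^sup>+y. indicator UNIV y * emeasure N (ball y r \<inter> UNIV) \<partial>M)"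
      by (rule uniformly_distributed_swap[OF M.sigma_finite_measure_axioms N.sigma_finite_measure_axioms sets]) auto
    also have "\<dots> = (\<integral>\<^sup>+y. emeasure N (ball x r) \<partial>M)"
    proof (rule nn_integral_cong_AE)
      show "AE y in M. indicator UNIV y * emeasure N (ball y r \<inter> UNIV) = emeasure N (ball x r)"
        using S(1)
      proof eventually_elim
        case (elim y)
        show ?case using eqN[OF elim that, of r] by simp
      qed
    qed
    also have "\<dots> = emeasure N (ball x r)" using M.emeasure_space_1 by simp
    finally show ?thesis by simp
  qed
  have g0: "g r \<noteq> 0" if "r > 0" for r
    unfolding g_def by (rule uniformly_distributed_emeasure_ball_pos[OF M sets(1) S(1) that x0 eqM])
  have gtop: "g r \<noteq> top" for r unfolding g_def by simp
  define r where "r i = 1 / real (Suc i)" for i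
  have r: "r i > 0" for i by (simp add: r_def)
  define q where "q i x = indicator U x * emeasure M (ball x (r i) \<inter> U) / g (r i)" for i x
  have [measurable]: "q i \<in> borel_measurable N" for i
  proof -
    have "(\<lambda>x. emeasure M (Pair x -` {p. dist (fst p) (snd p) < r i \<and> snd p \<in> U})) \<in> borel_measurable borel"
    proof (rule M.measurable_emeasure_Pair)
      have "{p \<in> space (borel \<Otimes>\<^sub>M M). dist (fst p) (snd p) < r i \<and> snd p \<in> U} \<in> sets (borel \<Otimes>\<^sub>M M)"
        by measurable
      then show "{p. dist (fst p) (snd p) < r i \<and> snd p \<in> U} \<in> sets (borel \<Otimes>\<^sub>M M)"
        by (simp add: space_pair_measure sp)
    qed
    moreover have "Pair x -` {p. dist (fst p) (snd p) < r i \<and> snd p \<in> U} = ball x (r i) \<inter> U" for x by auto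
    ultimately have [measurable]: "(\<lambda>x. emeasure M (ball x (r i) \<inter> U)) \<in> borel_measurable borel" by simp
    show ?thesis unfolding q_def[abs_def] by measurable
  qed
  have int_q: "(\<integral>\<^sup>+x. q i x \<partial>N) \<le> emeasure M U" for i
  proof -
    have "(\<integral>\<^sup>+x. q i x \<partial>N) * g (r i) = (\<integral>\<^sup>+x. indicator U x * emeasure M (ball x (r i) \<inter> U) \<partial>N)"
      by (subst nn_integral_multc[symmetric])
         (auto intro!: nn_integral_cong simp: q_def ennreal_divide_times g0[OF r] gtop ennreal_times_divide
            mult_divide_eq_ennreal ennreal_mult_divide_eq)
    also have "\<dots> = (\<integral>\<^sup>+y. indicator U y * emeasure N (ball y (r i) \<inter> U) \<partial>M)"
      by (rule uniformly_distributed_swap[OF M.sigma_finite_measure_axioms N.sigma_finite_measure_axioms sets]) auto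
    also have "\<dots> \<le> (\<integral>\<^sup>+y. indicator U y * g (r i) \<partial>M)"
    proof (rule nn_integral_mono_AE)
      show "AE y in M. indicator U y * emeasure N (ball y (r i) \<inter> U) \<le> indicator U y * g (r i)"
        using S(1)
      proof eventually_elim
        case (elim y)
        show ?case unfolding gN[OF elim, symmetric]
          by (intro mult_left_mono emeasure_mono) (auto simp: sets)
      qed
    qed
    also have "\<dots> = emeasure M U * g (r i)" by (subst nn_integral_multc) (auto simp: sets)
    finally have "(\<integral>\<^sup>+x. q i x \<partial>N) * g (r i) \<le> emeasure M U * g (r i)" .
    then have "(\<integral>\<^sup>+x. q i x \<partial>N) * g (r i) / g (r i) \<le> emeasure M U * g (r i) / g (r i)" 
      by (rule divide_right_mono_ennreal)
    then show ?thesis by (simp add: ennreal_mult_divide_eq g0[OF r] gtop)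
  qed
  have "emeasure N U = (\<integral>\<^sup>+x. indicator U x \<partial>N)" by (simp add: sets)
  also have "\<dots> \<le> (\<integral>\<^sup>+x. liminf (\<lambda>i. q i x) \<partial>N)"
  proof (rule nn_integral_mono_AE)
    show "AE x in N. indicator U x \<le> liminf (\<lambda>i. q i x)"
      using S(2)
    proof eventually_elim
      case (elim x)
      show ?case
      proof (cases "x \<in> U")
        case True
        obtain e where e: "e > 0" "ball x e \<subseteq> U" using U True openE by blast
        have "\<forall>\<^sub>F i in sequentially. r i < e"
          unfolding r_def using e(1) lim_inverse_n' LIMSEQ_inverse_real_of_nat
          by (intro order_tendstoD(2)[where y = 0]) (simp_all add: inverse_eq_divide)
        then have "\<forall>\<^sub>F i in sequentially. q i x = 1"
        proof eventually_elim
          case (elim i)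
          then have "ball x (r i) \<inter> U = ball x (r i)" using e(2) by auto
          then show ?case using True \<open>x \<in> S\<close> g0[OF r] gtop
            by (simp add: q_def gM ennreal_divide_self top.not_eq_extremum)
        qed
        then have "liminf (\<lambda>i. q i x) = liminf (\<lambda>i. 1)" by (rule Liminf_eq)
        then show ?thesis using True by (simp add: Liminf_const)
      qed simp
    qed
  qed
  also have "\<dots> \<le> liminf (\<lambda>i. \<integral>\<^sup>+x. q i x \<partial>N)" by (rule nn_integral_liminf) measurable
  also have "\<dots> \<le> liminf (\<lambda>i. emeasure M U)" by (intro Liminf_mono always_eventually) (simp add: int_q)
  also have "\<dots> = emeasure M U" by (simp add: Liminf_const)
  finally show ?thesis .
qed

lemma uniformly_distributed_unique:
  fixes M N :: "'a::{metric_space, second_countable_topology} measure"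
  assumes M: "prob_space M" and N: "prob_space N" and sets: "sets M = sets borel" "sets N = sets borel"
    and S: "AE x in M. x \<in> S" "AE x in N. x \<in> S"
    and eqM: "\<And>x y r. x \<in> S \<Longrightarrow> y \<in> S \<Longrightarrow> emeasure M (ball x r) = emeasure M (ball y r)"
    and eqN: "\<And>x y r. x \<in> S \<Longrightarrow> y \<in> S \<Longrightarrow> emeasure N (ball x r) = emeasure N (ball y r)"
  shows "M = N"
proof (rule measure_eqI_generator_eq[where E = "{U. open U}" and \<Omega> = UNIV and A = "\<lambda>_. UNIV"])
  interpret M: prob_space M by fact
  show "emeasure M U = emeasure N U" if "U \<in> {U. open U}" for U
    using that uniformly_distributed_le[OF M N sets S eqM eqN] uniformly_distributed_le[OF N M sets(2,1) S(2,1) eqN eqM]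
    by (intro antisym) auto
  show "sets M = sigma_sets UNIV {U. open U}" "sets N = sigma_sets UNIV {U. open U}"
    by (auto simp: sets borel_def sets_measure_of)
  show "emeasure M UNIV \<noteq> \<infinity>" by simp
qed (auto simp: Int_stable_def)

section \<open>Random flags\<close>

definition rank1 :: "real^'n \<Rightarrow> real^'n^'n" where "rank1 w = (\<chi> i j. w $ i * w $ j)"

lemma rank1_vec: "rank1 w *v x = (w \<bullet> x) *\<^sub>R w"
  by (simp add: rank1_def vec_eq_iff matrix_vector_mult_def inner_vec_def sum_distrib_right sum_distrib_left mult_ac)

lemma trace_rank1: "trace (rank1 w) = (norm w)\<^sup>2"
  by (simp add: trace_def rank1_def inner_vec_def flip: dot_square_norm)

lemma trace_scaleR: "trace (c *\<^sub>R A) = c * trace A" for A :: "real^'n^'n"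
  by (simp add: trace_def sum_distrib_left)

lemma trace_sum: "finite B \<Longrightarrow> trace (\<Sum>b\<in>B. A b) = (\<Sum>b\<in>B. trace (A b))" for A :: "'b \<Rightarrow> real^'n^'n"
  by (simp add: trace_def sum.swap[of _ UNIV])

lemma matrix_sum_vec: "(\<Sum>b\<in>B. A b) *v x = (\<Sum>b\<in>B. A b *v x)" for A :: "'b \<Rightarrow> real^'n^'m"
  by (induction B rule: infinite_finite_induct) (auto simp: matrix_vector_mult_add_rdistrib)

lemma scaleR_matrix_vec: "(c *\<^sub>R A) *v x = c *\<^sub>R (A *v x)" for A :: "real^'n^'m"
  by (simp add: scaleR_matrix_vector_assoc)

lemma is_projectionI:
  fixes P :: "real^'n^'n"
  assumes "\<And>x y. (P *v x) \<bullet> y = x \<bullet> (P *v y)" "\<And>x. P *v (P *v x) = P *v x"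
  shows "is_projection P"
proof -
  have "(transpose P *v x) \<bullet> y = (P *v x) \<bullet> y" for x y
    using matrix_inner[of "transpose P" x y] assms(1)[of x y] by simp
  then have "transpose P = P" by (intro matrix_eqI) (metis vector_eq_rdot)
  moreover have "P ** P = P" by (rule matrix_eqI) (simp add: assms(2) flip: matrix_vector_mul_assoc)
  ultimately show ?thesis by (simp add: is_projection_def)
qed

lemma proj_eq_sum_rank1:
  assumes "orthonormal B" "span B = S" shows "proj S = (\<Sum>b\<in>B. rank1 b)"
  by (rule matrix_eqI) (simp add: proj_orthonormal[OF assms] matrix_sum_vec rank1_vec inner_commute)

lemma trace_proj:
  fixes S :: "(real^'n) set"
  assumes S: "subspace S" shows "trace (proj S) = real (dim S)"
proof -
  obtain B where B: "orthonormal B" "span B = S" "card B = dim S" using orthonormal_basis_exists[OF S] .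
  have "trace (proj S) = (\<Sum>b\<in>B. (norm b)\<^sup>2)"
    by (simp add: proj_eq_sum_rank1[OF B(1,2)] trace_sum[OF orthonormal_finite[OF B(1)]] trace_rank1)
  also have "\<dots> = real (card B)" using B(1) by (simp add: orthonormal_def)
  finally show ?thesis by (simp add: B(3))
qed

lemma trace_projection:
  assumes "is_projection P" shows "trace P = real (dim {x. P *v x = x})"
  using trace_proj[OF subspace_range_projection[of P]] proj_range[OF assms] by simp

text \<open>
  If \<open>P\<close> is the projection onto a subspace \<open>V\<close> and \<open>v \<notin> V\<close>, this is the projection onto \<open>V + \<real>v\<close>: one
  step of the Gram--Schmidt process.
\<close>

definition adjoin :: "real^'n^'n \<Rightarrow> real^'n \<Rightarrow> real^'n^'n" where
  "adjoin P v = P + (1 / (norm (v - P *v v))\<^sup>2) *\<^sub>R rank1 (v - P *v v)"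

text \<open>
  The projections onto the \<open>(k+1)\<close>-dimensional subspaces that contain \<open>u\<close>; the trace of a projection
  is its rank.  These subspaces correspond to the \<open>k\<close>-dimensional subspaces of \<open>u\<^sup>\<bottom>\<close>.
\<close>

definition flag_projections :: "real^'n \<Rightarrow> nat \<Rightarrow> (real^'n^'n) set" where
  "flag_projections u k = {P. is_projection P \<and> P *v u = u \<and> trace P = real (Suc k)}"

lemma adjoin_vec: "adjoin P v *v x = P *v x + (((v - P *v v) \<bullet> x) / (norm (v - P *v v))\<^sup>2) *\<^sub>R (v - P *v v)"
  by (simp add: adjoin_def matrix_vector_mult_add_rdistrib scaleR_matrix_vec rank1_vec)

lemma adjoin_flag_projection:
  assumes P: "P \<in> flag_projections u k" and v: "P *v v \<noteq> v"
  shows "adjoin P v \<in> flag_projections u (Suc k)"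
proof -
  define w where "w = v - P *v v"
  have w: "w \<noteq> 0" using v by (simp add: w_def)
  have proj: "is_projection P" and u: "P *v u = u" using P by (auto simp: flag_projections_def)
  have Pw: "P *v w = 0" by (simp add: w_def matrix_vector_mult_diff_distrib is_projection_idem[OF proj])
  have a: "adjoin P v *v x = P *v x + ((w \<bullet> x) / (norm w)\<^sup>2) *\<^sub>R w" for x
    by (simp add: adjoin_vec w_def)
  have wP: "w \<bullet> (P *v x) = 0" for x using is_projection_inner[OF proj, of w x] Pw by simp
  have ww: "w \<bullet> w = (norm w)\<^sup>2" by (simp add: dot_square_norm)
  have "is_projection (adjoin P v)"
  proof (rule is_projectionI)
    fix x y
    show "(adjoin P v *v x) \<bullet> y = x \<bullet> (adjoin P v *v y)"
      by (simp add: a inner_add_left inner_add_right is_projection_inner[OF proj] inner_commute[of x w] mult.commute)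
    show "adjoin P v *v (adjoin P v *v x) = adjoin P v *v x"
      using w by (simp add: a matrix_vector_right_distrib is_projection_idem[OF proj] matrix_vector_mult_scaleR Pw
          inner_add_right wP ww)
  qed
  moreover have "adjoin P v *v u = u" using wP[of u] by (simp add: a u)
  moreover have "trace (adjoin P v) = real (Suc (Suc k))"
    using P w by (simp add: adjoin_def trace_add trace_scaleR trace_rank1 flag_projections_def flip: w_def)
  ultimately show ?thesis by (simp add: flag_projections_def)
qed

lemma rank1_flag_projection:
  assumes u: "norm u = 1" shows "rank1 u \<in> flag_projections u 0"
proof -
  have uu: "u \<bullet> u = 1" using u by (simp add: dot_square_norm)
  have "is_projection (rank1 u)"
    by (rule is_projectionI) (auto simp: rank1_vec uu inner_commute)
  then show ?thesis by (simp add: flag_projections_def rank1_vec uu trace_rank1 u)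
qed

lemma continuous_matrix_vec [continuous_intros]:
  assumes "continuous_on S f" "continuous_on S g"
  shows "continuous_on S (\<lambda>x. (f x :: real^'n^'m) *v g x)"
  unfolding matrix_vector_mult_def by (intro continuous_intros continuous_on_vec_lambda assms)

lemma continuous_matrix_mult [continuous_intros]:
  assumes "continuous_on S f" "continuous_on S g"
  shows "continuous_on S (\<lambda>x. (f x :: real^'n^'m) ** (g x :: real^'p^'n))"
  unfolding matrix_matrix_mult_def by (intro continuous_intros continuous_on_vec_lambda assms)

lemma continuous_transpose [continuous_intros]:
  assumes "continuous_on S f"
  shows "continuous_on S (\<lambda>x. transpose (f x :: real^'n^'m))"
  unfolding transpose_def by (intro continuous_intros continuous_on_vec_lambda assms)

lemma continuous_trace [continuous_intros]:
  assumes "continuous_on S f"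
  shows "continuous_on S (\<lambda>x. trace (f x :: real^'n^'n))"
  unfolding trace_def by (intro continuous_intros assms)

lemma continuous_rank1 [continuous_intros]:
  assumes "continuous_on S f"
  shows "continuous_on S (\<lambda>x. rank1 (f x))"
  unfolding rank1_def by (intro continuous_intros continuous_on_vec_lambda assms)

lemma closed_flag_projections: "closed (flag_projections u k)"
proof -
  have "flag_projections u k = {P. transpose P = P} \<inter> {P. P ** P = P} \<inter> {P. P *v u = u} \<inter> {P. trace P = real (Suc k)}"
    by (auto simp: flag_projections_def is_projection_def)
  also have "closed \<dots>"
    by (intro closed_Int closed_Collect_eq continuous_intros continuous_on_id)
  finally show ?thesis .
qed

lemma flag_projections_borel [measurable]: "flag_projections u k \<in> sets borel"
  by (simp add: closed_flag_projections)

lemma measurable_adjoin [measurable]: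
  "(\<lambda>(P, v). adjoin P v) \<in> borel_measurable (borel \<Otimes>\<^sub>M (borel :: (real^'n) measure))"
proof -
  have "continuous_on UNIV (\<lambda>p::(real^'n^'n) \<times> (real^'n). snd p - fst p *v snd p)"
    by (intro continuous_intros)
  then have [measurable]: "(\<lambda>p::(real^'n^'n) \<times> (real^'n). snd p - fst p *v snd p) \<in> borel_measurable (borel \<Otimes>\<^sub>M borel)"
    by (simp add: borel_prod borel_measurable_continuous_onI)
  have "continuous_on UNIV (rank1 :: real^'n \<Rightarrow> _)"
    by (intro continuous_intros)
  then have [measurable]: "(rank1 :: real^'n \<Rightarrow> _) \<in> borel_measurable borel"
    by (rule borel_measurable_continuous_onI)
  show ?thesis unfolding adjoin_def[abs_def] split_beta' by measurable
qed

abbreviation ball_measure :: "(real^'n) measure" where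
  "ball_measure \<equiv> uniform_measure lborel (ball 0 1)"

lemma emeasure_unit_ball: "emeasure lborel (ball (0::'a::euclidean_space) 1) \<noteq> 0" "emeasure lborel (ball (0::'a) 1) \<noteq> \<infinity>"
    using emeasure_lborel_ball_finite[of "0::'a" 1] open_not_negligible[of "ball (0::'a) 1"]
    by (auto simp: negligible_iff_emeasure0)

lemma prob_space_ball_measure: "prob_space (ball_measure :: (real^'n) measure)"
  using emeasure_unit_ball[where 'a = "real^'n"] by (intro prob_space_uniform_measure) auto

lemma ball_measure_orthogonal:
  fixes g :: "real^'n \<Rightarrow> real^'n"
  assumes g: "orthogonal_transformation g"
  shows "distr ball_measure borel g = ball_measure"
proof (rule measure_eqI)
  fix A assume "A \<in> sets (distr ball_measure borel g)"
  then have [measurable]: "A \<in> sets borel" by simp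
  have [measurable]: "g \<in> borel_measurable borel"
    by (rule borel_measurable_orthogonal_transformation[OF g])
  have "emeasure lborel (ball 0 1 \<inter> A) = emeasure (distr lborel borel g) (ball 0 1 \<inter> A)"
    by (simp add: lborel_distr_orthogonal[OF g])
  also have "\<dots> = emeasure lborel (g -` (ball 0 1 \<inter> A))" by (simp add: emeasure_distr)
  also have "g -` (ball 0 1 \<inter> A) = ball 0 1 \<inter> g -` A"
    using orthogonal_transformation_norm[OF g] by auto
  finally have *: "emeasure lborel (ball 0 1 \<inter> A) = emeasure lborel (ball 0 1 \<inter> g -` A)" .
  have [measurable]: "g -` A \<in> sets borel" using measurable_sets[of g borel borel A] by simp
  show "emeasure (distr ball_measure borel g) A = emeasure ball_measure A"
    by (simp add: emeasure_distr *)
qed simp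

text \<open>
  For a unit vector \<open>u\<close>, the distribution of the projection onto the span of \<open>u\<close> and of \<open>k\<close> independent random vectors,
  uniformly distributed in the unit ball.  The recursion keeps the dependence on \<open>u\<close> in the initial
  value only, which makes invariance and measurability in \<open>u\<close> accessible to induction.
\<close>

primrec random_flag :: "real^'n \<Rightarrow> nat \<Rightarrow> (real^'n^'n) measure" where
  "random_flag u 0 = return borel (rank1 u)"
| "random_flag u (Suc k) = distr (random_flag u k \<Otimes>\<^sub>M ball_measure) borel (\<lambda>(P, v). adjoin P v)"

lemma sets_random_flag [simp, measurable_cong]: "sets (random_flag u k) = sets borel"
  by (cases k) auto

lemma space_random_flag [simp]: "space (random_flag u k) = UNIV"
  using sets_eq_imp_space_eq[OF sets_random_flag] by auto

lemma measurable_adjoin_random_flag [measurable]: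
  "(\<lambda>(P, v). adjoin P v) \<in> borel_measurable (random_flag u k \<Otimes>\<^sub>M ball_measure)"
  using measurable_adjoin by (simp cong: measurable_cong_sets sets_pair_measure_cong)

lemma prob_space_random_flag: "prob_space (random_flag u k)"
proof (induction k)
  case 0 show ?case by (auto intro: prob_space_return)
next
  case (Suc k)
  interpret A: prob_space "random_flag u k" by (rule Suc)
  interpret B: prob_space "ball_measure :: (real^'a) measure" by (rule prob_space_ball_measure)
  interpret pair_prob_space "random_flag u k" "ball_measure :: (real^'a) measure" ..
  show ?case by (simp add: prob_space_distr measurable_adjoin_random_flag)
qed

lemma null_range_projection:
  fixes P :: "real^'n^'n"
  assumes P: "is_projection P" "trace P < real CARD('n)"
  shows "{v. P *v v = v} \<in> null_sets lborel"
proof -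
  have "dim {v. P *v v = v} < DIM(real^'n)" using trace_projection[OF P(1)] P(2) by simp
  then have "negligible {v. P *v v = v}" by (rule negligible_lowdim)
  moreover have "closed {v. P *v v = v}" by (rule closed_subspace[OF subspace_range_projection])
  ultimately show ?thesis by (auto simp: negligible_iff_emeasure0 null_sets_def)
qed

text \<open>
  A random vector almost surely avoids the range of a projection of rank less than \<open>n\<close>, so that each
  step raises the rank by one.
\<close>

lemma AE_random_flag:
  fixes u :: "real^'n"
  assumes u: "norm u = 1" and k: "k < CARD('n)"
  shows "AE P in random_flag u k. P \<in> flag_projections u k"
  using k
proof (induction k)
  case 0
  have "Measurable.pred borel (\<lambda>P. P \<in> flag_projections u 0)" by measurable
  then show ?case using rank1_flag_projection[OF u] by (subst random_flag.simps, subst AE_return) auto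
next
  case (Suc k)
  interpret A: prob_space "random_flag u k" by (rule prob_space_random_flag)
  interpret B: prob_space "ball_measure :: (real^'n) measure" by (rule prob_space_ball_measure)
  interpret pair_prob_space "random_flag u k" "ball_measure :: (real^'n) measure" ..
  have "AE p in random_flag u k \<Otimes>\<^sub>M ball_measure. (\<lambda>(P, v). adjoin P v) p \<in> flag_projections u (Suc k)"
  proof (rule AE_pair_measure)
    have "(\<lambda>(P, v). adjoin P v) -` flag_projections u (Suc k) \<inter> space (random_flag u k \<Otimes>\<^sub>M ball_measure)
        \<in> sets (random_flag u k \<Otimes>\<^sub>M ball_measure)"
      by (rule measurable_sets[OF measurable_adjoin_random_flag]) simp
    then show "{p \<in> space (random_flag u k \<Otimes>\<^sub>M ball_measure). (\<lambda>(P, v). adjoin P v) p \<in> flag_projections u (Suc k)}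
        \<in> sets (random_flag u k \<Otimes>\<^sub>M ball_measure)"
      by (simp add: vimage_def Int_def conj_commute)
    have "AE P in random_flag u k. P \<in> flag_projections u k" using Suc by simp
    then show "AE P in random_flag u k. AE v in ball_measure. (\<lambda>(P, v). adjoin P v) (P, v) \<in> flag_projections u (Suc k)"
    proof eventually_elim
      case (elim P)
      then have "{v. P *v v = v} \<in> null_sets lborel"
        using Suc.prems by (intro null_range_projection) (auto simp: flag_projections_def)
      from AE_not_in[OF this] have "AE v in lborel. P *v v \<noteq> v" by simp
      then have "AE v in ball_measure. P *v v \<noteq> v"
        using emeasure_unit_ball[where 'a = "real^'n"] by (intro AE_uniform_measureI) auto
      then show ?case by eventually_elim (simp add: adjoin_flag_projection[OF elim])
    qed
  qed
  then show ?case
    unfolding random_flag.simps by (subst AE_distr_iff[OF measurable_adjoin_random_flag]) auto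
qed

text \<open>
  The action on projections that corresponds to the action of \<open>g\<close> on subspaces (\<open>proj_image\<close>).
\<close>

definition conj_by :: "(real^'n \<Rightarrow> real^'n) \<Rightarrow> real^'n^'n \<Rightarrow> real^'n^'n" where
  "conj_by g P = matrix g ** P ** transpose (matrix g)"

lemma orthogonal_matrix_vec:
  fixes g :: "real^'n \<Rightarrow> real^'n"
  shows "orthogonal_transformation g \<Longrightarrow> matrix g *v x = g x"
  using orthogonal_transformation_linear[of g] by (simp add: matrix_works)

lemma conj_by_vec:
  assumes g: "orthogonal_transformation g"
  shows "conj_by g P *v g x = g (P *v x)"
proof -
  have "transpose (matrix g) ** matrix g = mat 1"
    using g by (simp add: orthogonal_transformation_matrix orthogonal_matrix_def)
  then have "transpose (matrix g) *v g x = x"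
    by (metis g matrix_vector_mul_assoc matrix_vector_mul_lid orthogonal_matrix_vec)
  then show ?thesis
    by (simp add: conj_by_def orthogonal_matrix_vec[OF g] flip: matrix_vector_mul_assoc)
qed

lemma conj_by_eqI:
  assumes g: "orthogonal_transformation g" and "\<And>x. Q *v g x = g (P *v x)"
  shows "conj_by g P = Q"
proof (rule matrix_eqI)
  fix y
  obtain x where "y = g x" using orthogonal_transformation_surj[OF g] by (metis surjD)
  then show "conj_by g P *v y = Q *v y" by (simp add: conj_by_vec[OF g] assms(2))
qed

lemma conj_by_rank1: "orthogonal_transformation g \<Longrightarrow> conj_by g (rank1 w) = rank1 (g w)"
  by (rule conj_by_eqI) (simp_all add: rank1_vec orthogonal_transformation_def orthogonal_transformation_scaleR)

lemma conj_by_adjoin: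
  assumes g: "orthogonal_transformation g"
  shows "conj_by g (adjoin P v) = adjoin (conj_by g P) (g v)"
proof (rule conj_by_eqI[OF g])
  fix x
  have lin: "linear g" by (rule orthogonal_transformation_linear[OF g])
  have d: "g v - g (P *v v) = g (v - P *v v)" by (simp add: linear_diff[OF lin])
  show "adjoin (conj_by g P) (g v) *v g x = g (adjoin P v *v x)"
    by (simp add: adjoin_vec conj_by_vec[OF g] d orthogonal_transformation_norm[OF g] linear_add[OF lin] linear_scale[OF lin])
       (simp add: g[unfolded orthogonal_transformation_def])
qed

lemma continuous_conj_by: "continuous_on S (conj_by g)"
  unfolding conj_by_def[abs_def] by (intro continuous_intros continuous_on_const continuous_on_id)

lemma measurable_conj_by [measurable]: "conj_by g \<in> borel_measurable borel"
  by (rule borel_measurable_continuous_onI[OF continuous_conj_by])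

text \<open>
  Gram--Schmidt steps commute with orthogonal maps, the uniform distribution on the ball is
  invariant under them, and the initial value is fixed because \<open>g\<close> fixes \<open>u\<close>.
\<close>

lemma random_flag_conj_by:
  assumes g: "orthogonal_transformation g" and u: "g u = u"
  shows "distr (random_flag u k) borel (conj_by g) = random_flag u k"
proof (induction k)
  case 0
  show ?case by (simp add: distr_return conj_by_rank1[OF g] u)
next
  case (Suc k)
  let ?M = "random_flag u k \<Otimes>\<^sub>M ball_measure"
  let ?a = "\<lambda>(P, v). adjoin P v"
  let ?h = "\<lambda>(P, v). (conj_by g P, g v)"
  have [measurable]: "g \<in> borel_measurable borel"
    by (rule borel_measurable_orthogonal_transformation[OF g])
  interpret B: prob_space "ball_measure :: (real^'a) measure" by (rule prob_space_ball_measure)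
  have "?M = distr (random_flag u k) (random_flag u k) (conj_by g) \<Otimes>\<^sub>M distr ball_measure ball_measure g"
  proof -
    have "distr ball_measure ball_measure g = ball_measure"
      using ball_measure_orthogonal[OF g] by (simp cong: distr_cong)
    moreover have "distr (random_flag u k) (random_flag u k) (conj_by g) = random_flag u k"
      using Suc by (simp cong: distr_cong)
    ultimately show ?thesis by simp
  qed
  also have "\<dots> = distr ?M ?M ?h"
  proof (rule pair_measure_distr)
    show "sigma_finite_measure (distr ball_measure ball_measure g)"
      using ball_measure_orthogonal[OF g] B.sigma_finite_measure_axioms by (simp cong: distr_cong)
  qed measurable
  finally have M: "distr ?M ?M ?h = ?M" by simp
  have [measurable]: "?h \<in> measurable ?M ?M" by measurable
  have "distr (distr ?M borel ?a) borel (conj_by g) = distr ?M borel (\<lambda>p. conj_by g (?a p))"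
    by (subst distr_distr) (auto simp: o_def)
  also have "(\<lambda>p. conj_by g (?a p)) = (\<lambda>p. ?a (?h p))" by (auto simp: conj_by_adjoin[OF g])
  also have "distr ?M borel \<dots> = distr (distr ?M ?M ?h) borel ?a"
    by (subst distr_distr) (auto simp: o_def)
  finally show ?case by (simp add: M)
qed

lemma norm_matrix_square: "(norm A)\<^sup>2 = (\<Sum>i\<in>UNIV. \<Sum>j\<in>UNIV. (A $ i $ j)\<^sup>2)" for A :: "real^'n^'m"
  by (simp add: power2_norm_eq_inner inner_vec_def) (simp add: power2_eq_square)

lemma norm_transpose: "norm (transpose A) = norm A" for A :: "real^'n^'m"
proof -
  have "(norm (transpose A))\<^sup>2 = (norm A)\<^sup>2"
    unfolding norm_matrix_square by (subst sum.swap) (simp add: transpose_def)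
  then show ?thesis by simp
qed

lemma norm_mult_orthogonal_transpose:
  fixes A :: "real^'n^'m" and g :: "real^'n \<Rightarrow> real^'n"
  assumes g: "orthogonal_transformation g"
  shows "norm (A ** transpose (matrix g)) = norm A"
proof -
  have "(A ** transpose (matrix g)) $ i = matrix g *v (A $ i)" for i
    by (simp add: vec_eq_iff matrix_matrix_mult_def matrix_vector_mult_def transpose_def mult.commute)
  then have "(A ** transpose (matrix g)) $ i = g (A $ i)" for i
    by (simp only: orthogonal_matrix_vec[OF g])
  then have "(norm (A ** transpose (matrix g)))\<^sup>2 = (norm A)\<^sup>2"
    by (simp add: power2_norm_eq_inner inner_vec_def[of "A ** _"] inner_vec_def[of A A] g[unfolded orthogonal_transformation_def])
  then show ?thesis by simp
qed

text \<open>
  Multiplication with an orthogonal matrix from the right rotates every row, and multiplication from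
  the left reduces to this by transposition.
\<close>

lemma norm_conj_by:
  assumes g: "orthogonal_transformation g" shows "norm (conj_by g A) = norm A"
proof -
  have "norm (conj_by g A) = norm (matrix g ** A)"
    unfolding conj_by_def by (rule norm_mult_orthogonal_transpose[OF g])
  also have "\<dots> = norm (transpose A ** transpose (matrix g))"
    by (metis matrix_transpose_mul norm_transpose)
  also have "\<dots> = norm A" by (simp add: norm_mult_orthogonal_transpose[OF g] norm_transpose)
  finally show ?thesis .
qed

lemma conj_by_diff: "conj_by g A - conj_by g B = conj_by g (A - B)"
  by (rule matrix_eqI)
     (simp add: conj_by_def matrix_vector_mult_diff_rdistrib matrix_vector_mult_diff_distrib flip: matrix_vector_mul_assoc)

lemma dist_conj_by: "orthogonal_transformation g \<Longrightarrow> dist (conj_by g A) (conj_by g B) = dist A B"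
  by (simp add: dist_norm conj_by_diff norm_conj_by)

section \<open>The invariant measure on the Grassmannian\<close>

lemma orthonormal_inner_expand:
  assumes B: "orthonormal B" "x \<in> span B"
  shows "x \<bullet> y = (\<Sum>b\<in>B. (x \<bullet> b) * (b \<bullet> y))"
  by (subst orthonormal_expand[OF B]) (simp add: inner_sum_left)

lemma orthogonal_transformation_between_bases:
  fixes B C :: "'a::euclidean_space set"
  assumes B: "orthonormal B" "span B = UNIV" and C: "orthonormal C" and f: "bij_betw f B C"
  obtains g where "orthogonal_transformation g" "\<And>b. b \<in> B \<Longrightarrow> g b = f b"
proof
  let ?g = "\<lambda>x. \<Sum>b\<in>B. (x \<bullet> b) *\<^sub>R f b"
  have fin: "finite B" by (rule orthonormal_finite[OF B(1)])
  have ff: "f b \<bullet> f c = (if b = c then 1 else 0)" if "b \<in> B" "c \<in> B" for b c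
    using that f orthonormal_inner[OF C, of "f b" "f c"] by (auto simp: bij_betw_def inj_on_def)
  have "?g x \<bullet> f c = x \<bullet> c" if "c \<in> B" for x c
  proof -
    have "?g x \<bullet> f c = (\<Sum>b\<in>B. if b = c then x \<bullet> c else 0)"
      unfolding inner_sum_left by (intro sum.cong) (auto simp: ff that)
    then show ?thesis using that fin by simp
  qed
  note gf = this
  have "?g x \<bullet> ?g y = x \<bullet> y" for x y
  proof -
    have "?g x \<bullet> ?g y = (\<Sum>b\<in>B. (y \<bullet> b) * (?g x \<bullet> f b))"
      by (simp only: inner_sum_right inner_scaleR_right)
    also have "\<dots> = (\<Sum>b\<in>B. (y \<bullet> b) * (b \<bullet> x))"
    proof (intro sum.cong refl)
      fix b assume b: "b \<in> B"
      have "?g x \<bullet> f b = b \<bullet> x" using gf[OF b, of x] by (simp only: inner_commute[of b x])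
      then show "(y \<bullet> b) * (?g x \<bullet> f b) = (y \<bullet> b) * (b \<bullet> x)" by (simp only:)
    qed
    also have "\<dots> = y \<bullet> x" using orthonormal_inner_expand[OF B(1), of y x] B(2) by simp
    finally show ?thesis by (simp add: inner_commute)
  qed
  moreover have "linear ?g"
    by (intro linearI) (auto simp: inner_add_left scaleR_add_left sum.distrib scaleR_sum_right)
  ultimately show "orthogonal_transformation ?g" by (simp add: orthogonal_transformation_def)
  fix b assume b: "b \<in> B"
  have "?g b = (\<Sum>c\<in>B. if c = b then f b else 0)"
    by (intro sum.cong) (auto simp: orthonormal_inner[OF B(1) b])
  then show "?g b = f b" using b fin by simp
qed

lemma is_projection_minus_rank1:
  fixes P :: "real^'n^'n"
  assumes u: "norm u = 1" and P: "is_projection P" "P *v u = u"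
  shows "is_projection (P - rank1 u)" and "u \<bullet> ((P - rank1 u) *v x) = 0"
proof -
  have uu: "u \<bullet> u = 1" using u by (simp add: dot_square_norm)
  have vec: "(P - rank1 u) *v x = P *v x - (u \<bullet> x) *\<^sub>R u" for x
    by (simp add: matrix_vector_mult_diff_rdistrib rank1_vec)
  have uP: "u \<bullet> (P *v x) = u \<bullet> x" for x using is_projection_inner[OF P(1), of u x] P(2) by simp
  show "u \<bullet> ((P - rank1 u) *v x) = 0" by (simp add: vec inner_diff_right uP uu)
  show "is_projection (P - rank1 u)"
  proof (rule is_projectionI)
    fix x y
    have "((P - rank1 u) *v x) \<bullet> y = x \<bullet> (P *v y) - (u \<bullet> x) * (u \<bullet> y)"
      by (simp add: vec inner_diff_left is_projection_inner[OF P(1)])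
    also have "\<dots> = x \<bullet> ((P - rank1 u) *v y)"
      by (simp add: vec inner_diff_right inner_commute[of x u])
    finally show "((P - rank1 u) *v x) \<bullet> y = x \<bullet> ((P - rank1 u) *v y)" .
    show "(P - rank1 u) *v ((P - rank1 u) *v x) = (P - rank1 u) *v x"
      by (simp add: vec inner_diff_right uP uu matrix_vector_mult_diff_distrib is_projection_idem[OF P(1)]
          matrix_vector_mult_scaleR P(2))
  qed
qed

lemma is_projection_plus_rank1:
  fixes P :: "real^'n^'n"
  assumes u: "norm u = 1" and P: "is_projection P" "P *v u = 0"
  shows "is_projection (P + rank1 u)"
proof (rule is_projectionI)
  have uu: "u \<bullet> u = 1" using u by (simp add: dot_square_norm)
  have vec: "(P + rank1 u) *v x = P *v x + (u \<bullet> x) *\<^sub>R u" for x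
    by (simp add: matrix_vector_mult_add_rdistrib rank1_vec)
  have uP: "u \<bullet> (P *v x) = 0" for x using is_projection_inner[OF P(1), of u x] P(2) by simp
  fix x y
  have "((P + rank1 u) *v x) \<bullet> y = x \<bullet> (P *v y) + (u \<bullet> x) * (u \<bullet> y)"
    by (simp add: vec inner_add_left is_projection_inner[OF P(1)])
  also have "\<dots> = x \<bullet> ((P + rank1 u) *v y)"
    by (simp add: vec inner_add_right inner_commute[of x u])
  finally show "((P + rank1 u) *v x) \<bullet> y = x \<bullet> ((P + rank1 u) *v y)" .
  show "(P + rank1 u) *v ((P + rank1 u) *v x) = (P + rank1 u) *v x"
    by (simp add: vec inner_add_right uP uu matrix_vector_right_distrib is_projection_idem[OF P(1)]
        matrix_vector_mult_scaleR P(2))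
qed

text \<open>
  The orthogonal complement of \<open>u\<close> in the range of \<open>P\<close>.  Matrices that are not projections of the
  required kind are sent to some fixed subspace, so that the map takes values in the Grassmannian
  everywhere and is measurable.
\<close>

definition grass_of :: "real^'n \<Rightarrow> nat \<Rightarrow> real^'n^'n \<Rightarrow> (real^'n) set" where
  "grass_of u k P = {x. (if P \<in> flag_projections u k then P
       else SOME P. P \<in> flag_projections u k) *v x = x \<and> u \<bullet> x = 0}"

text \<open>
  For \<open>\<zeta>\<close> in \<open>u\<^sup>\<bottom>\<close> this is the projection onto the span of \<open>\<zeta>\<close> and \<open>u\<close>; the maps \<open>flag_of u\<close> and
  \<open>grass_of u k\<close> identify the Grassmannian of \<open>u\<^sup>\<bottom>\<close> with the flag projections.
\<close>

definition flag_of :: "real^'n \<Rightarrow> (real^'n) set \<Rightarrow> real^'n^'n" where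
  "flag_of u \<zeta> = proj \<zeta> + rank1 u"

lemma subspace_grassmannian: "\<zeta> \<in> grassmannian_perp u k \<Longrightarrow> subspace \<zeta>"
  and perp_grassmannian: "\<zeta> \<in> grassmannian_perp u k \<Longrightarrow> x \<in> \<zeta> \<Longrightarrow> u \<bullet> x = 0"
  by (auto simp: grassmannian_perp_def)

lemma flag_of_grassmannian:
  assumes u: "norm u = 1" and \<zeta>: "\<zeta> \<in> grassmannian_perp u k"
  shows "flag_of u \<zeta> \<in> flag_projections u k"
    and "{x. flag_of u \<zeta> *v x = x \<and> u \<bullet> x = 0} = \<zeta>"
    and "proj (span (insert u \<zeta>)) = flag_of u \<zeta>"
proof -
  have uu: "u \<bullet> u = 1" using u by (simp add: dot_square_norm)
  have S: "subspace \<zeta>" and d: "dim \<zeta> = k" using \<zeta> by (auto simp: grassmannian_perp_def)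
  have perp: "u \<bullet> (proj \<zeta> *v x) = 0" for x
    by (rule perp_grassmannian[OF \<zeta> proj_in[OF S]])
  note Pr = is_projection_proj[OF S]
  have Pu: "proj \<zeta> *v u = 0"
    using is_projection_inner[OF Pr, of "proj \<zeta> *v u" u] is_projection_idem[OF Pr, of u] perp[of u]
    by (simp add: inner_commute)
  have x: "flag_of u \<zeta> *v x = proj \<zeta> *v x + (u \<bullet> x) *\<^sub>R u" for x
    by (simp add: flag_of_def matrix_vector_mult_add_rdistrib rank1_vec)
  have "is_projection (flag_of u \<zeta>)"
    unfolding flag_of_def by (rule is_projection_plus_rank1[OF u Pr Pu])
  moreover have "trace (flag_of u \<zeta>) = real (Suc k)"
    by (simp add: flag_of_def trace_add trace_rank1 u trace_proj[OF S] d)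
  ultimately show fl: "flag_of u \<zeta> \<in> flag_projections u k"
    by (simp add: flag_projections_def x Pu uu)
  show "{x. flag_of u \<zeta> *v x = x \<and> u \<bullet> x = 0} = \<zeta>"
    using proj_in[OF S] proj_self[OF S] perp_grassmannian[OF \<zeta>] by (auto simp: x) metis
  have "span (insert u \<zeta>) = {x. flag_of u \<zeta> *v x = x}"
  proof
    show "span (insert u \<zeta>) \<subseteq> {x. flag_of u \<zeta> *v x = x}"
      by (intro span_minimal subspace_range_projection) (auto simp: x Pu uu proj_self[OF S] perp_grassmannian[OF \<zeta>])
    show "{x. flag_of u \<zeta> *v x = x} \<subseteq> span (insert u \<zeta>)"
    proof
      fix y assume "y \<in> {x. flag_of u \<zeta> *v x = x}"
      then have "y = proj \<zeta> *v y + (u \<bullet> y) *\<^sub>R u" by (simp add: x)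
      also have "\<dots> \<in> span (insert u \<zeta>)"
        by (intro span_add span_scale span_base) (auto simp: proj_in[OF S])
      finally show "y \<in> span (insert u \<zeta>)" .
    qed
  qed
  then show "proj (span (insert u \<zeta>)) = flag_of u \<zeta>"
    using proj_range[of "flag_of u \<zeta>"] fl by (simp add: flag_projections_def)
qed

lemma grass_of_flag_projection:
  assumes u: "norm u = 1" and P: "P \<in> flag_projections u k"
  shows "grass_of u k P \<in> grassmannian_perp u k" and "flag_of u (grass_of u k P) = P"
proof -
  have proj: "is_projection P" and Pu: "P *v u = u" and tr: "trace P = real (Suc k)" using P by (auto simp: flag_projections_def)
  define Q where "Q = P - rank1 u"
  have Qx: "Q *v x = P *v x - (u \<bullet> x) *\<^sub>R u" for x
    by (simp add: Q_def matrix_vector_mult_diff_rdistrib rank1_vec)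
  have Q: "is_projection Q" and uQ: "u \<bullet> (Q *v x) = 0" for x
    unfolding Q_def by (rule is_projection_minus_rank1[OF u proj Pu])+
  have "P *v x = x \<and> u \<bullet> x = 0 \<longleftrightarrow> Q *v x = x" for x
  proof
    assume Qxx: "Q *v x = x"
    then have "u \<bullet> x = 0" using uQ[of x] by simp
    then show "P *v x = x \<and> u \<bullet> x = 0" using Qx[of x] Qxx by simp
  qed (simp add: Qx)
  then have eq: "grass_of u k P = {x. Q *v x = x}" by (simp add: grass_of_def P)
  have "trace Q = real k" using tr u by (simp add: Q_def trace_sub trace_rank1)
  then have "dim {x. Q *v x = x} = k" using trace_projection[OF Q] by simp
  then show "grass_of u k P \<in> grassmannian_perp u k"
    using uQ unfolding eq grassmannian_perp_def by (auto simp: subspace_range_projection) metis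
  show "flag_of u (grass_of u k P) = P"
    unfolding eq flag_of_def proj_range[OF Q] by (simp add: Q_def)
qed

lemma flag_projection_basis:
  fixes u :: "real^'n"
  assumes u: "norm u = 1" and P: "P \<in> flag_projections u k"
  obtains B where "orthonormal B" "u \<notin> B" "card B = k" "orthonormal (insert u B)" "P = (\<Sum>b\<in>insert u B. rank1 b)"
proof -
  define \<zeta> where "\<zeta> = grass_of u k P"
  have \<zeta>: "\<zeta> \<in> grassmannian_perp u k" "flag_of u \<zeta> = P"
    unfolding \<zeta>_def by (rule grass_of_flag_projection[OF u P])+
  obtain B where B: "orthonormal B" "span B = \<zeta>" "card B = dim \<zeta>"
    using orthonormal_basis_exists[OF subspace_grassmannian[OF \<zeta>(1)]] .
  have ub: "orthogonal u b" if "b \<in> B" for b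
    using perp_grassmannian[OF \<zeta>(1), of b] that B(2) span_base by (auto simp: orthogonal_def)
  have "u \<notin> B" using ub[of u] u by (auto simp: orthogonal_def)
  moreover have "orthonormal (insert u B)"
    using B(1) ub u by (auto simp: orthonormal_def pairwise_insert orthogonal_commute)
  moreover have "card B = k" using B(3) \<zeta>(1) by (simp add: grassmannian_perp_def)
  moreover have "P = (\<Sum>b\<in>insert u B. rank1 b)"
  proof -
    have "P = rank1 u + (\<Sum>b\<in>B. rank1 b)"
      using \<zeta>(2) by (simp add: flag_of_def proj_eq_sum_rank1[OF B(1,2)] add.commute)
    then show ?thesis using \<open>u \<notin> B\<close> orthonormal_finite[OF B(1)] by simp
  qed
  ultimately show ?thesis using that[of B] B(1) by simp
qed

lemma conj_by_sum: "conj_by g (\<Sum>b\<in>B. A b) = (\<Sum>b\<in>B. conj_by g (A b))"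
  by (rule matrix_eqI) (simp add: conj_by_def matrix_sum_vec linear_sum[OF matrix_vector_mul_linear] flip: matrix_vector_mul_assoc)

text \<open>
  Extend orthonormal bases of the two subspaces, both chosen to contain \<open>u\<close>, to orthonormal bases of
  the whole space, and map one to the other.
\<close>

lemma flag_projections_transitive:
  fixes u :: "real^'n"
  assumes u: "norm u = 1" and P: "P \<in> flag_projections u k" "Q \<in> flag_projections u k"
  obtains g where "orthogonal_transformation g" "g u = u" "conj_by g P = Q"
proof -
  obtain B where B: "orthonormal B" "u \<notin> B" "card B = k" "orthonormal (insert u B)" "P = (\<Sum>b\<in>insert u B. rank1 b)"
    using flag_projection_basis[OF u P(1)] .
  obtain C where C: "orthonormal C" "u \<notin> C" "card C = k" "orthonormal (insert u C)" "Q = (\<Sum>b\<in>insert u C. rank1 b)"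
    using flag_projection_basis[OF u P(2)] .
  obtain B' where B': "insert u B \<inter> B' = {}" "orthonormal (insert u B \<union> B')" "span (insert u B \<union> B') = UNIV"
    using orthonormal_complement[OF B(4)] .
  obtain C' where C': "insert u C \<inter> C' = {}" "orthonormal (insert u C \<union> C')" "span (insert u C \<union> C') = UNIV"
    using orthonormal_complement[OF C(4)] .
  have fin: "finite B" "finite C" "finite B'" "finite C'"
    using orthonormal_finite[OF B(1)] orthonormal_finite[OF C(1)] orthonormal_finite[OF B'(2)] orthonormal_finite[OF C'(2)] by auto
  have card_full: "card D = CARD('n)" if "orthonormal D" "span D = (UNIV :: (real^'n) set)" for D
    using dim_eq_card_independent[OF orthonormal_independent[OF that(1)]] dim_span[of D] that(2) by (simp add: dim_UNIV)
  have "card B' = card C'"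
    using card_full[OF B'(2,3)] card_full[OF C'(2,3)] B'(1) C'(1) B(2,3) C(2,3) fin
    by (simp add: card_Un_disjoint)
  then obtain h' where h': "bij_betw h' B' C'" using finite_same_card_bij[OF fin(3,4)] by auto
  obtain h where h: "bij_betw h B C" using finite_same_card_bij[OF fin(1,2)] B(3) C(3) by auto
  \<comment> \<open>The map on the bases respects \<open>u\<close>, the rest of the subspaces, and the complements.\<close>
  define f where "f b = (if b = u then u else if b \<in> B then h b else h' b)" for b
  have fB: "bij_betw f B C" using h B(2) by (subst bij_betw_cong[of B f h]) (auto simp: f_def)
  have fB': "bij_betw f B' C'" using h' B'(1) by (subst bij_betw_cong[of B' f h']) (auto simp: f_def)
  have fu: "bij_betw f {u} {u}" by (simp add: f_def bij_betw_def)
  have fuB: "bij_betw f (insert u B) (insert u C)"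
    using bij_betw_combine[OF fu fB] C(2) by simp
  have f: "bij_betw f (insert u B \<union> B') (insert u C \<union> C')"
    by (rule bij_betw_combine[OF fuB fB' C'(1)])
  obtain g where g: "orthogonal_transformation g" "\<And>b. b \<in> insert u B \<union> B' \<Longrightarrow> g b = f b"
    using orthogonal_transformation_between_bases[OF B'(2,3) C'(2) f] by metis
  have "conj_by g P = (\<Sum>b\<in>insert u B. rank1 (f b))"
    unfolding B(5) conj_by_sum by (intro sum.cong refl) (auto simp: conj_by_rank1[OF g(1)] g(2))
  also have "\<dots> = Q" unfolding C(5) by (rule sum.reindex_bij_betw[OF fuB])
  finally have "conj_by g P = Q" .
  moreover have "g u = u" using g(2)[of u] by (simp add: f_def)
  ultimately show ?thesis using that g(1) by blast
qed

lemma invariant_flag_measure_ball: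
  fixes u :: "real^'n"
  assumes u: "norm u = 1" and sets: "sets M = sets borel"
    and inv: "\<And>g. orthogonal_transformation g \<Longrightarrow> g u = u \<Longrightarrow> distr M borel (conj_by g) = M"
    and P: "P \<in> flag_projections u k" "Q \<in> flag_projections u k"
  shows "emeasure M (ball P r) = emeasure M (ball Q r)"
proof -
  obtain g where g: "orthogonal_transformation g" "g u = u" "conj_by g P = Q"
    using flag_projections_transitive[OF u P] .
  have [measurable]: "conj_by g \<in> measurable M borel"
    using measurable_conj_by sets by (simp cong: measurable_cong_sets)
  have "emeasure M (ball Q r) = emeasure (distr M borel (conj_by g)) (ball Q r)" by (simp add: inv g)
  also have "\<dots> = emeasure M (conj_by g -` ball Q r)"
    using sets_eq_imp_space_eq[OF sets] by (subst emeasure_distr) auto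
  also have "conj_by g -` ball Q r = ball P r"
    using dist_conj_by[OF g(1), of P] by (auto simp: g(3))
  finally show ?thesis by simp
qed

text \<open>
  By transitivity and since conjugation is an isometry of the space of matrices, invariant measures
  are uniformly distributed.
\<close>

lemma invariant_flag_measure_unique:
  fixes u :: "real^'n"
  assumes u: "norm u = 1" and k: "k < CARD('n)" and "prob_space M" and sets: "sets M = sets borel"
    and AE: "AE P in M. P \<in> flag_projections u k"
    and inv: "\<And>g. orthogonal_transformation g \<Longrightarrow> g u = u \<Longrightarrow> distr M borel (conj_by g) = M"
  shows "M = random_flag u k"
  by (rule uniformly_distributed_unique[OF \<open>prob_space M\<close> prob_space_random_flag sets sets_random_flag AE AE_random_flag[OF u k]])
     (auto intro: invariant_flag_measure_ball[OF u sets inv] invariant_flag_measure_ball[OF u sets_random_flag random_flag_conj_by])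

lemma grass_of_flag_of:
  assumes u: "norm u = 1" and \<zeta>: "\<zeta> \<in> grassmannian_perp u k"
  shows "grass_of u k (flag_of u \<zeta>) = \<zeta>"
  using flag_of_grassmannian[OF assms] by (simp add: grass_of_def)

lemma flag_projections_nonempty:
  assumes u: "norm (u :: real^'n) = 1" and k: "k < CARD('n)"
  shows "(SOME P. P \<in> flag_projections u k) \<in> flag_projections u k"
proof -
  interpret prob_space "random_flag u k" by (rule prob_space_random_flag)
  have "\<exists>P. P \<in> flag_projections u k"
  proof (rule ccontr)
    assume "\<not> ?thesis"
    then show False using AE_random_flag[OF u k] AE_False by simp
  qed
  then show ?thesis by (rule someI_ex)
qed

lemma grass_of_in:
  assumes u: "norm (u :: real^'n) = 1" and k: "k < CARD('n)"
  shows "grass_of u k P \<in> grassmannian_perp u k"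
proof (cases "P \<in> flag_projections u k")
  case True then show ?thesis by (rule grass_of_flag_projection[OF u])
next
  case False
  note s = flag_projections_nonempty[OF u k]
  have "grass_of u k P = grass_of u k (SOME P. P \<in> flag_projections u k)"
    using False s by (simp add: grass_of_def)
  then show ?thesis using grass_of_flag_projection(1)[OF u s] by simp
qed

lemma space_grassmannian_borel [simp]: "space (grassmannian_perp_borel u k) = grassmannian_perp u k"
  by (simp add: grassmannian_perp_borel_def)

lemma measurable_proj_grassmannian: "proj \<in> borel_measurable (grassmannian_perp_borel u k)"
  unfolding grassmannian_perp_borel_def proj_def[abs_def] by (rule measurable_vimage_algebra1) simp

lemma measurable_flag_of [measurable]: "flag_of u \<in> borel_measurable (grassmannian_perp_borel u k)"
  unfolding flag_of_def[abs_def] using measurable_proj_grassmannian by measurable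

lemma measurable_into_grassmannian:
  assumes "f \<in> space M \<rightarrow> grassmannian_perp u k" "(\<lambda>x. flag_of u (f x)) \<in> borel_measurable M"
  shows "f \<in> measurable M (grassmannian_perp_borel u k)"
  unfolding grassmannian_perp_borel_def
proof (rule measurable_vimage_algebra2[OF assms(1)])
  have "(\<lambda>x. flag_of u (f x) - rank1 u) \<in> borel_measurable M" using assms(2) by measurable
  then show "(\<lambda>x. matrix (closest_point (f x))) \<in> borel_measurable M" by (simp add: flag_of_def proj_def)
qed

lemma measurable_grass_of [measurable]:
  assumes u: "norm (u :: real^'n) = 1" and k: "k < CARD('n)"
  shows "grass_of u k \<in> measurable borel (grassmannian_perp_borel u k)"
proof (rule measurable_into_grassmannian)
  show "grass_of u k \<in> space borel \<rightarrow> grassmannian_perp u k" using grass_of_in[OF u k] by auto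
  have "flag_of u (grass_of u k P) = (if P \<in> flag_projections u k then P else flag_of u (grass_of u k (SOME P. P \<in> flag_projections u k)))" for P
    using grass_of_flag_projection(2)[OF u] flag_projections_nonempty[OF u k] by (auto simp: grass_of_def)
  then show "(\<lambda>P. flag_of u (grass_of u k P)) \<in> borel_measurable borel" by simp
qed

lemma proj_image:
  assumes g: "orthogonal_transformation g" and S: "subspace S"
  shows "proj (g ` S) = conj_by g (proj S)"
proof -
  have lin: "linear g" by (rule orthogonal_transformation_linear[OF g])
  have gS: "subspace (g ` S)" by (rule linear_subspace_image[OF lin S])
  have "proj (g ` S) *v g x = g (proj S *v x)" for x
    unfolding proj_vec[OF gS]
  proof (rule closest_point_subspace_eqI[OF gS])
    show "g (proj S *v x) \<in> g ` S" using proj_in[OF S] by simp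
    fix y assume "y \<in> g ` S"
    then obtain z where z: "z \<in> S" "y = g z" by auto
    show "(g x - g (proj S *v x)) \<bullet> y = 0"
      using g proj_orthogonal[OF S z(1), of x] by (simp add: z(2) orthogonal_transformation_def flip: linear_diff[OF lin])
  qed
  then show ?thesis using conj_by_eqI[OF g] by metis
qed

lemma conj_by_add: "conj_by g (A + B) = conj_by g A + conj_by g B"
  by (rule matrix_eqI)
     (simp add: conj_by_def matrix_vector_mult_add_rdistrib matrix_vector_right_distrib flip: matrix_vector_mul_assoc)

lemma flag_of_image:
  assumes g: "orthogonal_transformation g" "g u = u" and \<zeta>: "\<zeta> \<in> grassmannian_perp u k"
  shows "flag_of u (g ` \<zeta>) = conj_by g (flag_of u \<zeta>)"
  by (simp add: flag_of_def proj_image[OF g(1) subspace_grassmannian[OF \<zeta>]] conj_by_add conj_by_rank1[OF g(1)] g(2))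

lemma image_grassmannian:
  assumes g: "orthogonal_transformation g" "g u = u" and \<zeta>: "\<zeta> \<in> grassmannian_perp u k"
  shows "g ` \<zeta> \<in> grassmannian_perp u k"
proof -
  have lin: "linear g" by (rule orthogonal_transformation_linear[OF g(1)])
  have "u \<bullet> g x = 0" if "x \<in> \<zeta>" for x
  proof -
    have "g u \<bullet> g x = u \<bullet> x" using g(1) by (simp add: orthogonal_transformation_def)
    then show ?thesis using perp_grassmannian[OF \<zeta> that] g(2) by simp
  qed
  moreover have "dim (g ` \<zeta>) = dim \<zeta>"
    using dim_image_eq[OF lin] orthogonal_transformation_inj[OF g(1)] inj_on_subset by blast
  ultimately show ?thesis
    using \<zeta> linear_subspace_image[OF lin] by (auto simp: grassmannian_perp_def)
qed

lemma measurable_image_grassmannian: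
  assumes g: "orthogonal_transformation g" "g u = u"
  shows "(\<lambda>\<zeta>. g ` \<zeta>) \<in> measurable (grassmannian_perp_borel u k) (grassmannian_perp_borel u k)"
proof (rule measurable_into_grassmannian)
  show "(\<lambda>\<zeta>. g ` \<zeta>) \<in> space (grassmannian_perp_borel u k) \<rightarrow> grassmannian_perp u k"
    using image_grassmannian[OF g] by simp
  show "(\<lambda>\<zeta>. flag_of u (g ` \<zeta>)) \<in> borel_measurable (grassmannian_perp_borel u k)"
    by (subst measurable_cong[where g = "\<lambda>\<zeta>. conj_by g (flag_of u \<zeta>)"]) (auto simp: flag_of_image[OF g])
qed

lemma conj_by_flag:
  assumes g: "orthogonal_transformation g" "g u = u" and u: "norm u = 1" and P: "P \<in> flag_projections u k"
  shows "conj_by g P \<in> flag_projections u k" and "grass_of u k (conj_by g P) = g ` grass_of u k P"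
proof -
  note gr = grass_of_flag_projection[OF u P]
  have *: "flag_of u (g ` grass_of u k P) = conj_by g P"
    using flag_of_image[OF g gr(1)] gr(2) by simp
  note im = image_grassmannian[OF g gr(1)]
  show "conj_by g P \<in> flag_projections u k" using flag_of_grassmannian(1)[OF u im] * by simp
  show "grass_of u k (conj_by g P) = g ` grass_of u k P" using grass_of_flag_of[OF u im] * by simp
qed

text \<open>
  Taking images of subspaces under \<open>g\<close> corresponds to conjugation of projections, which preserves the
  distribution of random flags.
\<close>

lemma is_haar_prob_random_flag:
  assumes u: "norm (u :: real^'n) = 1" and k: "k < CARD('n)"
  shows "is_haar_prob u k (distr (random_flag u k) (grassmannian_perp_borel u k) (grass_of u k))"
  unfolding is_haar_prob_def
proof (intro conjI allI impI)
  let ?G = "grassmannian_perp_borel u k"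
  let ?\<nu> = "distr (random_flag u k) ?G (grass_of u k)"
  note [measurable] = measurable_grass_of[OF u k]
  interpret prob_space "random_flag u k" by (rule prob_space_random_flag)
  show "sets ?\<nu> = sets ?G" by simp
  show "emeasure ?\<nu> (space ?\<nu>) = 1"
    by (rule prob_space.emeasure_space_1[OF prob_space_distr]) simp
  fix g :: "real^'n \<Rightarrow> real^'n" assume "orthogonal_transformation g \<and> g u = u"
  then have g: "orthogonal_transformation g" "g u = u" by auto
  note [measurable] = measurable_image_grassmannian[OF g, of k]
  have "distr ?\<nu> ?\<nu> ((`) g) = distr ?\<nu> ?G ((`) g)" by (rule distr_cong) auto
  also have "\<dots> = distr (random_flag u k) ?G (\<lambda>P. g ` grass_of u k P)"
    by (subst distr_distr) (auto simp: o_def)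
  also have "\<dots> = distr (random_flag u k) ?G (\<lambda>P. grass_of u k (conj_by g P))"
  proof (rule distr_cong_AE)
    show "AE P in random_flag u k. g ` grass_of u k P = grass_of u k (conj_by g P)"
      using AE_random_flag[OF u k] by eventually_elim (simp add: conj_by_flag(2)[OF g u])
  qed auto
  also have "\<dots> = distr (distr (random_flag u k) borel (conj_by g)) ?G (grass_of u k)"
    by (subst distr_distr) (auto simp: o_def)
  also have "\<dots> = ?\<nu>" by (simp add: random_flag_conj_by[OF g])
  finally show "distr ?\<nu> ?\<nu> ((`) g) = ?\<nu>" .
qed

text \<open>
  The image of an invariant measure among the flag projections is the distribution of random flags, and
  the measure is recovered from its image because \<open>grass_of u k\<close> inverts \<open>flag_of u\<close>.
\<close>

lemma is_haar_prob_unique: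
  assumes u: "norm (u :: real^'n) = 1" and k: "k < CARD('n)" and \<nu>: "is_haar_prob u k \<nu>"
  shows "\<nu> = distr (random_flag u k) (grassmannian_perp_borel u k) (grass_of u k)"
proof -
  let ?G = "grassmannian_perp_borel u k"
  have sets: "sets \<nu> = sets ?G" and one: "emeasure \<nu> (space \<nu>) = 1"
    and inv: "\<And>g. orthogonal_transformation g \<Longrightarrow> g u = u \<Longrightarrow> distr \<nu> \<nu> (\<lambda>\<zeta>. g ` \<zeta>) = \<nu>"
    using \<nu> by (auto simp: is_haar_prob_def)
  note [measurable_cong] = sets
  note [measurable] = measurable_grass_of[OF u k]
  interpret prob_space \<nu> by (rule prob_spaceI[OF one])
  have sp: "space \<nu> = grassmannian_perp u k" using sets_eq_imp_space_eq[OF sets] by simp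
  let ?M = "distr \<nu> borel (flag_of u)"
  have "?M = random_flag u k"
  proof (rule invariant_flag_measure_unique[OF u k])
    show "prob_space ?M" by (rule prob_space_distr) simp
    show "AE P in ?M. P \<in> flag_projections u k"
      by (subst AE_distr_iff) (auto simp: sp flag_of_grassmannian[OF u])
    fix g assume g: "orthogonal_transformation g" "g u = u"
    note [measurable] = measurable_image_grassmannian[OF g, of k]
    have "distr ?M borel (conj_by g) = distr \<nu> borel (\<lambda>\<zeta>. conj_by g (flag_of u \<zeta>))"
      by (subst distr_distr) (auto simp: o_def)
    also have "\<dots> = distr \<nu> borel (\<lambda>\<zeta>. flag_of u (g ` \<zeta>))"
      by (intro distr_cong) (auto simp: sp flag_of_image[OF g])
    also have "\<dots> = distr (distr \<nu> \<nu> (\<lambda>\<zeta>. g ` \<zeta>)) borel (flag_of u)"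
      by (subst distr_distr) (auto simp: o_def)
    finally show "distr ?M borel (conj_by g) = ?M" by (simp add: inv g)
  qed simp
  then have "distr (random_flag u k) ?G (grass_of u k) = distr ?M ?G (grass_of u k)" by simp
  also have "\<dots> = distr \<nu> ?G (\<lambda>\<zeta>. grass_of u k (flag_of u \<zeta>))"
    by (subst distr_distr) (auto simp: o_def)
  also have "\<dots> = distr \<nu> \<nu> (\<lambda>\<zeta>. \<zeta>)"
    by (intro distr_cong) (auto simp: sp sets grass_of_flag_of[OF u])
  finally show ?thesis by simp
qed

lemma haar_prob_eq:
  assumes u: "norm (u :: real^'n) = 1" and k: "k < CARD('n)"
  shows "haar_prob u k = distr (random_flag u k) (grassmannian_perp_borel u k) (grass_of u k)"
  unfolding haar_prob_def
proof (rule the_equality)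
  show "is_haar_prob u k (distr (random_flag u k) (grassmannian_perp_borel u k) (grass_of u k))"
    by (rule is_haar_prob_random_flag[OF u k])
qed (rule is_haar_prob_unique[OF u k])

section \<open>The dual Radon transform of section volumes\<close>

text \<open>
  Integrating out the last random vector turns an integral over random flags of length \<open>k + 1\<close> into
  one over random flags of length \<open>k\<close>, with an integrand that again does not involve \<open>u\<close>.
\<close>

lemma borel_measurable_nn_integral_random_flag:
  assumes "f \<in> borel_measurable borel"
  shows "(\<lambda>u::real^'n. \<integral>\<^sup>+P. f P \<partial>random_flag u k) \<in> borel_measurable borel"
  using assms
proof (induction k arbitrary: f)
  case (0 f)
  note [measurable] = 0
  have "continuous_on UNIV (rank1 :: real^'n \<Rightarrow> _)" by (intro continuous_intros)
  then have [measurable]: "(rank1 :: real^'n \<Rightarrow> _) \<in> borel_measurable borel"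
    by (rule borel_measurable_continuous_onI)
  show ?case by (simp add: nn_integral_return)
next
  case (Suc k f)
  note [measurable] = Suc.prems
  interpret B: prob_space "ball_measure :: (real^'n) measure" by (rule prob_space_ball_measure)
  have [measurable]: "(\<lambda>(P, v). f (adjoin P v)) \<in> borel_measurable (borel \<Otimes>\<^sub>M (ball_measure :: (real^'n) measure))"
  proof -
    have "(\<lambda>p. f ((\<lambda>(P, v). adjoin P v) p)) \<in> borel_measurable (borel \<Otimes>\<^sub>M (borel :: (real^'n) measure))"
      by measurable
    then show ?thesis by (simp add: split_beta' cong: measurable_cong_sets sets_pair_measure_cong)
  qed
  have m: "(\<lambda>P. \<integral>\<^sup>+v. f (adjoin P v) \<partial>ball_measure) \<in> borel_measurable borel"
    by (rule B.borel_measurable_nn_integral) measurable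
  have "(\<integral>\<^sup>+P. f P \<partial>random_flag u (Suc k)) = (\<integral>\<^sup>+P. (\<integral>\<^sup>+v. f (adjoin P v) \<partial>ball_measure) \<partial>random_flag u k)" for u :: "real^'n"
  proof -
    have "(\<integral>\<^sup>+P. f P \<partial>random_flag u (Suc k)) = (\<integral>\<^sup>+p. f ((\<lambda>(P, v). adjoin P v) p) \<partial>(random_flag u k \<Otimes>\<^sub>M ball_measure))"
      unfolding random_flag.simps by (rule nn_integral_distr[OF measurable_adjoin_random_flag]) simp
    also have "\<dots> = (\<integral>\<^sup>+P. (\<integral>\<^sup>+v. f ((\<lambda>(P, v). adjoin P v) (P, v)) \<partial>ball_measure) \<partial>random_flag u k)"
      by (rule B.nn_integral_fst[symmetric]) (intro measurable_compose[OF measurable_adjoin_random_flag], simp)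
    finally show ?thesis by simp
  qed
  then show ?case using Suc.IH[OF m] by simp
qed

definition radon_const :: "nat \<Rightarrow> nat \<Rightarrow> real" where
  "radon_const n m = (real m * unit_ball_vol (real m)) / (real n * unit_ball_vol (real n))"

lemma radon_const_nonneg: "0 \<le> radon_const n m"
  by (simp add: radon_const_def)

abbreviation section_radon :: "nat \<Rightarrow> (real^'n) set \<Rightarrow> real^'n \<Rightarrow> real" where
  "section_radon m K \<equiv> dual_radon m (\<lambda>\<xi>. section_vol K \<xi> ^ (CARD('n) - 1))"

text \<open>
  The integral over the Grassmannian becomes an integral over projections onto subspaces through \<open>u\<close>.
\<close>

lemma section_radon_eq:
  fixes u :: "real^'n"
  assumes u: "norm u = 1" and m: "m \<in> {1..CARD('n) - 1}" and K: "K \<in> sets borel"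
  shows "section_radon m K u = radon_const CARD('n) m *
     (\<integral>P. gauss_section K P ^ (CARD('n) - 1) \<partial>random_flag u (m - 1))"
proof -
  let ?k = "m - 1" let ?G = "grassmannian_perp_borel u ?k"
  have k: "?k < CARD('n)" using m by auto
  note [measurable] = borel_measurable_gauss_section[OF K] measurable_grass_of[OF u k]
  let ?f = "\<lambda>\<zeta>. section_vol K (span (insert u \<zeta>)) ^ (CARD('n) - 1)"
  have f: "?f \<zeta> = gauss_section K (flag_of u \<zeta>) ^ (CARD('n) - 1)" if "\<zeta> \<in> grassmannian_perp u ?k" for \<zeta>
    by (simp add: section_vol_eq_gauss_section K flag_of_grassmannian(3)[OF u that])
  have sp: "space (haar_prob u ?k) = grassmannian_perp u ?k"
    by (simp only: haar_prob_eq[OF u k] space_distr space_grassmannian_borel)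
  have "(\<integral>\<zeta>. ?f \<zeta> \<partial>haar_prob u ?k) = (\<integral>\<zeta>. gauss_section K (flag_of u \<zeta>) ^ (CARD('n) - 1) \<partial>haar_prob u ?k)"
    by (rule Bochner_Integration.integral_cong) (simp_all only: sp f)
  also have "\<dots> = (\<integral>P. gauss_section K (flag_of u (grass_of u ?k P)) ^ (CARD('n) - 1) \<partial>random_flag u ?k)"
    unfolding haar_prob_eq[OF u k] by (rule integral_distr) measurable
  also have "\<dots> = (\<integral>P. gauss_section K P ^ (CARD('n) - 1) \<partial>random_flag u ?k)"
  proof (rule integral_cong_AE)
    show "AE P in random_flag u ?k. gauss_section K (flag_of u (grass_of u ?k P)) ^ (CARD('n) - 1) = gauss_section K P ^ (CARD('n) - 1)"
      using AE_random_flag[OF u k] by eventually_elim (simp add: grass_of_flag_projection(2)[OF u])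
  qed measurable
  finally show ?thesis by (simp add: dual_radon_def radon_const_def)
qed

lemma borel_measurable_section_radon:
  assumes m: "m \<in> {1..CARD('n) - 1}" and K: "K \<in> sets borel"
  shows "section_radon m K \<in> borel_measurable (sphere_borel :: (real^'n) measure)"
proof -
  note [measurable] = borel_measurable_gauss_section[OF K]
  have eq: "(\<integral>P. gauss_section K P ^ (CARD('n) - 1) \<partial>random_flag u (m - 1))
      = enn2real (\<integral>\<^sup>+P. ennreal (gauss_section K P ^ (CARD('n) - 1)) \<partial>random_flag u (m - 1))" for u :: "real^'n"
    by (rule integral_eq_nn_integral) (auto simp: gauss_section_nonneg)
  have [measurable]: "(\<lambda>u::real^'n. \<integral>\<^sup>+P. ennreal (gauss_section K P ^ (CARD('n) - 1)) \<partial>random_flag u (m - 1)) \<in> borel_measurable borel"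
    by (rule borel_measurable_nn_integral_random_flag) measurable
  have "(\<lambda>u. radon_const CARD('n) m * (\<integral>P. gauss_section K P ^ (CARD('n) - 1) \<partial>random_flag u (m - 1))) \<in> borel_measurable (borel :: (real^'n) measure)"
    unfolding eq by measurable
  then have "(\<lambda>u. radon_const CARD('n) m * (\<integral>P. gauss_section K P ^ (CARD('n) - 1) \<partial>random_flag u (m - 1))) \<in> borel_measurable (sphere_borel :: (real^'n) measure)"
    by (rule measurable_restrict_space1)
  then show ?thesis
    by (rule measurable_cong[THEN iffD1, rotated], subst section_radon_eq[OF _ m K]) (auto simp: space_restrict_space)
qed

lemma section_radon_bounds:
  fixes u :: "real^'n"
  assumes u: "norm u = 1" and m: "m \<in> {1..CARD('n) - 1}" and K: "K \<in> sets borel" "K \<subseteq> cball 0 R"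
  shows "0 \<le> section_radon m K u" "section_radon m K u \<le> radon_const CARD('n) m * exp (pi * R\<^sup>2) ^ (CARD('n) - 1)"
proof -
  have k: "m - 1 < CARD('n)" using m by auto
  note [measurable] = borel_measurable_gauss_section[OF K(1)]
  interpret prob_space "random_flag u (m - 1)" by (rule prob_space_random_flag)
  have AE: "AE P in random_flag u (m - 1). gauss_section K P ^ (CARD('n) - 1) \<le> exp (pi * R\<^sup>2) ^ (CARD('n) - 1)"
    using AE_random_flag[OF u k]
    by eventually_elim (intro power_mono gauss_section_le[OF _ K(2)] gauss_section_nonneg, simp add: flag_projections_def)
  have "(\<integral>P. gauss_section K P ^ (CARD('n) - 1) \<partial>random_flag u (m - 1)) \<le> (\<integral>P. exp (pi * R\<^sup>2) ^ (CARD('n) - 1) \<partial>random_flag u (m - 1))"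
    by (rule integral_mono_AE'[OF integrable_const AE]) simp
  also have "\<dots> = exp (pi * R\<^sup>2) ^ (CARD('n) - 1)" using prob_space by simp
  finally show "section_radon m K u \<le> radon_const CARD('n) m * exp (pi * R\<^sup>2) ^ (CARD('n) - 1)"
    unfolding section_radon_eq[OF u m K(1)] by (intro mult_left_mono radon_const_nonneg)
  show "0 \<le> section_radon m K u"
    unfolding section_radon_eq[OF u m K(1)]
    by (intro mult_nonneg_nonneg radon_const_nonneg integral_nonneg_AE) (auto simp: gauss_section_nonneg)
qed

context hausdorff_convergence begin

text \<open>
  All subspaces in the integral contain the interior point \<open>t u\<close> of \<open>L\<close>, hence all section volumes
  converge.
\<close>

lemma section_radon_tendsto:
  assumes u: "norm u = 1" and m: "m \<in> {1..CARD('n) - 1}" and t: "t *\<^sub>R u \<in> interior L"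
  shows "(\<lambda>j. section_radon m (K j) u) \<longlonglongrightarrow> section_radon m L u"
proof -
  have k: "m - 1 < CARD('n)" using m by auto
  have borel: "K j \<in> sets borel" "L \<in> sets borel" for j
    using convex_bodies_oD(4)[OF K] convex_bodies_oD(4)[OF L] by simp_all
  note [measurable] = borel_measurable_gauss_section[OF borel(1)] borel_measurable_gauss_section[OF borel(2)]
  obtain R where R: "R > 0" "\<And>j. K j \<subseteq> cball 0 R" "L \<subseteq> cball 0 R" using uniformly_bounded by blast
  interpret prob_space "random_flag u (m - 1)" by (rule prob_space_random_flag)
  note AE = AE_random_flag[OF u k]
  have "(\<lambda>j. \<integral>P. gauss_section (K j) P ^ (CARD('n) - 1) \<partial>random_flag u (m - 1))
      \<longlonglongrightarrow> (\<integral>P. gauss_section L P ^ (CARD('n) - 1) \<partial>random_flag u (m - 1))"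
  proof (rule integral_dominated_convergence[where w = "\<lambda>_. exp (pi * R\<^sup>2) ^ (CARD('n) - 1)"])
    show "AE P in random_flag u (m - 1). norm (gauss_section (K j) P ^ (CARD('n) - 1)) \<le> exp (pi * R\<^sup>2) ^ (CARD('n) - 1)" for j
      using AE
    proof eventually_elim
      case (elim P)
      then have "gauss_section (K j) P ^ (CARD('n) - 1) \<le> exp (pi * R\<^sup>2) ^ (CARD('n) - 1)"
        by (intro power_mono gauss_section_le[OF _ R(2)] gauss_section_nonneg) (simp add: flag_projections_def)
      then show ?case by (simp add: gauss_section_nonneg)
    qed
    show "AE P in random_flag u (m - 1). (\<lambda>j. gauss_section (K j) P ^ (CARD('n) - 1)) \<longlonglongrightarrow> gauss_section L P ^ (CARD('n) - 1)"
      using AE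
    proof eventually_elim
      case (elim P)
      then have "is_projection P" "P *v (t *\<^sub>R u) = t *\<^sub>R u"
        by (simp_all add: flag_projections_def matrix_vector_mult_scaleR)
      then show ?case by (intro tendsto_power gauss_section_tendsto[OF _ t])
    qed
    show "integrable (random_flag u (m - 1)) (\<lambda>_. exp (pi * R\<^sup>2) ^ (CARD('n) - 1))"
      by (rule integrable_const)
  qed auto
  then show ?thesis unfolding section_radon_eq[OF u m borel(1)] section_radon_eq[OF u m borel(2)]
    by (intro tendsto_mult_left)
qed

end

section \<open>Linear functionals with several maximizers\<close>

text \<open>
  Averaging the measure of \<open>S\<close> over its translates by \<open>t e\<close>, \<open>0 \<le> t \<le> 1\<close>, and exchanging the
  integrals leaves inner integrals over lines in direction \<open>e\<close>, all of which vanish.  In this form of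
  Fubini's theorem the direction need not be a coordinate axis.
\<close>

lemma null_set_if_countable_on_lines:
  fixes S :: "'a::euclidean_space set"
  assumes S[measurable]: "S \<in> sets borel" and line: "\<And>x. countable {t. x + t *\<^sub>R e \<in> S}"
  shows "S \<in> null_sets lborel"
proof -
  let ?f = "\<lambda>x t. indicator {0..1::real} t * indicator S (x + t *\<^sub>R e) :: ennreal"
  have "emeasure lborel S = (\<integral>\<^sup>+t. indicator {0..1::real} t * emeasure lborel S \<partial>lborel)"
    by (simp add: nn_integral_multc)
  also have "\<dots> = (\<integral>\<^sup>+t. (\<integral>\<^sup>+x. ?f x t \<partial>lborel) \<partial>lborel)"
  proof (rule nn_integral_cong)
    fix t :: real
    have "emeasure lborel S = (\<integral>\<^sup>+x. indicator S x \<partial>distr lborel borel ((+) (t *\<^sub>R e)))"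
      by (subst lborel_distr_plus) simp
    also have "\<dots> = (\<integral>\<^sup>+x. indicator S (x + t *\<^sub>R e) \<partial>lborel)"
      by (subst nn_integral_distr) (auto simp: add.commute)
    finally show "indicator {0..1} t * emeasure lborel S = (\<integral>\<^sup>+x. ?f x t \<partial>lborel)"
      by (simp add: nn_integral_cmult)
  qed
  also have "\<dots> = (\<integral>\<^sup>+x. (\<integral>\<^sup>+t. ?f x t \<partial>lborel) \<partial>lborel)"
    by (rule lborel_pair.Fubini') measurable
  also have "\<dots> = (\<integral>\<^sup>+x. 0 \<partial>(lborel :: 'a measure))"
  proof (rule nn_integral_cong)
    fix x :: 'a
    have "AE t in lborel. t \<notin> {t. x + t *\<^sub>R e \<in> S}"
      by (rule AE_not_in, rule countable_imp_null_set_lborel, rule line)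
    then have "(\<integral>\<^sup>+t. ?f x t \<partial>lborel) = (\<integral>\<^sup>+t. 0 \<partial>(lborel :: real measure))"
      by (intro nn_integral_cong_AE) (auto elim!: eventually_mono)
    then show "(\<integral>\<^sup>+t. ?f x t \<partial>lborel) = 0" by simp
  qed
  finally show ?thesis by (simp add: null_sets_def)
qed

definition maximizers :: "'a::euclidean_space set \<Rightarrow> 'a \<Rightarrow> 'a set" where
  "maximizers C x = {y \<in> C. \<forall>z\<in>C. z \<bullet> x \<le> y \<bullet> x}"

text \<open>
  A projection along the compact set \<open>D\<close>.
\<close>

lemma closed_maximizers_meet:
  fixes D :: "'a::euclidean_space set"
  assumes "compact D" "closed C"
  shows "closed {x. maximizers C x \<inter> D \<noteq> {}}"
proof -
  let ?S = "{(y,x). y \<in> C \<and> y \<in> D \<and> (\<forall>z\<in>C. z \<bullet> x \<le> y \<bullet> x)}"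
  have "?S = (\<Inter>z\<in>C. {p. z \<bullet> snd p \<le> fst p \<bullet> snd p}) \<inter> ((C \<inter> D) \<times> UNIV)" by auto
  also have "closed \<dots>"
    using assms by (intro closed_Int closed_INT closed_Times compact_imp_closed closed_Collect_le continuous_intros ballI) auto
  finally have cl: "closed ?S" .
  have "{x. maximizers C x \<inter> D \<noteq> {}} = {x. \<exists>y. y \<in> D \<and> (y, x) \<in> ?S}"
    by (auto simp: maximizers_def)
  also have "closed \<dots>"
    by (rule closed_compact_projection[OF assms(1) cl])
  finally show ?thesis .
qed

text \<open>
  If \<open>y\<^sub>1\<close> and \<open>y\<^sub>2\<close> maximize the functionals \<open>x + t\<^sub>1 e\<close> and \<open>x + t\<^sub>2 e\<close> with \<open>t\<^sub>1 < t\<^sub>2\<close>, adding the two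
  optimality conditions gives \<open>y\<^sub>1 \<bullet> e \<le> y\<^sub>2 \<bullet> e\<close>.  Hence for \<open>r < s\<close> a line in direction \<open>e\<close> contains at
  most one functional that has both a maximizer \<open>y\<close> with \<open>y \<bullet> e \<le> r\<close> and one with \<open>s \<le> y \<bullet> e\<close>.  Functionals
  with several maximizers are of this kind for suitable rational \<open>r < s\<close> and some basis vector \<open>e\<close>;
  the restriction to balls only serves to make the sets closed.
\<close>

lemma null_set_several_maximizers:
  fixes C :: "'a::euclidean_space set"
  assumes C: "closed C"
  shows "{x. \<exists>y\<in>maximizers C x. \<exists>z\<in>maximizers C x. y \<noteq> z} \<in> null_sets lborel"
proof -
  define low where "low e r k = C \<inter> cball 0 (real k) \<inter> {y. y \<bullet> e \<le> r}" for e :: 'a and r k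
  define high where "high e s k = C \<inter> cball 0 (real k) \<inter> {y. s \<le> y \<bullet> e}" for e :: 'a and s k
  define S where "S e r s k = {x. maximizers C x \<inter> low e r k \<noteq> {}} \<inter> {x. maximizers C x \<inter> high e s k \<noteq> {}}"
    for e r s k
  have comp: "compact (low e r k)" "compact (high e r k)" for e r k
    unfolding low_def high_def
    by (intro closed_Int_compact compact_Int_closed C closed_Collect_le continuous_intros; simp)+
  have null: "S e r s k \<in> null_sets lborel" if rs: "r < s" for e r s k
  proof (rule null_set_if_countable_on_lines[where e = e])
    have "closed (S e r s k)"
      unfolding S_def by (intro closed_Int closed_maximizers_meet comp C)
    then show "S e r s k \<in> sets borel" by simp
    fix x :: 'a
    have mono: False if t: "t1 < t2" "x + t1 *\<^sub>R e \<in> S e r s k" "x + t2 *\<^sub>R e \<in> S e r s k" for t1 t2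
    proof -
      from t(2) obtain y1 where y1: "y1 \<in> maximizers C (x + t1 *\<^sub>R e)" "s \<le> y1 \<bullet> e"
        by (auto simp: S_def high_def)
      from t(3) obtain y2 where y2: "y2 \<in> maximizers C (x + t2 *\<^sub>R e)" "y2 \<bullet> e \<le> r"
        by (auto simp: S_def low_def)
      have "y2 \<bullet> (x + t1 *\<^sub>R e) \<le> y1 \<bullet> (x + t1 *\<^sub>R e)" "y1 \<bullet> (x + t2 *\<^sub>R e) \<le> y2 \<bullet> (x + t2 *\<^sub>R e)"
        using y1 y2 by (auto simp: maximizers_def)
      then have "(t2 - t1) * (y1 \<bullet> e) \<le> (t2 - t1) * (y2 \<bullet> e)"
        by (simp add: inner_add_right algebra_simps)
      then show False using t(1) y1(2) y2(2) rs by (simp add: mult_le_cancel_left)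
    qed
    have "\<exists>a. {t. x + t *\<^sub>R e \<in> S e r s k} \<subseteq> {a}"
      using mono by (metis (mono_tags, lifting) insertI1 linorder_less_linear mem_Collect_eq singletonI subsetI)
    then show "countable {t. x + t *\<^sub>R e \<in> S e r s k}"
      by (meson countable_empty countable_insert countable_subset)
  qed
  have "{x. \<exists>y\<in>maximizers C x. \<exists>z\<in>maximizers C x. y \<noteq> z} =
     (\<Union>e\<in>Basis. \<Union>(r,s)\<in>{(r,s)\<in>\<rat>\<times>\<rat>. r < s}. \<Union>k. S e r s k)" (is "?L = ?R")
  proof (intro equalityI subsetI)
    fix x assume "x \<in> ?L"
    then obtain y z where yz: "y \<in> maximizers C x" "z \<in> maximizers C x" "y \<noteq> z" by auto
    then obtain e where e: "e \<in> Basis" "y \<bullet> e \<noteq> z \<bullet> e"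
      using euclidean_eq_iff[of y z] by auto
    obtain y z where yz: "y \<in> maximizers C x" "z \<in> maximizers C x" "y \<bullet> e < z \<bullet> e"
      using yz e by (metis linorder_less_linear)
    obtain q where q: "y \<bullet> e < q" "q < z \<bullet> e" using yz(3) dense by blast
    obtain r where r: "r \<in> \<rat>" "y \<bullet> e < r" "r < q" using q(1) Rats_dense_in_real by blast
    obtain s where s: "s \<in> \<rat>" "q < s" "s < z \<bullet> e" using q(2) Rats_dense_in_real by blast
    obtain k :: nat where k: "max (norm y) (norm z) \<le> real k" using real_arch_simple by blast
    have "x \<in> S e r s k"
      using yz r s k unfolding S_def low_def high_def by (auto simp: maximizers_def intro!: exI[of _ y] exI[of _ z])
    then show "x \<in> ?R" using e(1) r s q by force
  next
    fix x assume "x \<in> ?R"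
    then show "x \<in> ?L" by (fastforce simp: S_def low_def high_def)
  qed
  also have "\<dots> \<in> null_sets lborel"
  proof (intro null_sets_UN')
    show "countable (Basis :: 'a set)" by (simp add: countable_finite)
    show "countable {(r, s) \<in> \<rat> \<times> \<rat>. r < (s::real)}"
      by (rule countable_subset[of _ "\<rat> \<times> \<rat>"]) (auto simp: countable_rat)
  qed (auto simp: null)
  finally show ?thesis .
qed

section \<open>Spherical Lebesgue measure\<close>

lemma sets_sphere_lebesgue_borel: "A \<in> sets (sphere_borel :: (real^'n) measure) \<Longrightarrow> A \<in> sets sphere_lebesgue"
  unfolding sphere_lebesgue_def by (intro sets_completionI_sets) simp

lemma space_sphere_lebesgue [simp]: "space (sphere_lebesgue :: (real^'n) measure) = sphere 0 1"
  unfolding sphere_lebesgue_def by (simp add: space_restrict_space space_scale_measure)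

lemma measurable_sgn_sphere:
  "sgn \<in> measurable (restrict_space lborel (ball 0 1 - {0})) (sphere_borel :: (real^'n) measure)"
proof (rule measurable_restrict_space2)
  show "sgn \<in> space (restrict_space lborel (ball 0 1 - {0})) \<rightarrow> (sphere 0 1 :: (real^'n) set)"
    by (auto simp: space_restrict_space norm_sgn)
  have "(sgn :: real^'n \<Rightarrow> real^'n) \<in> borel_measurable borel"
    unfolding sgn_div_norm[abs_def] by measurable
  then show "sgn \<in> measurable (restrict_space lborel (ball 0 1 - {0})) (borel :: (real^'n) measure)"
    by (intro measurable_restrict_space1) simp
qed

lemma emeasure_sphere_lebesgue:
  fixes A :: "(real^'n) set"
  assumes "A \<in> sets sphere_borel"
  shows "emeasure sphere_lebesgue A = of_nat CARD('n) * emeasure lborel {x \<in> ball 0 1 - {0}. sgn x \<in> A}"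
proof -
  have "emeasure sphere_lebesgue A = of_nat CARD('n) *
     emeasure (restrict_space lborel (ball 0 1 - {0})) (sgn -` A \<inter> space (restrict_space lborel (ball 0 1 - {0})))"
    unfolding sphere_lebesgue_def using assms
    by (subst emeasure_completion) (simp_all add: emeasure_distr[OF measurable_sgn_sphere])
  also have "sgn -` A \<inter> space (restrict_space lborel (ball 0 1 - {0})) = {x \<in> ball 0 1 - {0}. sgn x \<in> A}"
    by (auto simp: space_restrict_space)
  also have "emeasure (restrict_space lborel (ball 0 1 - {0})) \<dots> = emeasure lborel {x \<in> ball 0 1 - {0}. sgn x \<in> A}"
    by (intro emeasure_restrict_space) auto
  finally show ?thesis .
qed

lemma finite_measure_sphere_lebesgue: "finite_measure (sphere_lebesgue :: (real^'n) measure)"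
proof
  have "emeasure sphere_lebesgue (sphere 0 1 :: (real^'n) set) =
      of_nat CARD('n) * emeasure lborel {x \<in> ball 0 1 - {0::real^'n}. sgn x \<in> sphere 0 1}"
    by (rule emeasure_sphere_lebesgue) (simp add: sets_restrict_space_iff)
  also have "\<dots> \<le> of_nat CARD('n) * emeasure lborel (ball 0 1 :: (real^'n) set)"
    by (intro mult_left_mono emeasure_mono) auto
  also have "\<dots> < \<infinity>"
    using emeasure_lborel_ball_finite[of "0::real^'n" 1] by (simp add: ennreal_mult_less_top of_nat_less_top)
  finally show "emeasure sphere_lebesgue (space (sphere_lebesgue :: (real^'n) measure)) \<noteq> \<infinity>" by simp
qed

text \<open>
  Spherical Lebesgue measure is defined by cones, so null cones cut out null sets on the sphere.
\<close>

lemma AE_sphere_lebesgue_not_in_cone: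
  fixes A :: "(real^'n) set"
  assumes A: "A \<in> null_sets lborel" and cone: "\<And>x. x \<noteq> 0 \<Longrightarrow> sgn x \<in> A \<Longrightarrow> x \<in> A"
  shows "AE u in sphere_lebesgue. u \<notin> A"
proof -
  have [measurable]: "A \<in> sets borel" using A by auto
  have s: "A \<inter> sphere 0 1 \<in> sets (sphere_borel :: (real^'n) measure)"
    by (subst sets_restrict_space_iff) auto
  have "{x \<in> ball 0 1 - {0}. sgn x \<in> A \<inter> sphere 0 1} \<subseteq> A" using cone by auto
  then have "emeasure lborel {x \<in> ball 0 1 - {0}. sgn x \<in> A \<inter> sphere 0 1} \<le> emeasure lborel A"
    using A by (intro emeasure_mono) auto
  then have "emeasure sphere_lebesgue (A \<inter> sphere 0 1) = 0"
    using A by (subst emeasure_sphere_lebesgue[OF s]) auto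
  then have "A \<inter> sphere 0 1 \<in> null_sets sphere_lebesgue"
    using sets_sphere_lebesgue_borel[OF s] by auto
  from AE_not_in[OF this] AE_space show ?thesis by eventually_elim auto
qed

section \<open>The Gauss map of a convex body\<close>

text \<open>
  The open cone generated by the interior of \<open>K\<close>.  If \<open>K\<close> has interior points,
  all directions of positive radius lie in this cone or on its frontier.
\<close>

definition inner_directions :: "(real^'n) set \<Rightarrow> (real^'n) set" where
  "inner_directions K = {x. \<exists>t>0. t *\<^sub>R x \<in> interior K}"

definition polar :: "(real^'n) set \<Rightarrow> (real^'n) set" where
  "polar K = {y. \<forall>x\<in>K. y \<bullet> x \<le> 1}"

text \<open>
  Within the inner directions these are the directions in which the boundary point of \<open>K\<close> has several
  unit normals.
\<close>

definition rough_directions :: "(real^'n) set \<Rightarrow> (real^'n) set" where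
  "rough_directions K = {x. \<exists>y\<in>maximizers (polar K) x. \<exists>z\<in>maximizers (polar K) x. y \<noteq> z}"

definition smooth_directions :: "(real^'n) set \<Rightarrow> (real^'n) set" where
  "smooth_directions K = inner_directions K - rough_directions K"

lemma open_inner_directions: "open (inner_directions K)"
proof -
  have "inner_directions K = (\<Union>t\<in>{0<..}. (\<lambda>x. t *\<^sub>R x) -` interior K)"
    by (auto simp: inner_directions_def)
  also have "open \<dots>" by (intro open_UN ballI open_vimage open_interior continuous_intros)
  finally show ?thesis .
qed

lemma closed_polar: "closed (polar K)"
proof -
  have "polar K = (\<Inter>x\<in>K. {y. y \<bullet> x \<le> 1})" by (auto simp: polar_def)
  also have "closed \<dots>" by (intro closed_INT ballI closed_Collect_le continuous_intros)
  finally show ?thesis .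
qed

lemma null_set_rough_directions: "rough_directions K \<in> null_sets lborel"
  unfolding rough_directions_def by (rule null_set_several_maximizers[OF closed_polar])

lemma sets_smooth_directions [measurable]: "smooth_directions K \<in> sets borel"
  using null_set_rough_directions[of K] open_inner_directions[of K] by (auto simp: smooth_directions_def)

text \<open>
  The cone generated by \<open>K\<close> is convex, and its interior is the cone generated by the interior of \<open>K\<close>,
  so the difference lies in the frontier of a convex set.  If \<open>K\<close> has no interior points, the cone
  lies in a hyperplane.
\<close>

lemma null_set_boundary_directions:
  assumes K: "K \<in> convex_bodies_o"
  shows "{x. \<exists>t>0. t *\<^sub>R x \<in> K} - inner_directions K \<in> null_sets lborel"
proof -
  let ?F = "{x. \<exists>t>0. t *\<^sub>R x \<in> K}"
  note conv = convex_bodies_oD(2)[OF K] and zero = convex_bodies_oD(3)[OF K]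
  have shrink: "s *\<^sub>R x \<in> K" if "x \<in> K" "0 \<le> s" "s \<le> 1" for s x
    using convexD[OF conv that(1) zero, of s "1 - s"] that by simp
  have F: "?F = (\<Union>k::nat. (\<lambda>x. (1 / real (Suc k)) *\<^sub>R x) -` K)"
  proof (intro equalityI subsetI)
    fix x assume "x \<in> ?F"
    then obtain t where t: "t > 0" "t *\<^sub>R x \<in> K" by auto
    obtain k where k: "1 / real (Suc k) < t" using nat_approx_posE[OF t(1)] .
    have "0 \<le> 1 / real (Suc k) / t" "1 / real (Suc k) / t \<le> 1"
      using t(1) less_imp_le[OF k] by (simp_all only: pos_divide_le_eq mult_1) auto
    from shrink[OF t(2) this] have "(1 / real (Suc k) / t) *\<^sub>R (t *\<^sub>R x) \<in> K" .
    then show "x \<in> (\<Union>k::nat. (\<lambda>x. (1 / real (Suc k)) *\<^sub>R x) -` K)" using t(1) by auto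
  next
    fix x assume "x \<in> (\<Union>k::nat. (\<lambda>x. (1 / real (Suc k)) *\<^sub>R x) -` K)"
    then obtain k :: nat where "(1 / real (Suc k)) *\<^sub>R x \<in> K" by auto
    then show "x \<in> ?F" by (intro CollectI exI[of _ "1 / real (Suc k)"]) auto
  qed
  have "closed ((\<lambda>x. (1 / real (Suc k)) *\<^sub>R x) -` K)" for k
    by (intro closed_vimage convex_bodies_oD(4)[OF K] continuous_intros)
  then have "?F \<in> sets borel" unfolding F by (intro sets.countable_UN) auto
  then have sets: "?F - inner_directions K \<in> sets borel" using open_inner_directions[of K] by auto
  have "negligible (?F - inner_directions K)"
  proof (cases "interior K = {}")
    case True
    obtain a b where ab: "a \<noteq> 0" "K \<subseteq> {x. a \<bullet> x = b}"
      using empty_interior_subset_hyperplane[OF conv True] by blast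
    have "b = 0" using ab zero by auto
    then have "?F - inner_directions K \<subseteq> {x. a \<bullet> x = 0}" using ab by (auto dest!: subsetD[OF ab(2)])
    moreover have "negligible {x. a \<bullet> x = 0}" using ab(1) by (intro negligible_hyperplane) auto
    ultimately show ?thesis by (rule negligible_subset[rotated])
  next
    case False
    then obtain p where p: "p \<in> interior K" by auto
    have "convex ?F"
    proof (rule convexI)
      fix x y and a b :: real assume xy: "x \<in> ?F" "y \<in> ?F" and ab: "0 \<le> a" "0 \<le> b" "a + b = 1"
      obtain s t where st: "s > 0" "s *\<^sub>R x \<in> K" "t > 0" "t *\<^sub>R y \<in> K" using xy by auto
      define r where "r = min s t"
      have r: "r > 0" using st by (simp add: r_def)
      have rs: "0 \<le> r / s" "r / s \<le> 1" "0 \<le> r / t" "r / t \<le> 1" using st by (auto simp: r_def)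
      have "(r / s) *\<^sub>R (s *\<^sub>R x) \<in> K" "(r / t) *\<^sub>R (t *\<^sub>R y) \<in> K"
        using shrink[OF st(2) rs(1,2)] shrink[OF st(4) rs(3,4)] .
      then have "r *\<^sub>R x \<in> K" "r *\<^sub>R y \<in> K" using st by auto
      then have "a *\<^sub>R (r *\<^sub>R x) + b *\<^sub>R (r *\<^sub>R y) \<in> K" using ab by (intro convexD[OF conv])
      then have "r *\<^sub>R (a *\<^sub>R x + b *\<^sub>R y) \<in> K" by (simp add: scaleR_add_right mult.commute)
      then show "a *\<^sub>R x + b *\<^sub>R y \<in> ?F" using r by auto
    qed
    then have "negligible (frontier ?F)" by (rule negligible_convex_frontier)
    moreover have "?F - inner_directions K \<subseteq> frontier ?F"
    proof
      fix x assume x: "x \<in> ?F - inner_directions K"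
      have "x \<notin> interior ?F"
      proof
        assume "x \<in> interior ?F"
        then obtain e where e: "e > 0" "cball x e \<subseteq> ?F" by (auto simp: mem_interior_cball)
        \<comment> \<open>A positive step width with \<open>d |p| \<le> e\<close>.\<close>
        define d where "d = e / (1 + norm p)"
        have d: "d > 0" "d * norm p \<le> e" using e(1) by (auto simp: d_def divide_simps add_pos_nonneg)
        have "x - d *\<^sub>R p \<in> cball x e" using d by (simp add: dist_norm)
        from subsetD[OF e(2) this] obtain t where t: "t > 0" "t *\<^sub>R (x - d *\<^sub>R p) \<in> K" by blast
        have td: "t * d > 0" using t d by simp
        have "(1 / (1 + t * d)) *\<^sub>R (t *\<^sub>R (x - d *\<^sub>R p) + (t * d) *\<^sub>R p) \<in> interior K"
          by (rule convex_mix_in_interior[OF conv p t(2) td])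
        then have "(t / (1 + t * d)) *\<^sub>R x \<in> interior K" by (simp add: scaleR_diff_right)
        then have "x \<in> inner_directions K"
          using td t(1) unfolding inner_directions_def by (intro CollectI exI[of _ "t / (1 + t * d)"]) auto
        then show False using x by simp
      qed
      then show "x \<in> frontier ?F" using x closure_subset[of ?F] by (auto simp: frontier_def)
    qed
    ultimately show ?thesis by (rule negligible_subset)
  qed
  then show ?thesis using sets by (auto simp: negligible_iff_emeasure0 null_sets_def)
qed

lemma AE_smooth_direction:
  fixes K :: "(real^'n) set"
  assumes K: "K \<in> convex_bodies_o"
  shows "AE u in sphere_lebesgue. radial_fun K u = 0 \<or> u \<in> smooth_directions K"
proof -
  have sc: "x = norm x *\<^sub>R sgn x" for x :: "real^'n" by (cases "x = 0") (simp_all add: sgn_div_norm)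
  have "AE u in sphere_lebesgue. u \<notin> {x. \<exists>t>0. t *\<^sub>R x \<in> K} - inner_directions K"
  proof (rule AE_sphere_lebesgue_not_in_cone[OF null_set_boundary_directions[OF K]])
    fix x :: "real^'n" assume x0: "x \<noteq> 0" and "sgn x \<in> {x. \<exists>t>0. t *\<^sub>R x \<in> K} - inner_directions K"
    then obtain t where t: "t > 0" "t *\<^sub>R sgn x \<in> K" and no: "\<And>t. t > 0 \<Longrightarrow> t *\<^sub>R sgn x \<notin> interior K"
      by (auto simp: inner_directions_def)
    have "(t / norm x) *\<^sub>R x \<in> K" using t(2) by (simp add: sgn_div_norm divide_inverse_commute mult.commute)
    moreover have "s *\<^sub>R x \<notin> interior K" if "s > 0" for s
      using no[of "s * norm x"] that x0 by (metis mult_pos_pos sc scaleR_scaleR zero_less_norm_iff)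
    ultimately show "x \<in> {x. \<exists>t>0. t *\<^sub>R x \<in> K} - inner_directions K"
      using t(1) x0 by (auto simp: inner_directions_def intro!: exI[of _ "t / norm x"])
  qed
  moreover have "AE u in sphere_lebesgue. u \<notin> rough_directions K"
  proof (rule AE_sphere_lebesgue_not_in_cone[OF null_set_rough_directions])
    fix x :: "real^'n" assume "x \<noteq> 0" "sgn x \<in> rough_directions K"
    moreover have "maximizers C (sgn x) = maximizers C x" for C
      using \<open>x \<noteq> 0\<close> by (simp add: maximizers_def sgn_div_norm)
    ultimately show "x \<in> rough_directions K" by (simp add: rough_directions_def)
  qed
  ultimately show ?thesis
    using AE_space
  proof eventually_elim
    case (elim u)
    then show ?case
      using radial_fun_zero_outside_cone[OF K, of u] by (auto simp: smooth_directions_def)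
  qed
qed

text \<open>
  A point of the ray in the interior of \<open>K\<close> can be moved a little in the direction \<open>v\<close> without leaving
  \<open>K\<close>; comparing it with the boundary point shows that \<open>v\<close> makes an acute angle with \<open>u\<close>.
\<close>

lemma outer_normal_inner_pos:
  assumes K: "K \<in> convex_bodies_o" and u: "norm u = 1" "u \<in> inner_directions K"
    and v: "v \<in> normal_cone_at K (radial_fun K u *\<^sub>R u)" "v \<noteq> 0"
  shows "0 < radial_fun K u * (v \<bullet> u)"
proof -
  let ?r = "radial_fun K u"
  obtain t where t: "t > 0" "t *\<^sub>R u \<in> interior K" using u(2) by (auto simp: inner_directions_def)
  obtain e where e: "e > 0" "cball (t *\<^sub>R u) e \<subseteq> K" using t(2) by (auto simp: mem_interior_cball)
  define d where "d = e / norm v"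
  have d: "d > 0" using e v(2) by (simp add: d_def)
  have "t *\<^sub>R u + d *\<^sub>R v \<in> K" using e v(2) by (intro subsetD[OF e(2)]) (simp add: dist_norm d_def)
  then have "v \<bullet> (t *\<^sub>R u + d *\<^sub>R v - ?r *\<^sub>R u) \<le> 0" using v(1) by (auto simp: normal_cone_at_def)
  then have 1: "d * (v \<bullet> v) \<le> (?r - t) * (v \<bullet> u)" by (simp add: algebra_simps inner_add_right inner_diff_right)
  moreover have "0 < d * (v \<bullet> v)" using d v(2) by simp
  moreover have "t \<le> ?r" using le_radial_fun_iff[OF K u(1), of t] t interior_subset by auto
  ultimately have "0 < v \<bullet> u" by (metis diff_ge_0_iff_ge less_le_trans zero_less_mult_pos mult_nonneg_nonpos not_less order.strict_trans2)
  then show ?thesis using \<open>t \<le> ?r\<close> t(1) by simp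
qed

text \<open>
  Scaled so that \<open>v \<bullet> (\<rho>\<^sub>K(u) u) = 1\<close>, a normal \<open>v\<close> belongs to the polar set.  On the polar set the
  functional \<open>u\<close> is at most \<open>1 / \<rho>\<^sub>K(u)\<close>, and \<open>v\<close> attains this bound.
\<close>

lemma normal_gives_maximizer:
  assumes K: "K \<in> convex_bodies_o" and u: "norm u = 1" "u \<in> inner_directions K"
    and v: "v \<in> normal_cone_at K (radial_fun K u *\<^sub>R u)" "v \<noteq> 0"
  shows "v /\<^sub>R (radial_fun K u * (v \<bullet> u)) \<in> maximizers (polar K) u"
proof -
  let ?r = "radial_fun K u" let ?c = "?r * (v \<bullet> u)"
  have c: "?c > 0" by (rule outer_normal_inner_pos[OF assms])
  have r: "?r > 0" using c radial_fun_nonneg[OF K u(1)] by (simp add: zero_less_mult_iff)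
  have "v \<bullet> x \<le> ?c" if "x \<in> K" for x
    using v(1) that by (auto simp: normal_cone_at_def inner_diff_right)
  then have "(v /\<^sub>R ?c) \<bullet> x \<le> 1" if "x \<in> K" for x
    using that c by (simp add: divide_simps)
  then have "v /\<^sub>R ?c \<in> polar K" by (simp add: polar_def)
  moreover have "z \<bullet> u \<le> (v /\<^sub>R ?c) \<bullet> u" if "z \<in> polar K" for z
  proof -
    have "z \<bullet> (?r *\<^sub>R u) \<le> 1" using that radial_fun_in[OF K u(1)] unfolding polar_def by blast
    then have "z \<bullet> u \<le> 1 / ?r" using r by (simp add: field_simps)
    also have "\<dots> = (v /\<^sub>R ?c) \<bullet> u" using zero_less_mult_pos[OF c r] r by (simp add: field_simps)
    finally show ?thesis .
  qed
  ultimately show ?thesis by (simp add: maximizers_def)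
qed

lemma unit_normal_unique:
  assumes K: "K \<in> convex_bodies_o" and u: "norm u = 1" "u \<in> smooth_directions K"
    and v: "v \<in> normal_cone_at K (radial_fun K u *\<^sub>R u)" "norm v = 1"
    and w: "w \<in> normal_cone_at K (radial_fun K u *\<^sub>R u)" "norm w = 1"
  shows "v = w"
proof -
  let ?r = "radial_fun K u"
  have ui: "u \<in> inner_directions K" "u \<notin> rough_directions K" using u(2) by (auto simp: smooth_directions_def)
  have v0: "v \<noteq> 0" and w0: "w \<noteq> 0" using v w by auto
  have eq: "v /\<^sub>R (?r * (v \<bullet> u)) = w /\<^sub>R (?r * (w \<bullet> u))"
    using normal_gives_maximizer[OF K u(1) ui(1) v(1) v0] normal_gives_maximizer[OF K u(1) ui(1) w(1) w0] ui(2)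
    by (auto simp: rough_directions_def)
  have sgn: "sgn (x /\<^sub>R c) = x" if "norm x = 1" "0 < c" for x :: "real^'n" and c :: real
    using that by (simp add: sgn_scaleR sgn_div_norm)
  have "v = sgn (v /\<^sub>R (?r * (v \<bullet> u)))"
    by (rule sgn[symmetric, OF v(2) outer_normal_inner_pos[OF K u(1) ui(1) v(1) v0]])
  also have "\<dots> = w" unfolding eq
    by (rule sgn[OF w(2) outer_normal_inner_pos[OF K u(1) ui(1) w(1) w0]])
  finally show ?thesis .
qed

lemma unit_normal_exists:
  assumes K: "K \<in> convex_bodies_o" and u: "norm u = 1" "u \<in> inner_directions K"
  obtains v where "v \<in> normal_cone_at K (radial_fun K u *\<^sub>R u)" "norm v = 1"
proof -
  let ?z = "radial_fun K u *\<^sub>R u"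
  have int: "interior K \<noteq> {}" using u(2) by (auto simp: inner_directions_def)
  have "?z \<notin> interior K"
  proof
    assume "?z \<in> interior K"
    then obtain e where e: "e > 0" "cball ?z e \<subseteq> K" by (auto simp: mem_interior_cball)
    have "(radial_fun K u + e) *\<^sub>R u \<in> K"
      using e u(1) by (intro subsetD[OF e(2)]) (simp add: dist_norm scaleR_add_left)
    then have "radial_fun K u + e \<le> radial_fun K u"
      using e(1) radial_fun_nonneg[OF K u(1)] le_radial_fun_iff[OF K u(1), of "radial_fun K u + e"] by simp
    then show False using e(1) by simp
  qed
  then have "?z \<notin> rel_interior K" using interior_rel_interior_gen[of K] int 
    by (simp add: rel_interior_nonempty_interior)
  then obtain a where a: "a \<noteq> 0" "\<And>y. y \<in> K \<Longrightarrow> a \<bullet> ?z \<le> a \<bullet> y"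
    using supporting_hyperplane_rel_boundary[OF convex_bodies_oD(2)[OF K] radial_fun_in[OF K u(1)]] by metis
  show ?thesis
  proof
    show "(- a) /\<^sub>R norm a \<in> normal_cone_at K ?z"
      using a by (auto simp: normal_cone_at_def inner_diff_right divide_simps)
    show "norm ((- a) /\<^sub>R norm a) = 1" using a(1) by simp
  qed
qed

text \<open>
  Outside the smooth directions the value is an arbitrary unit vector, so that the map goes from the
  sphere to the sphere everywhere.
\<close>

definition gauss_map :: "(real^'n) set \<Rightarrow> real^'n \<Rightarrow> real^'n" where
  "gauss_map K u = (if u \<in> smooth_directions K
     then SOME v. v \<in> normal_cone_at K (radial_fun K u *\<^sub>R u) \<and> norm v = 1
     else SOME v. norm v = 1)"

lemma gauss_map_smooth:
  assumes K: "K \<in> convex_bodies_o" and u: "norm u = 1" "u \<in> smooth_directions K"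
  shows "gauss_map K u \<in> normal_cone_at K (radial_fun K u *\<^sub>R u)" "norm (gauss_map K u) = 1"
    and "v \<in> normal_cone_at K (radial_fun K u *\<^sub>R u) \<Longrightarrow> norm v = 1 \<Longrightarrow> v = gauss_map K u"
proof -
  have "u \<in> inner_directions K" using u(2) by (simp add: smooth_directions_def)
  from unit_normal_exists[OF K u(1) this]
  have "\<exists>v. v \<in> normal_cone_at K (radial_fun K u *\<^sub>R u) \<and> norm v = 1" by blast
  from someI_ex[OF this]
  show *: "gauss_map K u \<in> normal_cone_at K (radial_fun K u *\<^sub>R u)" "norm (gauss_map K u) = 1"
    using u(2) by (auto simp: gauss_map_def)
  show "v \<in> normal_cone_at K (radial_fun K u *\<^sub>R u) \<Longrightarrow> norm v = 1 \<Longrightarrow> v = gauss_map K u"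
    by (rule unit_normal_unique[OF K u _ _ *])
qed

lemma norm_gauss_map:
  assumes K: "K \<in> convex_bodies_o" and u: "norm u = 1" shows "norm (gauss_map K u) = 1"
proof (cases "u \<in> smooth_directions K")
  case True then show ?thesis by (rule gauss_map_smooth[OF K u])
next
  case False
  have "norm (SOME v::real^'n. norm v = 1) = 1" by (rule someI_ex) (metis vector_choose_size zero_le_one)
  then show ?thesis using False by (simp add: gauss_map_def)
qed

text \<open>
  A projection along the compact set \<open>D\<close> of normals.
\<close>

lemma closed_points_with_normal:
  assumes "compact D"
  shows "closed {z. \<exists>v\<in>D. v \<in> normal_cone_at K z}"
proof -
  have "{(v, z). \<forall>x\<in>K. v \<bullet> (x - z) \<le> 0} = (\<Inter>x\<in>K. {p. fst p \<bullet> (x - snd p) \<le> 0})" by auto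
  also have "closed \<dots>" by (intro closed_INT ballI closed_Collect_le continuous_intros)
  finally have "closed {z. \<exists>v. v \<in> D \<and> (v, z) \<in> {(v, z). \<forall>x\<in>K. v \<bullet> (x - z) \<le> 0}}"
    by (rule closed_compact_projection[OF assms])
  then show ?thesis by (simp add: normal_cone_at_def Bex_def)
qed

text \<open>
  By uniqueness of the normal, the preimage of a closed set \<open>D\<close> among the smooth directions consists of
  those \<open>u\<close> for which \<open>\<rho>\<^sub>K(u) u\<close> belongs to the closed set of points with a unit normal in \<open>D\<close>.
\<close>

lemma measurable_gauss_map:
  assumes K: "K \<in> convex_bodies_o"
  shows "gauss_map K \<in> measurable sphere_borel (sphere_borel :: (real^'n) measure)"
proof (rule measurable_restrict_space2)
  let ?S = "sphere_borel :: (real^'n) measure"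
  show "gauss_map K \<in> space ?S \<rightarrow> sphere 0 1"
    using norm_gauss_map[OF K] by (auto simp: space_restrict_space)
  note [measurable] = borel_measurable_radial_fun[OF K]
  have [measurable]: "(\<lambda>u. radial_fun K u *\<^sub>R u) \<in> borel_measurable ?S"
    by (intro borel_measurable_scaleR borel_measurable_radial_fun[OF K] measurable_restrict_space1) simp
  have closed: "gauss_map K -` D \<inter> space ?S \<in> sets ?S" if D: "closed D" for D
  proof -
    let ?Z = "{z. \<exists>v\<in>D \<inter> sphere 0 1. v \<in> normal_cone_at K z}"
    have "closed ?Z" using D by (intro closed_points_with_normal closed_Int_compact) auto
    then have Z: "(\<lambda>u. radial_fun K u *\<^sub>R u) -` ?Z \<inter> space ?S \<in> sets ?S" by (intro measurable_sets[where A = borel]) auto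
    have S: "smooth_directions K \<inter> space ?S \<in> sets ?S"
      using sets_smooth_directions[of K]
      by (auto simp: sets_restrict_space space_restrict_space intro!: image_eqI[where x = "smooth_directions K"])
    have "gauss_map K -` D \<inter> space ?S =
        ((\<lambda>u. radial_fun K u *\<^sub>R u) -` ?Z \<inter> space ?S) \<inter> (smooth_directions K \<inter> space ?S) \<union>
        (if (SOME v::real^'n. norm v = 1) \<in> D then space ?S - (smooth_directions K \<inter> space ?S) else {})" (is "?L = ?R")
    proof (rule set_eqI)
      fix u
      show "u \<in> ?L \<longleftrightarrow> u \<in> ?R"
      proof (cases "u \<in> smooth_directions K \<and> norm u = 1")
        case True
        then have u: "norm u = 1" "u \<in> smooth_directions K" by auto
        have "gauss_map K u \<in> D \<longleftrightarrow> radial_fun K u *\<^sub>R u \<in> ?Z"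
        proof
          assume "gauss_map K u \<in> D"
          then show "radial_fun K u *\<^sub>R u \<in> ?Z"
            using gauss_map_smooth(1,2)[OF K u] by (intro CollectI bexI[of _ "gauss_map K u"]) auto
        next
          assume "radial_fun K u *\<^sub>R u \<in> ?Z"
          then obtain v where v: "v \<in> D" "norm v = 1" "v \<in> normal_cone_at K (radial_fun K u *\<^sub>R u)" by auto
          then show "gauss_map K u \<in> D" using gauss_map_smooth(3)[OF K u v(3,2)] by simp
        qed
        then show ?thesis using True by (auto simp: space_restrict_space)
      next
        case False
        then show ?thesis by (auto simp: space_restrict_space gauss_map_def)
      qed
    qed
    also have "\<dots> \<in> sets ?S"
    proof -
      have "(if c then space ?S - (smooth_directions K \<inter> space ?S) else {}) \<in> sets ?S" for c
        by (cases c) (simp_all only: if_True if_False sets.compl_sets[OF S] sets.empty_sets)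
      then show ?thesis by (intro sets.Un sets.Int Z S)
    qed
    finally show ?thesis .
  qed
  show "gauss_map K \<in> borel_measurable ?S"
  proof (rule borel_measurableI)
    fix U :: "(real^'n) set" assume "open U"
    then have "closed (- U)" by auto
    have "gauss_map K -` U \<inter> space ?S = space ?S - (gauss_map K -` (- U) \<inter> space ?S)" by auto
    also have "\<dots> \<in> sets ?S" by (rule sets.compl_sets[OF closed[OF \<open>closed (- U)\<close>]])
    finally show "gauss_map K -` U \<inter> space ?S \<in> sets ?S" .
  qed
qed

context hausdorff_convergence begin

text \<open>
  Otherwise some subsequence of normals stays away from the normal of \<open>L\<close>, and by compactness of the
  sphere it may be assumed to converge.  The inequalities that define normals pass to the limit, so
  the limit is a unit normal of \<open>L\<close> at the same boundary point, contradicting uniqueness.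
\<close>

lemma gauss_map_tendsto:
  assumes u: "norm u = 1" "u \<in> smooth_directions L"
    and ev: "\<And>j. radial_fun (K j) u = 0 \<or> u \<in> smooth_directions (K j)"
  shows "(\<lambda>j. gauss_map (K j) u) \<longlonglongrightarrow> gauss_map L u"
proof (rule ccontr)
  assume "\<not> ?thesis"
  then obtain e where e: "e > 0" "\<And>N. \<exists>j\<ge>N. e \<le> dist (gauss_map (K j) u) (gauss_map L u)"
    by (auto simp: LIMSEQ_def not_less)
  have "infinite {j. e \<le> dist (gauss_map (K j) u) (gauss_map L u)}"
    using e(2) by (auto simp: infinite_nat_iff_unbounded_le)
  then obtain s :: "nat \<Rightarrow> nat" where s: "strict_mono s" "\<And>i. e \<le> dist (gauss_map (K (s i)) u) (gauss_map L u)"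
    using infinite_enumerate by blast
  have "compact (sphere (0::real^'n) 1)" by simp
  moreover have "\<forall>i. gauss_map (K (s i)) u \<in> sphere 0 1" using norm_gauss_map[OF K u(1)] by simp
  ultimately obtain v r where v: "v \<in> sphere 0 1" "strict_mono r" "(\<lambda>i. gauss_map (K (s (r i))) u) \<longlonglongrightarrow> v"
    unfolding compact_def o_def by meson
  obtain t where t: "t > 0" "t *\<^sub>R u \<in> interior L"
    using u(2) by (auto simp: smooth_directions_def inner_directions_def)
  let ?q = "\<lambda>i. s (r i)"
  have q: "strict_mono ?q" using strict_mono_o[OF s(1) v(2)] by (simp add: o_def)
  have rad: "(\<lambda>j. radial_fun (K j) u) \<longlonglongrightarrow> radial_fun L u" by (rule radial_fun_tendsto[OF u(1) t])
  have pos: "0 < radial_fun L u"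
    using le_radial_fun_iff[OF L u(1), of t] t interior_subset by force
  have evpos: "\<forall>\<^sub>F j in sequentially. 0 < radial_fun (K j) u" by (rule order_tendstoD(1)[OF rad pos])
  have "v \<in> normal_cone_at L (radial_fun L u *\<^sub>R u)"
    unfolding normal_cone_at_def
  proof (intro CollectI ballI)
    fix x assume "x \<in> L"
    then obtain y where y: "\<And>j. y j \<in> K j" "y \<longlonglongrightarrow> x" using approximating_sequence by blast
    have lim: "(\<lambda>i. gauss_map (K (?q i)) u \<bullet> (y (?q i) - radial_fun (K (?q i)) u *\<^sub>R u)) \<longlonglongrightarrow> v \<bullet> (x - radial_fun L u *\<^sub>R u)"
      using LIMSEQ_subseq_LIMSEQ[OF y(2) q] LIMSEQ_subseq_LIMSEQ[OF rad q] v(3)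
      by (intro tendsto_intros) (simp_all add: o_def)
    have "\<forall>\<^sub>F j in sequentially. gauss_map (K j) u \<bullet> (y j - radial_fun (K j) u *\<^sub>R u) \<le> 0"
      using evpos
    proof eventually_elim
      case (elim j)
      then have "u \<in> smooth_directions (K j)" using ev[of j] by simp
      from gauss_map_smooth(1)[OF K u(1) this] show ?case using y(1) by (simp add: normal_cone_at_def)
    qed
    then have "\<forall>\<^sub>F i in sequentially. gauss_map (K (?q i)) u \<bullet> (y (?q i) - radial_fun (K (?q i)) u *\<^sub>R u) \<le> 0"
      by (rule eventually_subseq[OF q])
    then show "v \<bullet> (x - radial_fun L u *\<^sub>R u) \<le> 0" using tendsto_upperbound[OF lim] by simp
  qed
  then have veq: "v = gauss_map L u" using v(1) by (intro gauss_map_smooth(3)[OF L u]) auto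
  have "(\<lambda>i. dist (gauss_map (K (?q i)) u) (gauss_map L u)) \<longlonglongrightarrow> 0"
    using tendsto_dist_iff[THEN iffD1, OF v(3)] unfolding veq .
  from order_tendstoD(2)[OF this e(1)] obtain i where "dist (gauss_map (K (?q i)) u) (gauss_map L u) < e"
    by (auto simp: eventually_sequentially)
  then show False using s(2)[of "r i"] by simp
qed

end

section \<open>The affine dual curvature measure and its weak continuity\<close>

definition curvature_density :: "nat \<Rightarrow> (real^'n) set \<Rightarrow> real^'n \<Rightarrow> real" where
  "curvature_density m K u = radial_fun K u ^ m * section_radon m K u"

lemma measurable_sphere_lebesgue:
  assumes "f \<in> measurable (sphere_borel :: (real^'n) measure) N"
  shows "f \<in> measurable sphere_lebesgue N"
proof (rule measurableI)
  show "f x \<in> space N" if "x \<in> space sphere_lebesgue" for x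
    using measurable_space[OF assms] that by (simp add: space_restrict_space)
  show "f -` A \<inter> space sphere_lebesgue \<in> sets sphere_lebesgue" if "A \<in> sets N" for A
    using sets_sphere_lebesgue_borel[OF measurable_sets[OF assms that]] by (simp add: space_restrict_space)
qed

lemma borel_measurable_curvature_density:
  assumes m: "m \<in> {1..CARD('n) - 1}" and K: "K \<in> convex_bodies_o"
  shows "curvature_density m K \<in> borel_measurable (sphere_borel :: (real^'n) measure)"
proof -
  have "K \<in> sets borel" using convex_bodies_oD(4)[OF K] by simp
  note [measurable] = borel_measurable_section_radon[OF m this] borel_measurable_radial_fun[OF K]
  show ?thesis unfolding curvature_density_def[abs_def] by measurable
qed

lemma curvature_density_bounds:
  fixes u :: "real^'n"
  assumes u: "norm u = 1" and m: "m \<in> {1..CARD('n) - 1}" and K: "K \<in> convex_bodies_o" "K \<subseteq> cball 0 R"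
  shows "0 \<le> curvature_density m K u"
    and "curvature_density m K u \<le> R ^ m * (radon_const CARD('n) m * exp (pi * R\<^sup>2) ^ (CARD('n) - 1))"
proof -
  have borel: "K \<in> sets borel" using convex_bodies_oD(4)[OF K(1)] by simp
  note b = section_radon_bounds[OF u m borel K(2)] and r = radial_fun_nonneg[OF K(1) u] radial_fun_le[OF K(1) u K(2)]
  show "0 \<le> curvature_density m K u"
    unfolding curvature_density_def by (intro mult_nonneg_nonneg zero_le_power r b)
  show "curvature_density m K u \<le> R ^ m * (radon_const CARD('n) m * exp (pi * R\<^sup>2) ^ (CARD('n) - 1))"
    unfolding curvature_density_def
  proof (rule mult_mono)
    show "radial_fun K u ^ m \<le> R ^ m" by (rule power_mono[OF r(2,1)])
    show "0 \<le> R ^ m" by (rule zero_le_power[OF order_trans[OF r]])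
  qed (rule b)+
qed

lemma curvature_density_nonneg:
  fixes u :: "real^'n"
  assumes u: "norm u = 1" and m: "m \<in> {1..CARD('n) - 1}" and K: "K \<in> convex_bodies_o"
  shows "0 \<le> curvature_density m K u"
proof -
  obtain R where "\<And>x. x \<in> K \<Longrightarrow> norm x \<le> R"
    using convex_bodies_oD(5)[OF K] unfolding bounded_iff by metis
  then have "K \<subseteq> cball 0 R" by auto
  then show ?thesis by (rule curvature_density_bounds(1)[OF u m K])
qed

text \<open>
  Directions with \<open>\<rho>\<^sub>K(u) = 0\<close> carry no mass because \<open>m \<ge> 1\<close>, and in almost all other directions
  membership in the reverse radial Gauss image of \<open>\<eta>\<close> means that the unique unit normal is in \<open>\<eta>\<close>.
  In particular the set function that defines the measure is countably additive.
\<close>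

lemma affine_dual_curvature_measure_eq_distr:
  assumes m: "m \<in> {1..CARD('n) - 1}" and K: "K \<in> convex_bodies_o" and int: "interior K \<noteq> {}"
  shows "affine_dual_curvature_measure m K =
    distr (density sphere_lebesgue (\<lambda>u. ennreal (curvature_density m K u))) (sphere_borel :: (real^'n) measure) (gauss_map K)"
    (is "_ = ?M")
proof -
  let ?S = "sphere_borel :: (real^'n) measure"
  let ?w = "\<lambda>u. ennreal (curvature_density m K u)"
  note g = measurable_sphere_lebesgue[OF measurable_gauss_map[OF K]]
  have [measurable]: "?w \<in> borel_measurable sphere_lebesgue"
    using measurable_sphere_lebesgue[OF borel_measurable_curvature_density[OF m K]] by measurable
  have eq: "(\<integral>\<^sup>+u\<in>reverse_radial_gauss_image K \<eta>. ?w u \<partial>sphere_lebesgue) = emeasure ?M \<eta>"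
    if \<eta>: "\<eta> \<in> sets ?S" for \<eta>
  proof -
    have \<eta>S: "\<eta> \<subseteq> sphere 0 1" using sets.sets_into_space[OF \<eta>] by (simp add: space_restrict_space)
    have A: "gauss_map K -` \<eta> \<inter> sphere 0 1 \<in> sets sphere_lebesgue" using measurable_sets[OF g \<eta>] by simp
    have "emeasure ?M \<eta> = (\<integral>\<^sup>+u\<in>gauss_map K -` \<eta> \<inter> sphere 0 1. ?w u \<partial>sphere_lebesgue)"
      using g \<eta> A by (subst emeasure_distr) (simp_all add: emeasure_density)
    also have "\<dots> = (\<integral>\<^sup>+u\<in>reverse_radial_gauss_image K \<eta>. ?w u \<partial>sphere_lebesgue)"
    proof (rule nn_integral_cong_AE)
      show "AE u in sphere_lebesgue. ?w u * indicator (gauss_map K -` \<eta> \<inter> sphere 0 1) u =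
          ?w u * indicator (reverse_radial_gauss_image K \<eta>) u"
        using AE_smooth_direction[OF K] AE_space
      proof eventually_elim
        case (elim u)
        have u: "norm u = 1" using elim by simp
        show ?case
        proof (cases "radial_fun K u = 0")
          case True
          then show ?thesis using m by (simp add: curvature_density_def power_0_left)
        next
          case False
          then have sm: "u \<in> smooth_directions K" using elim by simp
          have "gauss_map K u \<in> \<eta> \<longleftrightarrow> normal_cone_at K (radial_fun K u *\<^sub>R u) \<inter> \<eta> \<noteq> {}"
          proof
            assume "gauss_map K u \<in> \<eta>"
            then show "normal_cone_at K (radial_fun K u *\<^sub>R u) \<inter> \<eta> \<noteq> {}"
              using gauss_map_smooth(1)[OF K u sm] by auto
          next
            assume "normal_cone_at K (radial_fun K u *\<^sub>R u) \<inter> \<eta> \<noteq> {}"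
            then obtain v where v: "v \<in> normal_cone_at K (radial_fun K u *\<^sub>R u)" "v \<in> \<eta>" by auto
            moreover have "norm v = 1" using v(2) \<eta>S by auto
            ultimately show "gauss_map K u \<in> \<eta>" using gauss_map_smooth(3)[OF K u sm, of v] by simp
          qed
          then show ?thesis using u by (auto simp: reverse_radial_gauss_image_def split: split_indicator)
        qed
      qed
    qed
    finally show ?thesis by simp
  qed
  have "\<not> aff_dim K \<le> int CARD('n) - 1"
    using aff_dim_open[OF open_interior int] aff_dim_subset[OF interior_subset[of K]] by simp
  then have "affine_dual_curvature_measure m K = measure_of (sphere 0 1) (sets ?S)
     (\<lambda>\<eta>. \<integral>\<^sup>+u\<in>reverse_radial_gauss_image K \<eta>. ?w u \<partial>sphere_lebesgue)"
    by (simp add: affine_dual_curvature_measure_def curvature_density_def)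
  also have "\<dots> = measure_of (sphere 0 1) (sets ?S) (emeasure ?M)"
  proof (rule measure_of_eq)
    show "sets ?S \<subseteq> Pow (sphere 0 1)"
      using sets.space_closed[of ?S] by (simp add: space_restrict_space)
    have "sigma_sets (sphere 0 1) (sets ?S) = sets ?S"
      using sets.sigma_sets_eq[of ?S] by (simp add: space_restrict_space)
    then show "(\<integral>\<^sup>+u\<in>reverse_radial_gauss_image K \<eta>. ?w u \<partial>sphere_lebesgue) = emeasure ?M \<eta>"
      if "\<eta> \<in> sigma_sets (sphere 0 1) (sets ?S)" for \<eta>
      using that by (intro eq) simp
  qed
  also have "\<dots> = ?M"
    using measure_of_of_measure[of ?M] by (simp add: space_restrict_space)
  finally show ?thesis .
qed

text \<open>
  For bodies without interior points both sides vanish, since almost every radius is \<open>0\<close>.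
\<close>

lemma integral_affine_dual_curvature_measure:
  fixes f :: "real^'n \<Rightarrow> real"
  assumes m: "m \<in> {1..CARD('n) - 1}" and K: "K \<in> convex_bodies_o" and f: "continuous_on (sphere 0 1) f"
  shows "(\<integral>v. f v \<partial>affine_dual_curvature_measure m K)
    = (\<integral>u. curvature_density m K u * f (gauss_map K u) \<partial>sphere_lebesgue)"
proof -
  let ?S = "sphere_borel :: (real^'n) measure"
  note g = measurable_sphere_lebesgue[OF measurable_gauss_map[OF K]]
  have fS: "f \<in> borel_measurable ?S" by (rule borel_measurable_continuous_on_restrict[OF f])
  have w: "curvature_density m K \<in> borel_measurable sphere_lebesgue"
    by (rule measurable_sphere_lebesgue[OF borel_measurable_curvature_density[OF m K]])
  have fg: "(\<lambda>u. f (gauss_map K u)) \<in> borel_measurable sphere_lebesgue" by (rule measurable_compose[OF g fS])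
  show ?thesis
  proof (cases "interior K = {}")
    case False
    let ?D = "density sphere_lebesgue (\<lambda>u. ennreal (curvature_density m K u))"
    have "(\<integral>v. f v \<partial>affine_dual_curvature_measure m K) = (\<integral>u. f (gauss_map K u) \<partial>?D)"
      unfolding affine_dual_curvature_measure_eq_distr[OF m K False]
      using g fS by (intro integral_distr) (simp_all cong: measurable_cong_sets)
    also have "\<dots> = (\<integral>u. curvature_density m K u * f (gauss_map K u) \<partial>sphere_lebesgue)"
    proof (subst integral_density[OF fg w])
      show "AE u in sphere_lebesgue. 0 \<le> curvature_density m K u"
        by (rule AE_I2) (simp add: curvature_density_nonneg[OF _ m K])
    qed simp
    finally show ?thesis .
  next
    case True
    obtain a b where ab: "a \<noteq> 0" "K \<subseteq> {x. a \<bullet> x = b}"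
      using empty_interior_subset_hyperplane[OF convex_bodies_oD(2)[OF K] True] by blast
    have "aff_dim K \<le> int CARD('n) - 1"
      using aff_dim_subset[OF ab(2)] aff_dim_hyperplane[OF ab(1), of b] by simp
    then have "affine_dual_curvature_measure m K = null_measure ?S"
      by (simp add: affine_dual_curvature_measure_def)
    then have "(\<integral>v. f v \<partial>affine_dual_curvature_measure m K) = 0"
      by simp
    moreover have "(\<integral>u. curvature_density m K u * f (gauss_map K u) \<partial>sphere_lebesgue) = 0"
    proof (rule integral_eq_zero_AE)
      show "AE u in sphere_lebesgue. curvature_density m K u * f (gauss_map K u) = 0"
        using AE_smooth_direction[OF K]
        by eventually_elim (use True m in \<open>auto simp: smooth_directions_def inner_directions_def curvature_density_def power_0_left\<close>)
    qed
    ultimately show ?thesis by simp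
  qed
qed

theorem proposition3p7:
  fixes K :: "nat \<Rightarrow> (real^'n) set" and L :: "(real^'n) set" and m :: nat
  assumes "CARD('n) \<ge> 2"
    and "m \<in> {1..CARD('n) - 1}"
    and "\<And>j. K j \<in> convex_bodies_o"
    and "L \<in> convex_bodies_o"
    and "(\<lambda>j. hausdorff_dist (K j) L) \<longlonglongrightarrow> 0"
  shows "weakly_converges_on_sphere (\<lambda>j. affine_dual_curvature_measure m (K j))
           (affine_dual_curvature_measure m L)"
  unfolding weakly_converges_on_sphere_def
proof (intro allI impI)
  fix f :: "real^'n \<Rightarrow> real" assume f: "continuous_on (sphere 0 1) f"
  note m = assms(2)
  interpret hausdorff_convergence K L by standard (rule assms)+
  interpret finite_measure "sphere_lebesgue :: (real^'n) measure" by (rule finite_measure_sphere_lebesgue)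
  obtain R where R: "R > 0" "\<And>j. K j \<subseteq> cball 0 R" "L \<subseteq> cball 0 R" using uniformly_bounded by blast
  have "bounded (f ` sphere 0 1)"
    by (intro compact_imp_bounded compact_continuous_image f) simp
  then obtain B where "\<forall>y\<in>f ` sphere 0 1. norm y \<le> B" unfolding bounded_iff by blast
  then have B: "\<bar>f v\<bar> \<le> B" if "v \<in> sphere 0 1" for v using that by auto
  let ?C = "R ^ m * (radon_const CARD('n) m * exp (pi * R\<^sup>2) ^ (CARD('n) - 1))"
  have fg: "(\<lambda>u. curvature_density m M u * f (gauss_map M u)) \<in> borel_measurable sphere_lebesgue"
    if "M \<in> convex_bodies_o" for M
    by (intro borel_measurable_times measurable_sphere_lebesgue[OF borel_measurable_curvature_density[OF m that]]
        measurable_compose[OF measurable_sphere_lebesgue[OF measurable_gauss_map[OF that]]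
          borel_measurable_continuous_on_restrict[OF f]])
  show "(\<lambda>j. \<integral>v. f v \<partial>affine_dual_curvature_measure m (K j)) \<longlonglongrightarrow> (\<integral>v. f v \<partial>affine_dual_curvature_measure m L)"
    unfolding integral_affine_dual_curvature_measure[OF m K f] integral_affine_dual_curvature_measure[OF m L f]
  proof (rule integral_dominated_convergence[where w = "\<lambda>_. ?C * B"])
    show "AE u in sphere_lebesgue. norm (curvature_density m (K j) u * f (gauss_map (K j) u)) \<le> ?C * B" for j
      using AE_space
    proof eventually_elim
      case (elim u)
      then have u: "norm u = 1" by simp
      note b = curvature_density_bounds[OF u m K R(2), of j]
      have "\<bar>f (gauss_map (K j) u)\<bar> \<le> B" using norm_gauss_map[OF K u] by (intro B) simp
      then show ?case using b by (simp only: real_norm_def abs_mult) (intro mult_mono, auto)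
    qed
    have "AE u in sphere_lebesgue. \<forall>j. radial_fun (K j) u = 0 \<or> u \<in> smooth_directions (K j)"
      using AE_smooth_direction[OF K] by (simp add: AE_all_countable)
    with AE_smooth_direction[OF L] AE_space
    show "AE u in sphere_lebesgue. (\<lambda>j. curvature_density m (K j) u * f (gauss_map (K j) u))
        \<longlonglongrightarrow> curvature_density m L u * f (gauss_map L u)"
    proof eventually_elim
      case (elim u)
      then have u: "norm u = 1" by simp
      have borel: "K j \<in> sets borel" for j using convex_bodies_oD(4)[OF K] by simp
      show ?case
      proof (cases "radial_fun L u = 0")
        case True
        define c where "c = radon_const CARD('n) m * exp (pi * R\<^sup>2) ^ (CARD('n) - 1)"
        have m0: "m \<noteq> 0" using m by auto
        have "(\<lambda>j. radial_fun (K j) u ^ m * (c * B)) \<longlonglongrightarrow> 0 ^ m * (c * B)"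
          by (intro tendsto_intros radial_fun_tendsto_zero u True)
        then have "(\<lambda>j. radial_fun (K j) u ^ m * (c * B)) \<longlonglongrightarrow> 0"
          using m0 by (simp add: power_0_left)
        moreover have "norm (curvature_density m (K j) u * f (gauss_map (K j) u)) \<le> radial_fun (K j) u ^ m * (c * B)" for j
        proof -
          have "\<bar>f (gauss_map (K j) u)\<bar> \<le> B" using norm_gauss_map[OF K u] by (intro B) simp
          then show ?thesis
            using section_radon_bounds[OF u m borel R(2), of j, folded c_def] radial_fun_nonneg[OF K u, of j]
            unfolding curvature_density_def real_norm_def abs_mult mult.assoc
            by (intro mult_mono) auto
        qed
        ultimately have "(\<lambda>j. curvature_density m (K j) u * f (gauss_map (K j) u)) \<longlonglongrightarrow> 0"
          by (rule Lim_null_comparison[OF always_eventually[OF allI], rotated])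
        then show ?thesis using True m0 by (simp add: curvature_density_def power_0_left)
      next
        case False
        then have sm: "u \<in> smooth_directions L" using elim by simp
        then obtain t where t: "t > 0" "t *\<^sub>R u \<in> interior L" by (auto simp: smooth_directions_def inner_directions_def)
        have "(\<lambda>j. gauss_map (K j) u) \<longlonglongrightarrow> gauss_map L u"
          using elim by (intro gauss_map_tendsto u sm) auto
        then have "(\<lambda>j. f (gauss_map (K j) u)) \<longlonglongrightarrow> f (gauss_map L u)"
          by (rule continuous_on_tendsto_compose[OF f]) (simp_all add: norm_gauss_map K L u)
        then show ?thesis unfolding curvature_density_def
          by (intro tendsto_mult tendsto_power radial_fun_tendsto[OF u t] section_radon_tendsto[OF u m t(2)])
      qed
    qed
  qed (auto intro: fg K L)
qed

end
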